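(* Let $\alpha>1$ be rational. On $\mathbb R^6=T^*\mathbb R^3$ with coordinates $(Q^1,Q^2,Q^3,P^1,P^2,P^3)$ and its standard symplectic form, let $H_i=\frac12((Q^i)^2+(P^i)^2)$ for $i=1,2,3$ and $$Y_\alpha=\{(Q,P)\in\mathbb R^6: H_1+H_2+H_3=\tfrac12,\ H_1+\alpha H_2=\tfrac14\},$$ and let $\omega_\alpha$ be the restriction of the standard symplectic form to $Y_\alpha$. Then the coisotropic submanifold $Y_\alpha\subset\mathbb R^6$, or equivalently the pre-symplectic manifold $(Y_\alpha,\omega_\alpha)$, is obstructed.
   Context: A pre-symplectic manifold $(Y,\omega)$ is a smooth manifold of dimension $n+k$ with a closed 2-form of constant rank $2k$; $E=\ker\omega=T\mathcal F$ is tangent to the null foliation $\mathcal F$; $\Omega^\ell(\mathcal F)=\Gamma(\Lambda^\ell E^* )$ with leafwise exterior derivative $d_{\mathcal F}$; $H^\bullet(Y,\omega)$ is its cohomology. $Y_\alpha$ is a smooth 4-dimensional coisotropic submanifold whose null foliation is spanned by the Hamiltonian vector fields of $H=H_1+H_2+H_3$ and $H_\alpha=H_1+\alpha H_2$. Infinitesimal deformations of a coisotropic submanifold $Y$ are the $d_{\mathcal F}$-closed $\Gamma_1\in\Omega^1(\mathcal F)$ (with $NY\cong E^*$ via the symplectic form). The deformation (moduli) problem is called unobstructed if every class in $H^1(Y,\omega)$ is represented by some $\Gamma_1$ that is the first-order term of an actual deformation through coisotropic submanifolds (formally unobstructed: for every class in $H^1(Y,\omega)$ there is a formal power series $\Gamma=\sum_{k\ge1}\varepsilon^k\Gamma_k$,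 $\Gamma_k\in\Omega^1(\mathcal F)$, with $[\Gamma_1]$ the given class, satisfying formally in $\varepsilon$ the equation for the graph of $\Gamma$ to be coisotropic in the symplectic thickening). The latter is defined as follows: choosing a splitting $TY=G\oplus E$ with projection $p_G:TY\to E$ along $G$, put $\theta_{G,a}(\xi)=a(p_G(T\pi(\xi)))$ on $\pi:E^*\to Y$; the thickening is a neighborhood of the zero section in $E^*$ with symplectic form $\pi^*\omega-d\theta_G$. The manifold is called obstructed (respectively formally obstructed) otherwise. *)

theory Defs
  imports "HOL-Analysis.Analysis"
begin

section \<open>Smooth maps and embedded submanifolds of Euclidean spaces\<close>

fun Ck_on :: "nat \<Rightarrow> 'a::euclidean_space set \<Rightarrow> ('a \<Rightarrow> 'b::real_normed_vector) \<Rightarrow> bool" where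
  "Ck_on 0 U f \<longleftrightarrow> continuous_on U f"
| "Ck_on (Suc k) U f \<longleftrightarrow>
     (\<forall>x\<in>U. f differentiable (at x)) \<and> (\<forall>v. Ck_on k U (\<lambda>x. frechet_derivative f (at x) v))"

text \<open>\<open>smooth_on\<close> is meant for open sets; \<open>smooth_map_on\<close> is the usual notion for an arbitrary subset
  of a Euclidean space (local extendability to a smooth map on an open set).\<close>

definition smooth_on :: "'a::euclidean_space set \<Rightarrow> ('a \<Rightarrow> 'b::real_normed_vector) \<Rightarrow> bool" where
  "smooth_on U f \<longleftrightarrow> (\<forall>k. Ck_on k U f)"

definition smooth_map_on :: "'a::euclidean_space set \<Rightarrow> ('a \<Rightarrow> 'b::real_normed_vector) \<Rightarrow> bool" where
  "smooth_map_on S f \<longleftrightarrow>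
     (\<forall>x\<in>S. \<exists>U g. open U \<and> x \<in> U \<and> smooth_on U g \<and> (\<forall>y\<in>U \<inter> S. g y = f y))"

definition diffeomorphism_onto_image :: "'a::euclidean_space set \<Rightarrow> ('a \<Rightarrow> 'b::euclidean_space) \<Rightarrow> bool" where
  "diffeomorphism_onto_image S f \<longleftrightarrow>
     inj_on f S \<and> smooth_map_on S f \<and> smooth_map_on (f ` S) (inv_into S f)"

text \<open>A \<open>d\<close>-dimensional embedded submanifold is locally the zero set of a smooth submersion \<open>F\<close> onto
  a space of dimension \<open>DIM('a) - d\<close>; that space is realised as a linear subspace \<open>L\<close> of \<open>'a\<close>.\<close>

definition submanifold :: "nat \<Rightarrow> 'a::euclidean_space set \<Rightarrow> bool" where
  "submanifold d S \<longleftrightarrow>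
     (\<forall>p\<in>S. \<exists>U (F :: 'a \<Rightarrow> 'a) L.
        open U \<and> p \<in> U \<and> smooth_on U F \<and>
        subspace L \<and> dim L + d = DIM('a) \<and> F ` U \<subseteq> L \<and>
        (\<forall>x\<in>U. range (frechet_derivative F (at x)) = L) \<and>
        S \<inter> U = {x\<in>U. F x = 0})"

definition tangent_space :: "'a::euclidean_space set \<Rightarrow> 'a \<Rightarrow> 'a set" where
  "tangent_space S p =
     {v. \<exists>(c :: real \<Rightarrow> 'a) e. e > 0 \<and> smooth_on {-e<..<e} c \<and> c ` {-e<..<e} \<subseteq> S \<and>
           c 0 = p \<and> (c has_vector_derivative v) (at 0)}"

text \<open>For \<open>f\<close> smooth on \<open>S\<close> and \<open>v\<close> tangent to \<open>S\<close> at \<open>p\<close> this is the derivative of \<open>f\<close> in the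
  direction \<open>v\<close>. The derivative within \<open>S\<close> is not unique as a linear map on the ambient space, but
  its value on tangent vectors is; \<open>dir_deriv\<close> is only meaningful for those.\<close>

definition dir_deriv ::
  "'a::euclidean_space set \<Rightarrow> ('a \<Rightarrow> 'b::real_normed_vector) \<Rightarrow> 'a \<Rightarrow> 'a \<Rightarrow> 'b" where
  "dir_deriv S f p v = frechet_derivative f (at p within S) v"

section \<open>Differential forms and pre-symplectic manifolds\<close>

text \<open>Forms on \<open>S\<close> are written as families of multilinear forms on the ambient space, of which only
  the values on tangent vectors of \<open>S\<close> matter, so that a form stands for its restriction to \<open>S\<close>.
  In the exterior derivatives the vectors \<open>u v w\<close> are held constant in the ambient space; these are
  the restrictions to tangent vectors of the exterior derivatives of any smooth ambient extension.\<close>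

type_synonym 'a oneform = "'a \<Rightarrow> 'a \<Rightarrow> real"
type_synonym 'a twoform = "'a \<Rightarrow> 'a \<Rightarrow> 'a \<Rightarrow> real"

definition ext_deriv1 :: "'a::euclidean_space set \<Rightarrow> 'a oneform \<Rightarrow> 'a twoform" where
  "ext_deriv1 S \<beta> p u v =
     dir_deriv S (\<lambda>x. \<beta> x v) p u - dir_deriv S (\<lambda>x. \<beta> x u) p v"

definition ext_deriv2 ::
  "'a::euclidean_space set \<Rightarrow> 'a twoform \<Rightarrow> 'a \<Rightarrow> 'a \<Rightarrow> 'a \<Rightarrow> 'a \<Rightarrow> real" where
  "ext_deriv2 S \<omega> p u v w =
     dir_deriv S (\<lambda>x. \<omega> x v w) p u - dir_deriv S (\<lambda>x. \<omega> x u w) p v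
       + dir_deriv S (\<lambda>x. \<omega> x u v) p w"

definition closed_twoform :: "'a::euclidean_space set \<Rightarrow> 'a twoform \<Rightarrow> bool" where
  "closed_twoform S \<omega> \<longleftrightarrow>
     (\<forall>x\<in>S. bilinear (\<omega> x)) \<and>
     (\<forall>x\<in>S. \<forall>u\<in>tangent_space S x. \<omega> x u u = 0) \<and>
     (\<forall>u v. smooth_map_on S (\<lambda>x. \<omega> x u v)) \<and>
     (\<forall>x\<in>S. \<forall>u\<in>tangent_space S x. \<forall>v\<in>tangent_space S x. \<forall>w\<in>tangent_space S x.
        ext_deriv2 S \<omega> x u v w = 0)"

text \<open>The fibre at \<open>p\<close> of \<open>E\<close>, the kernel of \<open>\<omega>\<close> restricted to \<open>Y\<close>.\<close>

definition null_space :: "'a::euclidean_space set \<Rightarrow> 'a twoform \<Rightarrow> 'a \<Rightarrow> 'a set" where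
  "null_space Y \<omega> p =
     {u \<in> tangent_space Y p. \<forall>v\<in>tangent_space Y p. \<omega> p u v = 0}"

text \<open>Dimension \<open>n + k\<close> and constant rank \<open>2 * k\<close>, so that \<open>E\<close> has rank \<open>n - k\<close>.\<close>

definition presymplectic_manifold ::
  "nat \<Rightarrow> nat \<Rightarrow> 'a::euclidean_space set \<Rightarrow> 'a twoform \<Rightarrow> bool" where
  "presymplectic_manifold n k Y \<omega> \<longleftrightarrow>
     submanifold (n + k) Y \<and> closed_twoform Y \<omega> \<and>
     (\<forall>p\<in>Y. dim (null_space Y \<omega> p) + 2 * k = n + k)"

definition coisotropic_submanifold ::
  "'a::euclidean_space set \<Rightarrow> 'a twoform \<Rightarrow> 'a set \<Rightarrow> bool" where
  "coisotropic_submanifold M \<Omega> S \<longleftrightarrow>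
     S \<subseteq> M \<and> (\<exists>d. submanifold d S) \<and>
     (\<forall>p\<in>S. {u \<in> tangent_space M p. \<forall>v\<in>tangent_space S p. \<Omega> p u v = 0} \<subseteq> tangent_space S p)"

section \<open>Leafwise forms and leafwise cohomology in degree one\<close>

definition null_section :: "'a::euclidean_space set \<Rightarrow> 'a twoform \<Rightarrow> ('a \<Rightarrow> 'a) \<Rightarrow> bool" where
  "null_section Y \<omega> X \<longleftrightarrow> smooth_map_on Y X \<and> (\<forall>p\<in>Y. X p \<in> null_space Y \<omega> p)"

definition leafwise_oneform :: "'a::euclidean_space set \<Rightarrow> 'a twoform \<Rightarrow> 'a oneform \<Rightarrow> bool" where
  "leafwise_oneform Y \<omega> \<Gamma> \<longleftrightarrow>
     (\<forall>p\<in>Y. \<forall>u\<in>null_space Y \<omega> p. \<forall>v\<in>null_space Y \<omega> p. \<forall>a b.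
        \<Gamma> p (a *\<^sub>R u + b *\<^sub>R v) = a * \<Gamma> p u + b * \<Gamma> p v) \<and>
     (\<forall>X. null_section Y \<omega> X \<longrightarrow> smooth_map_on Y (\<lambda>p. \<Gamma> p (X p)))"

definition lie_bracket :: "'a::euclidean_space set \<Rightarrow> ('a \<Rightarrow> 'a) \<Rightarrow> ('a \<Rightarrow> 'a) \<Rightarrow> 'a \<Rightarrow> 'a" where
  "lie_bracket Y X Z p = dir_deriv Y Z p (X p) - dir_deriv Y X p (Z p)"

definition leafwise_d1 ::
  "'a::euclidean_space set \<Rightarrow> 'a oneform \<Rightarrow> ('a \<Rightarrow> 'a) \<Rightarrow> ('a \<Rightarrow> 'a) \<Rightarrow> 'a \<Rightarrow> real" where
  "leafwise_d1 Y \<Gamma> X Z p =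
     dir_deriv Y (\<lambda>x. \<Gamma> x (Z x)) p (X p) - dir_deriv Y (\<lambda>x. \<Gamma> x (X x)) p (Z p)
       - \<Gamma> p (lie_bracket Y X Z p)"

definition leafwise_closed :: "'a::euclidean_space set \<Rightarrow> 'a twoform \<Rightarrow> 'a oneform \<Rightarrow> bool" where
  "leafwise_closed Y \<omega> \<Gamma> \<longleftrightarrow>
     leafwise_oneform Y \<omega> \<Gamma> \<and>
     (\<forall>X Z. null_section Y \<omega> X \<longrightarrow> null_section Y \<omega> Z \<longrightarrow> (\<forall>p\<in>Y. leafwise_d1 Y \<Gamma> X Z p = 0))"

definition leafwise_cohomologous ::
  "'a::euclidean_space set \<Rightarrow> 'a twoform \<Rightarrow> 'a oneform \<Rightarrow> 'a oneform \<Rightarrow> bool" where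
  "leafwise_cohomologous Y \<omega> \<Gamma> \<Gamma>' \<longleftrightarrow>
     (\<exists>f :: 'a \<Rightarrow> real. smooth_map_on Y f \<and>
        (\<forall>p\<in>Y. \<forall>v\<in>null_space Y \<omega> p. \<Gamma>' p v - \<Gamma> p v = dir_deriv Y f p v))"

section \<open>Deformations of a coisotropic submanifold\<close>

text \<open>A smooth path of coisotropic submanifolds \<open>\<phi> t ` Y\<close> starting at \<open>Y\<close>, given by a smooth path of
  embeddings of \<open>Y\<close> starting at the inclusion.\<close>

definition coisotropic_deformation ::
  "'a::euclidean_space set \<Rightarrow> 'a twoform \<Rightarrow> 'a set \<Rightarrow> real \<Rightarrow> (real \<Rightarrow> 'a \<Rightarrow> 'a) \<Rightarrow> bool" where
  "coisotropic_deformation M \<Omega> Y e \<phi> \<longleftrightarrow>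
     e > 0 \<and>
     smooth_map_on ({-e<..<e} \<times> Y) (\<lambda>(t, x). \<phi> t x) \<and>
     (\<forall>x\<in>Y. \<phi> 0 x = x) \<and>
     (\<forall>t\<in>{-e<..<e}. diffeomorphism_onto_image Y (\<phi> t) \<and>
        coisotropic_submanifold M \<Omega> (\<phi> t ` Y))"

text \<open>The normal bundle \<open>TM/TY\<close> is identified with the dual of \<open>E\<close> by sending the class of \<open>\<xi>\<close>
  to \<open>\<lambda>v. \<Omega> v \<xi>\<close>. With this sign a section of the thickening below corresponds to itself.\<close>

definition coisotropic_first_order ::
  "'a twoform \<Rightarrow> 'a::euclidean_space set \<Rightarrow> (real \<Rightarrow> 'a \<Rightarrow> 'a) \<Rightarrow> 'a oneform \<Rightarrow> bool" where
  "coisotropic_first_order \<Omega> Y \<phi> \<Gamma>1 \<longleftrightarrow>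
     (\<forall>p\<in>Y. \<exists>\<xi>. ((\<lambda>t. \<phi> t p) has_vector_derivative \<xi>) (at 0) \<and>
        (\<forall>v\<in>null_space Y \<Omega> p. \<Gamma>1 p v = \<Omega> p v \<xi>))"

definition coisotropic_unobstructed ::
  "'a::euclidean_space set \<Rightarrow> 'a twoform \<Rightarrow> 'a set \<Rightarrow> bool" where
  "coisotropic_unobstructed M \<Omega> Y \<longleftrightarrow>
     (\<forall>\<Gamma>. leafwise_closed Y \<Omega> \<Gamma> \<longrightarrow>
        (\<exists>\<Gamma>1 e \<phi>. leafwise_closed Y \<Omega> \<Gamma>1 \<and> leafwise_cohomologous Y \<Omega> \<Gamma> \<Gamma>1 \<and>
           coisotropic_deformation M \<Omega> Y e \<phi> \<and> coisotropic_first_order \<Omega> Y \<phi> \<Gamma>1))"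

definition coisotropic_obstructed ::
  "'a::euclidean_space set \<Rightarrow> 'a twoform \<Rightarrow> 'a set \<Rightarrow> bool" where
  "coisotropic_obstructed M \<Omega> Y \<longleftrightarrow> \<not> coisotropic_unobstructed M \<Omega> Y"

section \<open>The symplectic thickening and deformations of a pre-symplectic manifold\<close>

text \<open>A splitting \<open>TY = G \<oplus> E\<close> together with the projection \<open>P x : T\<^sub>xY \<rightarrow> E\<^sub>x\<close> along \<open>G x\<close>;
  \<open>P x\<close> is extended to a linear map on the ambient space, smoothly in \<open>x\<close>.\<close>

definition splitting ::
  "'a::euclidean_space set \<Rightarrow> 'a twoform \<Rightarrow> ('a \<Rightarrow> 'a set) \<Rightarrow> ('a \<Rightarrow> 'a \<Rightarrow> 'a) \<Rightarrow> bool" where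
  "splitting Y \<omega> G P \<longleftrightarrow>
     (\<forall>x\<in>Y. subspace (G x) \<and> G x \<inter> null_space Y \<omega> x = {0} \<and>
        {g + v | g v. g \<in> G x \<and> v \<in> null_space Y \<omega> x} = tangent_space Y x \<and>
        linear (P x) \<and> (\<forall>g\<in>G x. P x g = 0) \<and> (\<forall>v\<in>null_space Y \<omega> x. P x v = v)) \<and>
     (\<forall>v. smooth_map_on Y (\<lambda>x. P x v))"

text \<open>The total space of the dual of \<open>E\<close>: the pair \<open>(x, a)\<close> with \<open>a \<in> E\<^sub>x\<close> stands for the covector
  \<open>\<lambda>v. a \<bullet> v\<close> on \<open>E\<^sub>x\<close>. The Euclidean inner product serves only to embed this bundle in
  a Euclidean space.\<close>

definition dual_bundle :: "'a::euclidean_space set \<Rightarrow> 'a twoform \<Rightarrow> ('a \<times> 'a) set" where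
  "dual_bundle Y \<omega> = {(x, a). x \<in> Y \<and> a \<in> null_space Y \<omega> x}"

definition graph_of :: "'a::euclidean_space set \<Rightarrow> 'a twoform \<Rightarrow> 'a oneform \<Rightarrow> ('a \<times> 'a) set" where
  "graph_of Y \<omega> \<Gamma> =
     {(x, a) \<in> dual_bundle Y \<omega>. \<forall>v\<in>null_space Y \<omega> x. a \<bullet> v = \<Gamma> x v}"

text \<open>Since \<open>\<pi> (x, a) = x\<close>, the vector \<open>fst \<xi>\<close> is \<open>T\<pi> \<xi>\<close>.\<close>

definition theta_G :: "('a \<Rightarrow> 'a \<Rightarrow> 'a) \<Rightarrow> ('a::euclidean_space \<times> 'a) oneform" where
  "theta_G P z \<xi> = snd z \<bullet> P (fst z) (fst \<xi>)"

definition thickening_form ::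
  "'a::euclidean_space set \<Rightarrow> 'a twoform \<Rightarrow> ('a \<Rightarrow> 'a \<Rightarrow> 'a) \<Rightarrow> ('a \<times> 'a) twoform" where
  "thickening_form Y \<omega> P z \<xi> \<eta> =
     \<omega> (fst z) (fst \<xi>) (fst \<eta>) - ext_deriv1 (dual_bundle Y \<omega>) (theta_G P) z \<xi> \<eta>"

text \<open>A neighbourhood \<open>M\<close> of the zero section on which the (automatically smooth and closed) form
  is symplectic.\<close>

definition symplectic_thickening ::
  "'a::euclidean_space set \<Rightarrow> 'a twoform \<Rightarrow> ('a \<Rightarrow> 'a \<Rightarrow> 'a) \<Rightarrow> ('a \<times> 'a) set \<Rightarrow> bool" where
  "symplectic_thickening Y \<omega> P M \<longleftrightarrow>
     (\<exists>U. open U \<and> M = U \<inter> dual_bundle Y \<omega>) \<and> Y \<times> {0} \<subseteq> M \<and>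
     (\<forall>z\<in>M. \<forall>\<xi>\<in>tangent_space M z.
        (\<forall>\<eta>\<in>tangent_space M z. thickening_form Y \<omega> P z \<xi> \<eta> = 0) \<longrightarrow> \<xi> = 0)"

definition presymplectic_deformation ::
  "'a::euclidean_space set \<Rightarrow> 'a twoform \<Rightarrow> ('a \<Rightarrow> 'a \<Rightarrow> 'a) \<Rightarrow> ('a \<times> 'a) set
     \<Rightarrow> real \<Rightarrow> (real \<Rightarrow> 'a oneform) \<Rightarrow> bool" where
  "presymplectic_deformation Y \<omega> P M e \<Gamma> \<longleftrightarrow>
     e > 0 \<and>
     (\<forall>X. null_section Y \<omega> X \<longrightarrow> smooth_map_on ({-e<..<e} \<times> Y) (\<lambda>(t, p). \<Gamma> t p (X p))) \<and>
     (\<forall>p\<in>Y. \<forall>v\<in>null_space Y \<omega> p. \<Gamma> 0 p v = 0) \<and>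
     (\<forall>t\<in>{-e<..<e}. leafwise_oneform Y \<omega> (\<Gamma> t) \<and>
        coisotropic_submanifold M (thickening_form Y \<omega> P) (graph_of Y \<omega> (\<Gamma> t)))"

definition presymplectic_first_order ::
  "'a::euclidean_space set \<Rightarrow> 'a twoform \<Rightarrow> (real \<Rightarrow> 'a oneform) \<Rightarrow> 'a oneform \<Rightarrow> bool" where
  "presymplectic_first_order Y \<omega> \<Gamma> \<Gamma>1 \<longleftrightarrow>
     (\<forall>p\<in>Y. \<forall>v\<in>null_space Y \<omega> p. ((\<lambda>t. \<Gamma> t p v) has_real_derivative \<Gamma>1 p v) (at 0))"

text \<open>Being unobstructed does not depend on the splitting and the neighbourhood. With the existential
  quantifier here, being obstructed refers to all such choices.\<close>

definition presymplectic_unobstructed :: "'a::euclidean_space set \<Rightarrow> 'a twoform \<Rightarrow> bool" where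
  "presymplectic_unobstructed Y \<omega> \<longleftrightarrow>
     (\<exists>G P M. splitting Y \<omega> G P \<and> symplectic_thickening Y \<omega> P M \<and>
        (\<forall>\<Gamma>. leafwise_closed Y \<omega> \<Gamma> \<longrightarrow>
           (\<exists>\<Gamma>1 e \<Gamma>t. leafwise_closed Y \<omega> \<Gamma>1 \<and> leafwise_cohomologous Y \<omega> \<Gamma> \<Gamma>1 \<and>
              presymplectic_deformation Y \<omega> P M e \<Gamma>t \<and> presymplectic_first_order Y \<omega> \<Gamma>t \<Gamma>1)))"

definition presymplectic_obstructed :: "'a::euclidean_space set \<Rightarrow> 'a twoform \<Rightarrow> bool" where
  "presymplectic_obstructed Y \<omega> \<longleftrightarrow> \<not> presymplectic_unobstructed Y \<omega>"

section \<open>The submanifold \<open>Y\<^sub>\<alpha>\<close> of the phase space\<close>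

text \<open>A point \<open>z = (Q, P)\<close> has the coordinates \<open>Q\<^sup>i = fst z $ i\<close> and \<open>P\<^sup>i = snd z $ i\<close>.\<close>

type_synonym phase = "(real ^ 3) \<times> (real ^ 3)"

definition omega_std :: "phase twoform" where
  "omega_std z u v = (\<Sum>i\<in>UNIV. fst u $ i * snd v $ i - snd u $ i * fst v $ i)"

definition H :: "3 \<Rightarrow> phase \<Rightarrow> real" where
  "H i z = 1/2 * ((fst z $ i)\<^sup>2 + (snd z $ i)\<^sup>2)"

definition Y_alpha :: "real \<Rightarrow> phase set" where
  "Y_alpha \<alpha> = {z. H 1 z + H 2 z + H 3 z = 1/2 \<and> H 1 z + \<alpha> * H 2 z = 1/4}"

end

theory Submission
  imports Defs
begin


text \<open>
  Write \<open>z\<^sub>j = Q\<^sup>j + \<i> P\<^sup>j\<close> and \<open>\<alpha> = m / n\<close>. The null foliation of \<open>Y_alpha \<alpha>\<close> is spanned by two commuting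
  linear fields, the infinitesimal rotations with weights \<open>(1, 1, 1)\<close> and \<open>(1, \<alpha>, 0)\<close>; as \<open>\<alpha>\<close> is rational
  their flows are periodic, every leaf is a torus, and the leaf space is a symplectic orbifold of
  dimension two. A closed leafwise one-form has, up to a leafwise exact form, constant values \<open>f\<^sub>1, f\<^sub>2\<close> on
  the two fields along each leaf, so it is given by two functions on the leaf space. The obstruction
  is their Poisson bracket: if the class is tangent to a path of coisotropic submanifolds, then \<open>f\<^sub>1\<close>
  and \<open>f\<^sub>2\<close> commute.

  The reason is a second order computation. Pulling the symplectic form back to \<open>Y_alpha \<alpha>\<close> along the path
  gives closed two-forms \<open>\<omega>\<^sub>t = d\<Lambda>\<^sub>t\<close>, and coisotropy of a four-dimensional submanifold of a
  six-dimensional symplectic manifold says that \<open>\<omega>\<^sub>t\<close> is degenerate, i.e. that the Pfaffian of \<open>\<omega>\<^sub>t\<close> vanishes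
  (\<open>pfaffian_zero_of_coisotropic\<close>). In coordinates \<open>(s\<^sub>1, s\<^sub>2, \<phi>, y)\<close> with \<open>s\<^sub>1, s\<^sub>2\<close> along the leaves,
  \<open>\<omega>\<^sub>0 = c d\<phi> \<and> dy\<close>, and the second time derivative of the Pfaffian at \<open>t = 0\<close> reads
  \<open>c (\<partial>\<^sub>1 n\<^sub>2 - \<partial>\<^sub>2 n\<^sub>1) = 2 (b\<^sub>1\<^sub>3 b\<^sub>2\<^sub>4 - b\<^sub>1\<^sub>4 b\<^sub>2\<^sub>3)\<close>, where \<open>m\<close> and \<open>n\<close> are the first and second derivatives of \<open>\<Lambda>\<close> and
  \<open>b = dm\<close>. The components of \<open>m\<close> along the leaf are, up to sign and an exact form, \<open>f\<^sub>1\<close> and \<open>f\<^sub>2\<close>. Averaged over a leaf torus all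
  terms disappear by periodicity, except for the Jacobian of \<open>(f\<^sub>1, f\<^sub>2)\<close> in the variables \<open>(\<phi>, y)\<close>, which
  therefore vanishes (\<open>leafwise_average_of_second_order_term\<close>, \<open>commuting_of_pfaffian_zero\<close>).

  The bracket is nonzero for \<open>f\<^sub>1 = |z\<^sub>3|\<^sup>2 + K\<close> and \<open>f\<^sub>2 = K / 2\<close>, where \<open>K\<close> is the real part of the resonant monomial
  \<open>z\<^sub>1\<^sup>m w\<^sub>2\<^sup>n z\<^sub>3\<^sup>n w\<^sub>3\<^sup>m\<close> with \<open>w\<^sub>j\<close> the conjugate of \<open>z\<^sub>j\<close>: \<open>K\<close> is invariant under both flows because
  \<open>n \<alpha> = m\<close>, but not under rotations of \<open>z\<^sub>1\<close> alone, while \<open>|z\<^sub>3|\<^sup>2\<close> generates a rotation of the leaf space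
  (\<open>obstructed_class_closed\<close>, \<open>leaf_value_jacobian\<close>).

  Both kinds of deformations lead to this situation, with different primitives: for a path of
  embeddings \<open>\<phi>\<^sub>t\<close> in the phase space, \<open>\<Lambda>\<^sub>t\<close> is the pull-back of half the radial contraction of the standard
  form; for graphs in the thickening it is the same primitive of \<open>\<omega>\<close> on \<open>Y_alpha \<alpha>\<close> minus the pull-back of
  \<open>theta_G\<close>. The argument is local around one leaf on which none of the coordinates \<open>z\<^sub>j\<close> vanishes.
\<close>

section \<open>Calculus of smooth maps\<close>

abbreviation pd :: "'a::euclidean_space \<Rightarrow> ('a \<Rightarrow> 'b::real_normed_vector) \<Rightarrow> 'a \<Rightarrow> 'b" where
  "pd v f x \<equiv> frechet_derivative f (at x) v"

lemma pd_eq: "(f has_derivative f') (at x) \<Longrightarrow> pd v f x = f' v"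
  by (metis frechet_derivative_at)

lemma pd_cong_open:
  assumes "open U" "x \<in> U" "\<And>y. y \<in> U \<Longrightarrow> f y = g y" "f differentiable (at x)"
  shows "pd v f x = pd v g x" and "g differentiable (at x)"
proof -
  have "(f has_derivative frechet_derivative f (at x)) (at x)"
    using assms(4) by (simp add: frechet_derivative_works)
  then have "(g has_derivative frechet_derivative f (at x)) (at x)"
    by (rule has_derivative_transform_within_open[OF _ assms(1-3)])
  then show "pd v f x = pd v g x" "g differentiable (at x)"
    by (auto simp: pd_eq differentiable_def)
qed

lemma Ck_on_cong:
  assumes "open U" "\<And>x. x \<in> U \<Longrightarrow> f x = g x" "Ck_on k U f"
  shows "Ck_on k U g"
  using assms(2,3)
proof (induction k arbitrary: f g)
  case 0
  then show ?case using continuous_on_cong by (metis Ck_on.simps(1))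
next
  case (Suc k)
  have e: "pd v f x = pd v g x" "g differentiable (at x)" if "x \<in> U" for x v
    using pd_cong_open[OF assms(1) that, of f g] Suc.prems that by auto
  have "Ck_on k U (pd v g)" for v
    using Suc.IH[of "pd v f" "pd v g"] e Suc.prems(2) by auto
  then show ?case using e by simp
qed

lemma Ck_on_lower: "Ck_on (Suc k) U f \<Longrightarrow> Ck_on k U f"
proof (induction k arbitrary: f)
  case 0
  then show ?case
    by (auto intro: continuous_at_imp_continuous_on differentiable_imp_continuous_within)
qed auto

lemma smooth_on_differentiable: "smooth_on U f \<Longrightarrow> x \<in> U \<Longrightarrow> f differentiable (at x)"
  unfolding smooth_on_def using Ck_on.simps(2) by blast

lemma smooth_on_pd: "smooth_on U f \<Longrightarrow> smooth_on U (pd v f)"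
  unfolding smooth_on_def using Ck_on.simps(2) by blast

lemma smooth_on_continuous: "smooth_on U f \<Longrightarrow> continuous_on U f"
  unfolding smooth_on_def using Ck_on.simps(1) by blast

lemma smooth_on_subset: 
  assumes "smooth_on U f" "V \<subseteq> U" shows "smooth_on V f"
proof -
  have "Ck_on k U f \<Longrightarrow> V \<subseteq> U \<Longrightarrow> Ck_on k V f" for k and f :: "'a \<Rightarrow> 'b"
  proof (induction k arbitrary: f)
    case 0
    then show ?case using continuous_on_subset by auto
  next
    case (Suc k)
    then show ?case by auto
  qed
  then show ?thesis using assms unfolding smooth_on_def by blast
qed

text \<open>Differentiability of every order is a local property; this is what makes maps that are merely
  locally extendable smooth in coordinates.\<close>

lemma smooth_on_local:
  assumes "\<And>x. x \<in> U \<Longrightarrow> \<exists>V g. open V \<and> x \<in> V \<and> smooth_on V g \<and> (\<forall>y\<in>V. g y = f y)"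
  shows "smooth_on U f"
proof -
  have "Ck_on k U f" if "\<And>x. x \<in> U \<Longrightarrow> \<exists>V g. open V \<and> x \<in> V \<and> Ck_on k V g \<and> (\<forall>y\<in>V. g y = f y)"
    for k and f :: "'a \<Rightarrow> 'b"
    using that
  proof (induction k arbitrary: f)
    case 0
    have "isCont f x" if x: "x \<in> U" for x
    proof -
      obtain V g where V: "open V" "x \<in> V" "continuous_on V g" "\<forall>y\<in>V. g y = f y" 
        using 0[OF x] unfolding Ck_on.simps by (elim exE conjE)
      then have "continuous_on V f" using continuous_on_cong by metis
      then show ?thesis using V continuous_on_eq_continuous_at by blast
    qed
    then show ?case by (simp add: continuous_at_imp_continuous_on)
  next
    case (Suc k)
    have "f differentiable (at x) \<and> (\<forall>v. \<exists>V g. open V \<and> x \<in> V \<and> Ck_on k V g \<and> (\<forall>y\<in>V. g y = pd v f y))"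
      if x: "x \<in> U" for x
    proof -
      obtain V g where V: "open V" "x \<in> V" "Ck_on (Suc k) V g" "\<forall>y\<in>V. g y = f y" 
        using Suc.prems[OF x] by auto
      have "pd v g y = pd v f y" "f differentiable (at y)" if "y \<in> V" for y v
        using pd_cong_open[OF V(1) that, of g f] V that by auto
      moreover from V have "\<forall>v. Ck_on k V (pd v g)" by simp
      ultimately show ?thesis using V(1,2) by blast
    qed
    then show ?case using Suc.IH by auto
  qed
  moreover have "\<exists>V g. open V \<and> x \<in> V \<and> Ck_on k V g \<and> (\<forall>y\<in>V. g y = f y)" if "x \<in> U" for k x
    using assms[OF that] unfolding smooth_on_def by blast
  ultimately show ?thesis unfolding smooth_on_def by blast
qed

text \<open>Induction on the order of differentiability inside a family that is closed under directional
  derivatives. Powers and trigonometric functions are handled this way, because their derivatives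
  keep their shape up to parameters.\<close>

lemma smooth_on_coinduct:
  assumes "open U" "f \<in> F"
    and F: "\<And>g v. g \<in> F \<Longrightarrow> (\<forall>x\<in>U. g differentiable (at x)) \<and> (\<exists>h\<in>F. \<forall>x\<in>U. h x = pd v g x)"
  shows "smooth_on U f"
proof -
  have "Ck_on k U f" if "f \<in> F" for k f
    using that
  proof (induction k arbitrary: f)
    case 0
    then have "\<forall>x\<in>U. f differentiable (at x)" using F by blast
    then show ?case
      by (auto intro: continuous_at_imp_continuous_on differentiable_imp_continuous_within)
  next
    case (Suc k)
    have "Ck_on k U (pd v f)" for v
      using F[OF Suc.prems, of v] Suc.IH Ck_on_cong[OF assms(1), of _ "pd v f" k] by auto
    then show ?case using F[OF Suc.prems] by auto
  qed
  then show ?thesis using assms(2) unfolding smooth_on_def by blast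
qed

lemma smooth_on_const [intro, simp]: "smooth_on U (\<lambda>x. c)"
proof -
  have "Ck_on k U (\<lambda>x. c)" for k and c :: 'b
    by (induction k arbitrary: c) auto
  then show ?thesis unfolding smooth_on_def by blast
qed

lemma smooth_on_bounded_linear:
  assumes "bounded_linear h" shows "smooth_on U h"
proof -
  have "(h has_derivative h) (at x)" for x
    using assms bounded_linear_imp_has_derivative by blast
  then have "pd v h x = h v" "h differentiable (at x)" for x v
    by (auto simp: pd_eq differentiable_def)
  moreover have "Ck_on k U (\<lambda>x. h v)" for k v
    using smooth_on_const[of U "h v"] unfolding smooth_on_def by simp
  ultimately have "Ck_on (Suc k) U h" for k by simp
  then show ?thesis unfolding smooth_on_def using Ck_on_lower by blast
qed

lemma Ck_on_add:
  assumes "open U" "Ck_on k U f" "Ck_on k U g" shows "Ck_on k U (\<lambda>x. f x + g x)"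
  using assms(2,3)
proof (induction k arbitrary: f g)
  case 0
  then show ?case by (auto intro: continuous_intros)
next
  case (Suc k)
  have p: "pd v (\<lambda>x. f x + g x) x = pd v f x + pd v g x" if "x \<in> U" for x v
  proof (rule pd_eq)
    show "((\<lambda>x. f x + g x) has_derivative (\<lambda>v. pd v f x + pd v g x)) (at x)"
      using Suc.prems that by (intro has_derivative_add) (simp_all add: frechet_derivative_works[symmetric])
  qed
  have "Ck_on k U (\<lambda>x. pd v f x + pd v g x)" for v
    using Suc by auto
  then have "Ck_on k U (pd v (\<lambda>x. f x + g x))" for v
    by (rule Ck_on_cong[OF assms(1), rotated]) (simp add: p)
  then show ?case using Suc.prems by auto
qed

lemma Ck_on_bilinear:
  assumes "bounded_bilinear h" "open U" "Ck_on k U f" "Ck_on k U g"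
  shows "Ck_on k U (\<lambda>x. h (f x) (g x))"
proof -
  interpret bounded_bilinear h by fact
  show ?thesis using assms(3,4)
  proof (induction k arbitrary: f g)
    case 0
    then show ?case by (auto intro: continuous_on)
  next
    case (Suc k)
    have d: "((\<lambda>x. h (f x) (g x)) has_derivative (\<lambda>v. h (f x) (pd v g x) + h (pd v f x) (g x))) (at x)"
      if "x \<in> U" for x
      using Suc.prems that by (intro FDERIV) (simp_all add: frechet_derivative_works[symmetric])
    have "Ck_on k U f" "Ck_on k U g" using Suc.prems by (auto intro: Ck_on_lower simp del: Ck_on.simps)
    then have "Ck_on k U (\<lambda>x. h (f x) (pd v g x) + h (pd v f x) (g x))" for v
      using Suc.prems by (intro Ck_on_add[OF assms(2)] Suc.IH) auto
    then have "Ck_on k U (pd v (\<lambda>x. h (f x) (g x)))" for v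
      by (rule Ck_on_cong[OF assms(2), rotated]) (use pd_eq[OF d] in auto)
    then show ?case using d by (auto simp: differentiable_def)
  qed
qed

lemma smooth_on_bilinear:
  "bounded_bilinear h \<Longrightarrow> open U \<Longrightarrow> smooth_on U f \<Longrightarrow> smooth_on U g \<Longrightarrow> smooth_on U (\<lambda>x. h (f x) (g x))"
  unfolding smooth_on_def using Ck_on_bilinear by blast

lemma smooth_on_add: "open U \<Longrightarrow> smooth_on U f \<Longrightarrow> smooth_on U g \<Longrightarrow> smooth_on U (\<lambda>x. f x + g x)"
  unfolding smooth_on_def using Ck_on_add by blast

lemma Ck_on_sum:
  "open U \<Longrightarrow> (\<And>i. i \<in> I \<Longrightarrow> Ck_on k U (f i)) \<Longrightarrow> Ck_on k U (\<lambda>x. \<Sum>i\<in>I. f i x)"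
proof (induction I rule: infinite_finite_induct)
  case (insert i I)
  then show ?case using Ck_on_add[of U k "f i"] by simp
qed (use smooth_on_const[of U 0] smooth_on_def in auto)

lemma smooth_on_sum:
  "open U \<Longrightarrow> (\<And>i. i \<in> I \<Longrightarrow> smooth_on U (f i)) \<Longrightarrow> smooth_on U (\<lambda>x. \<Sum>i\<in>I. f i x)"
  by (simp add: smooth_on_def Ck_on_sum)

lemma smooth_on_linear_compose:
  fixes h :: "'b::real_normed_vector \<Rightarrow> 'c::real_normed_vector"
  assumes "bounded_linear h" "open U" "smooth_on U f"
  shows "smooth_on U (\<lambda>x. h (f x))"
proof -
  have "bounded_bilinear (\<lambda>(a::real) b. a *\<^sub>R h b)"
    by (intro bounded_bilinear.comp[OF bounded_bilinear_scaleR bounded_linear_ident assms(1)])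
  from smooth_on_bilinear[OF this assms(2) smooth_on_const[of U 1] assms(3)] show ?thesis by simp
qed

lemma pd_compose:
  assumes "f differentiable (at x)" "g differentiable (at (f x))"
  shows "pd v (\<lambda>x. g (f x)) x = frechet_derivative g (at (f x)) (pd v f x)"
proof -
  have "((\<lambda>x. g (f x)) has_derivative (\<lambda>v. frechet_derivative g (at (f x)) (pd v f x))) (at x)"
    using diff_chain_at[of f _ x g] assms by (simp add: frechet_derivative_works o_def)
  then show ?thesis by (rule pd_eq)
qed

lemma pd_expand:
  fixes g :: "'a::euclidean_space \<Rightarrow> 'b::real_normed_vector"
  assumes "g differentiable (at y)"
  shows "pd v g y = (\<Sum>b\<in>Basis. (v \<bullet> b) *\<^sub>R pd b g y)"
proof -
  have "linear (frechet_derivative g (at y))" using assms by (rule linear_frechet_derivative)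
  then have "(\<Sum>b\<in>Basis. (v \<bullet> b) *\<^sub>R pd b g y) = pd (\<Sum>b\<in>Basis. (v \<bullet> b) *\<^sub>R b) g y"
    by (simp add: linear_sum linear_scale)
  then show ?thesis by (simp add: euclidean_representation)
qed

text \<open>By the chain rule a directional derivative of the composition is the combination
  of the partial derivatives of the outer map with the components of the derivative of the inner map
  as coefficients, so that an induction over the order closes.\<close>

lemma smooth_on_compose:
  fixes f :: "'a::euclidean_space \<Rightarrow> 'b::euclidean_space" and g :: "'b \<Rightarrow> 'c::real_normed_vector"
  assumes "open U" "smooth_on U f" "smooth_on V g" "f ` U \<subseteq> V"
  shows "smooth_on U (\<lambda>x. g (f x))"
proof -
  have "Ck_on k U (\<lambda>x. g (f x))" if "\<forall>k. Ck_on k V g" for k and g :: "'b \<Rightarrow> 'c"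
    using that
  proof (induction k arbitrary: g)
    case 0
    have "continuous_on U f" "continuous_on V g"
      using 0 assms(2) by (simp_all add: smooth_on_continuous smooth_on_def)
    then show ?case using continuous_on_compose2[OF _ _ assms(4)] by simp
  next
    case (Suc k)
    have df: "f differentiable (at x)" if "x \<in> U" for x
      using smooth_on_differentiable[OF assms(2) that] .
    have dg: "g differentiable (at (f x))" if "x \<in> U" for x
      using smooth_on_differentiable[of V g "f x"] Suc.prems that assms(4) unfolding smooth_on_def by blast
    have e: "pd v (\<lambda>x. g (f x)) x = (\<Sum>b\<in>Basis. (pd v f x \<bullet> b) *\<^sub>R pd b g (f x))" if "x \<in> U" for x v
      using pd_compose[OF df[OF that] dg[OF that]] pd_expand[OF dg[OF that], of "pd v f x"] by (rule trans)
    have "Ck_on k U (\<lambda>x. pd b g (f x))" for b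
      using Suc.IH[of "pd b g"] smooth_on_pd[of V g b] Suc.prems unfolding smooth_on_def by auto
    moreover have "Ck_on k U (\<lambda>x. pd v f x \<bullet> b)" for v b
      using smooth_on_linear_compose[OF bounded_linear_inner_left assms(1) smooth_on_pd[OF assms(2)]]
      unfolding smooth_on_def by auto
    ultimately have "Ck_on k U (\<lambda>x. \<Sum>b\<in>Basis. (pd v f x \<bullet> b) *\<^sub>R pd b g (f x))" for v
      by (intro Ck_on_sum Ck_on_bilinear[OF bounded_bilinear_scaleR] assms(1))
    then have "Ck_on k U (pd v (\<lambda>x. g (f x)))" for v
      by (rule Ck_on_cong[OF assms(1), rotated]) (use e in auto)
    moreover have "(\<lambda>x. g (f x)) differentiable (at x)" if "x \<in> U" for x
      using differentiable_chain_at[OF df dg, OF that that] by (simp add: o_def)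
    ultimately show ?case by simp
  qed
  then show ?thesis using assms(3) unfolding smooth_on_def by blast
qed

lemma smooth_on_Pair:
  assumes "open U" "smooth_on U f" "smooth_on U g"
  shows "smooth_on U (\<lambda>x. (f x, g x))"
proof -
  have "smooth_on U (\<lambda>x. (f x, 0) + (0, g x))"
    by (intro smooth_on_add assms smooth_on_linear_compose[of "\<lambda>y. (y, 0)"]
        smooth_on_linear_compose[of "\<lambda>y. (0, y)"] bounded_linear_intros)
  then show ?thesis by simp
qed

lemma smooth_on_powr: "smooth_on {0<..} (\<lambda>x::real. x powr a)"
proof (rule smooth_on_coinduct[where F = "{\<lambda>x. c * x powr a | a c. True}"])
  fix g :: "real \<Rightarrow> real" and v :: real
  assume "g \<in> {\<lambda>x. c * x powr a | a c. True}"
  then obtain a c where g: "g = (\<lambda>x. c * x powr a)" by auto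
  have d: "(g has_derivative (\<lambda>h. h * (c * a * x powr (a - 1)))) (at x)" if "x \<in> {0<..}" for x
    unfolding g using that by (auto intro!: derivative_eq_intros simp: powr_diff field_simps)
  have "\<forall>x\<in>{0<..}. (\<lambda>x. (v * c * a) * x powr (a - 1)) x = pd v g x"
    using pd_eq[OF d] by simp
  moreover have "(\<lambda>x. (v * c * a) * x powr (a - 1)) \<in> {\<lambda>x. c * x powr a | a c. True}" by blast
  ultimately have "\<exists>h\<in>{\<lambda>x. c * x powr a | a c. True}. \<forall>x\<in>{0<..}. h x = pd v g x"
    by (rule bexI)
  moreover have "\<forall>x\<in>{0<..}. g differentiable (at x)"
    using d unfolding differentiable_def by blast
  ultimately show "(\<forall>x\<in>{0<..}. g differentiable (at x)) \<and> 
      (\<exists>h\<in>{\<lambda>x. c * x powr a | a c. True}. \<forall>x\<in>{0<..}. h x = pd v g x)" by blast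
next
  have "(\<lambda>x::real. 1 * x powr a) \<in> {\<lambda>x. c * x powr a | a c. True}" by blast
  then show "(\<lambda>x::real. x powr a) \<in> {\<lambda>x. c * x powr a | a c. True}" by simp
qed simp

lemma smooth_on_cos_sin: "smooth_on UNIV (\<lambda>x::real. cos x)" "smooth_on UNIV (\<lambda>x::real. sin x)"
proof -
  let ?F = "{\<lambda>x::real. c * cos (x + b) | b c::real. True}"
  have "\<exists>h\<in>?F. \<forall>x\<in>UNIV. h x = pd v g x" "\<forall>x\<in>UNIV. g differentiable (at x)" if "g \<in> ?F" for g v
  proof -
    obtain b c where g: "g = (\<lambda>x. c * cos (x + b))" using \<open>g \<in> ?F\<close> by auto
    have d: "(g has_derivative (\<lambda>h. h * (- c * sin (x + b)))) (at x)" for x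
      unfolding g by (auto intro!: derivative_eq_intros)
    have "\<forall>x\<in>UNIV. (\<lambda>x. (v * c) * cos (x + (b + pi / 2))) x = pd v g x"
      by (simp add: pd_eq[OF d] cos_add sin_add algebra_simps)
    moreover have "(\<lambda>x. (v * c) * cos (x + (b + pi / 2))) \<in> ?F" by blast
    ultimately show "\<exists>h\<in>?F. \<forall>x\<in>UNIV. h x = pd v g x" by (rule bexI)
    show "\<forall>x\<in>UNIV. g differentiable (at x)" using d unfolding differentiable_def by blast
  qed
  then have "smooth_on UNIV g" if "g \<in> ?F" for g
    using smooth_on_coinduct[OF open_UNIV that] by blast
  then have "smooth_on UNIV (\<lambda>x::real. 1 * cos (x + 0))" "smooth_on UNIV (\<lambda>x::real. 1 * cos (x + (- pi / 2)))"
    by blast+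
  moreover have "cos (x + - (pi / 2)) = sin x" for x :: real by (simp only: cos_add) simp
  ultimately show "smooth_on UNIV (\<lambda>x::real. cos x)" "smooth_on UNIV (\<lambda>x::real. sin x)"
    by simp_all
qed

lemma smooth_on_mult:
  fixes f g :: "'a::euclidean_space \<Rightarrow> 'b::real_normed_algebra"
  shows "open U \<Longrightarrow> smooth_on U f \<Longrightarrow> smooth_on U g \<Longrightarrow> smooth_on U (\<lambda>x. f x * g x)"
  by (rule smooth_on_bilinear[OF bounded_bilinear_mult])

lemma smooth_on_scaleR:
  "open U \<Longrightarrow> smooth_on U f \<Longrightarrow> smooth_on U g \<Longrightarrow> smooth_on U (\<lambda>x. f x *\<^sub>R g x)"
  by (rule smooth_on_bilinear[OF bounded_bilinear_scaleR])

lemma smooth_on_diff: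
  assumes "open U" "smooth_on U f" "smooth_on U g" shows "smooth_on U (\<lambda>x. f x - g x)"
  using smooth_on_add[OF assms(1,2) smooth_on_linear_compose[OF bounded_linear_minus[OF bounded_linear_ident] assms(1,3)]]
  by simp

lemma smooth_on_power:
  fixes f :: "'a::euclidean_space \<Rightarrow> 'b::real_normed_algebra_1"
  assumes "open U" "smooth_on U f" shows "smooth_on U (\<lambda>x. f x ^ n)"
  by (induction n) (simp_all add: smooth_on_mult assms)

lemma smooth_on_real_compose:
  fixes f :: "'a::euclidean_space \<Rightarrow> real"
  assumes "open U" "smooth_on U f"
  shows "(\<And>x. x \<in> U \<Longrightarrow> f x > 0) \<Longrightarrow> smooth_on U (\<lambda>x. f x powr a)"
    "smooth_on U (\<lambda>x. cos (f x))" "smooth_on U (\<lambda>x. sin (f x))"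
  using smooth_on_compose[OF assms smooth_on_powr, of a] 
    smooth_on_compose[OF assms smooth_on_cos_sin(1)] smooth_on_compose[OF assms smooth_on_cos_sin(2)]
  by auto

lemma smooth_on_inner:
  "open U \<Longrightarrow> smooth_on U f \<Longrightarrow> smooth_on U g \<Longrightarrow> smooth_on U (\<lambda>x. f x \<bullet> g x)"
  by (rule smooth_on_bilinear[OF bounded_bilinear_inner])

subsection \<open>Rules for directional derivatives\<close>

lemma pd_add: "f differentiable (at x) \<Longrightarrow> g differentiable (at x) \<Longrightarrow> pd v (\<lambda>x. f x + g x) x = pd v f x + pd v g x"
  by (rule pd_eq) (auto intro!: derivative_eq_intros simp: frechet_derivative_works)

lemma pd_diff: "f differentiable (at x) \<Longrightarrow> g differentiable (at x) \<Longrightarrow> pd v (\<lambda>x. f x - g x) x = pd v f x - pd v g x"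
  by (rule pd_eq) (auto intro!: derivative_eq_intros simp: frechet_derivative_works)

lemma pd_bilinear:
  assumes "bounded_bilinear h" "f differentiable (at x)" "g differentiable (at x)"
  shows "pd v (\<lambda>x. h (f x) (g x)) x = h (f x) (pd v g x) + h (pd v f x) (g x)"
  by (rule pd_eq, rule bounded_bilinear.FDERIV[OF assms(1)])
    (use assms in \<open>auto simp: frechet_derivative_works\<close>)

lemma pd_linear:
  assumes "bounded_linear h" "f differentiable (at x)"
  shows "pd v (\<lambda>x. h (f x)) x = h (pd v f x)"
  by (rule pd_eq, rule bounded_linear.has_derivative[OF assms(1)])
    (use assms in \<open>auto simp: frechet_derivative_works\<close>)

lemma pd_vector_add:
  "f differentiable (at x) \<Longrightarrow> pd (u + v) f x = pd u f x + pd v f x"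
  "f differentiable (at x) \<Longrightarrow> pd (c *\<^sub>R u) f x = c *\<^sub>R pd u f x"
  using linear_frechet_derivative[of f "at x"] by (auto simp: linear_add linear_scale)

lemma has_vector_derivative_along_line:
  assumes "f differentiable (at (x + t *\<^sub>R v))"
  shows "((\<lambda>t. f (x + t *\<^sub>R v)) has_vector_derivative pd v f (x + t *\<^sub>R v)) (at t)"
proof -
  have "((\<lambda>t. x + t *\<^sub>R v) has_derivative (\<lambda>h. h *\<^sub>R v)) (at t)"
    by (auto intro!: derivative_eq_intros)
  then have "((\<lambda>t. f (x + t *\<^sub>R v)) has_derivative (\<lambda>h. pd (h *\<^sub>R v) f (x + t *\<^sub>R v))) (at t)"
    using diff_chain_at[of _ _ t f] assms by (simp add: frechet_derivative_works o_def)
  then show ?thesis unfolding has_vector_derivative_def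
    using pd_vector_add(2)[OF assms] by simp
qed

lemma has_vector_derivative_smooth_compose:
  assumes "f differentiable (at (c t))" "(c has_vector_derivative v) (at t)"
  shows "((\<lambda>t. f (c t)) has_vector_derivative pd v f (c t)) (at t)"
proof -
  have "((\<lambda>t. f (c t)) has_derivative (\<lambda>h. pd (h *\<^sub>R v) f (c t))) (at t)"
    using diff_chain_at[of c _ t f] assms by (simp add: frechet_derivative_works o_def has_vector_derivative_def)
  then show ?thesis unfolding has_vector_derivative_def
    using pd_vector_add(2)[OF assms(1)] by simp
qed

text \<open>Schwarz's theorem by the mean value theorem: the second difference of \<open>f\<close> over the
  parallelogram spanned by \<open>h u\<close> and \<open>h v\<close> is \<open>h\<^sup>2\<close> times each of the two mixed derivatives at
  suitable points of the parallelogram.\<close>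

lemma second_difference:
  fixes f :: "'a::euclidean_space \<Rightarrow> real"
  assumes "smooth_on U f" "h > 0" "\<And>a b. 0 \<le> a \<Longrightarrow> a \<le> h \<Longrightarrow> 0 \<le> b \<Longrightarrow> b \<le> h \<Longrightarrow> x + a *\<^sub>R u + b *\<^sub>R v \<in> U"
  shows "\<exists>a b. 0 < a \<and> a < h \<and> 0 < b \<and> b < h \<and>
    f (x + h *\<^sub>R u + h *\<^sub>R v) - f (x + h *\<^sub>R u) - f (x + h *\<^sub>R v) + f x 
      = h * h * pd v (pd u f) (x + a *\<^sub>R u + b *\<^sub>R v)"
proof -
  have df: "f differentiable (at (x + a *\<^sub>R u + b *\<^sub>R v))" "pd u f differentiable (at (x + a *\<^sub>R u + b *\<^sub>R v))"
    if "0 \<le> a" "a \<le> h" "0 \<le> b" "b \<le> h" for a b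
    using smooth_on_differentiable[OF assms(1) assms(3)[OF that]] 
      smooth_on_differentiable[OF smooth_on_pd[OF assms(1)] assms(3)[OF that]] by auto
  define \<phi> where "\<phi> a = f (x + h *\<^sub>R v + a *\<^sub>R u) - f (x + a *\<^sub>R u)" for a
  have "(\<phi> has_real_derivative (pd u f (x + h *\<^sub>R v + a *\<^sub>R u) - pd u f (x + a *\<^sub>R u))) (at a)"
    if "0 \<le> a" "a \<le> h" for a
    unfolding \<phi>_def has_real_derivative_iff_has_vector_derivative
    using df(1)[of a h] df(1)[of a 0] assms(2) that
    by (intro has_vector_derivative_diff has_vector_derivative_along_line) (auto simp: algebra_simps)
  from MVT2[OF assms(2) this] obtain a where a: "0 < a" "a < h"
    "\<phi> h - \<phi> 0 = h * (pd u f (x + h *\<^sub>R v + a *\<^sub>R u) - pd u f (x + a *\<^sub>R u))" by auto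
  have "((\<lambda>b. pd u f (x + a *\<^sub>R u + b *\<^sub>R v)) has_real_derivative pd v (pd u f) (x + a *\<^sub>R u + b *\<^sub>R v)) (at b)"
    if "0 \<le> b" "b \<le> h" for b
    unfolding has_real_derivative_iff_has_vector_derivative
    using df(2)[of a b] a that by (intro has_vector_derivative_along_line) auto
  from MVT2[OF assms(2) this] obtain b where b: "0 < b" "b < h"
    "pd u f (x + a *\<^sub>R u + h *\<^sub>R v) - pd u f (x + a *\<^sub>R u) = h * pd v (pd u f) (x + a *\<^sub>R u + b *\<^sub>R v)" by auto
  have "\<phi> h - \<phi> 0 = h * h * pd v (pd u f) (x + a *\<^sub>R u + b *\<^sub>R v)"
    using a(3) b(3) by (simp add: add.commute add.left_commute)
  moreover have "\<phi> h - \<phi> 0 = f (x + h *\<^sub>R u + h *\<^sub>R v) - f (x + h *\<^sub>R u) - f (x + h *\<^sub>R v) + f x"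
    unfolding \<phi>_def by (simp add: algebra_simps)
  ultimately show ?thesis using a b by auto
qed

lemma schwarz_real:
  fixes f :: "'a::euclidean_space \<Rightarrow> real"
  assumes "open U" "x \<in> U" "smooth_on U f"
  shows "pd v (pd u f) x = pd u (pd v f) x"
proof (rule ccontr)
  let ?A = "pd v (pd u f)" and ?B = "pd u (pd v f)"
  assume ne: "?A x \<noteq> ?B x"
  define e where "e = \<bar>?A x - ?B x\<bar> / 2"
  have e: "e > 0" using ne by (simp add: e_def)
  have "isCont ?A x" "isCont ?B x"
    using smooth_on_continuous[OF smooth_on_pd[OF smooth_on_pd[OF assms(3)]]] assms(1,2) 
      continuous_on_eq_continuous_at by blast+
  then have "\<exists>d>0. \<forall>y. dist y x < d \<longrightarrow> \<bar>?A y - ?A x\<bar> < e" "\<exists>d>0. \<forall>y. dist y x < d \<longrightarrow> \<bar>?B y - ?B x\<bar> < e"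
    using e unfolding continuous_at_eps_delta dist_real_def by simp_all
  then obtain d1 d2 where d: "d1 > 0" "\<And>y. dist y x < d1 \<Longrightarrow> \<bar>?A y - ?A x\<bar> < e"
      "d2 > 0" "\<And>y. dist y x < d2 \<Longrightarrow> \<bar>?B y - ?B x\<bar> < e"
    by (elim exE conjE) blast
  obtain d3 where d3: "d3 > 0" "ball x d3 \<subseteq> U" using assms(1,2) open_contains_ball by blast
  define D where "D = min d1 (min d2 d3)"
  define h where "h = D / (2 * (norm u + norm v + 1))"
  have D: "D > 0" using d d3 by (simp add: D_def)
  have h: "h > 0" unfolding h_def using D by (intro divide_pos_pos) (auto intro: add_nonneg_pos)
  have near: "dist (x + a *\<^sub>R u + b *\<^sub>R v) x < D" if "0 \<le> a" "a \<le> h" "0 \<le> b" "b \<le> h" for a b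
  proof -
    have "norm (a *\<^sub>R u + b *\<^sub>R v) \<le> a * norm u + b * norm v"
      using that by (metis norm_triangle_le norm_scaleR abs_of_nonneg order_refl)
    also have "\<dots> \<le> h * norm u + h * norm v" using that by (intro add_mono mult_right_mono) auto
    also have "\<dots> \<le> h * (norm u + norm v + 1)" using h by (simp add: algebra_simps)
    also have "\<dots> = D / 2" using add_nonneg_pos[of "norm u + norm v" 1] unfolding h_def by (simp add: field_simps)
    also have "\<dots> < D" using D by simp
    finally show ?thesis by (simp add: dist_norm algebra_simps)
  qed
  have inU: "x + a *\<^sub>R u + b *\<^sub>R v \<in> U" if "0 \<le> a" "a \<le> h" "0 \<le> b" "b \<le> h" for a b
    using near[OF that] d3 unfolding D_def by (auto simp: dist_commute)
  then have inU': "x + a *\<^sub>R v + b *\<^sub>R u \<in> U" if "0 \<le> a" "a \<le> h" "0 \<le> b" "b \<le> h" for a b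
    using that by (metis add.assoc add.commute)
  obtain a b where ab: "0 < a" "a < h" "0 < b" "b < h" 
    "f (x + h *\<^sub>R u + h *\<^sub>R v) - f (x + h *\<^sub>R u) - f (x + h *\<^sub>R v) + f x = h * h * ?A (x + a *\<^sub>R u + b *\<^sub>R v)"
    using second_difference[OF assms(3) h inU] by auto
  obtain a' b' where ab': "0 < a'" "a' < h" "0 < b'" "b' < h" 
    "f (x + h *\<^sub>R v + h *\<^sub>R u) - f (x + h *\<^sub>R v) - f (x + h *\<^sub>R u) + f x = h * h * ?B (x + a' *\<^sub>R v + b' *\<^sub>R u)"
    using second_difference[OF assms(3) h inU'] by auto
  have "h * h * ?A (x + a *\<^sub>R u + b *\<^sub>R v) = h * h * ?B (x + a' *\<^sub>R v + b' *\<^sub>R u)"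
    using ab(5) ab'(5) by (simp add: algebra_simps)
  then have "?A (x + a *\<^sub>R u + b *\<^sub>R v) = ?B (x + b' *\<^sub>R u + a' *\<^sub>R v)"
    using h by (simp add: add.commute add.left_commute)
  moreover have "\<bar>?A (x + a *\<^sub>R u + b *\<^sub>R v) - ?A x\<bar> < e"
    using near[of a b] ab d(2) unfolding D_def by simp
  moreover have "\<bar>?B (x + b' *\<^sub>R u + a' *\<^sub>R v) - ?B x\<bar> < e"
    using near[of b' a'] ab' d(4) unfolding D_def by simp
  ultimately have "\<bar>?A x - ?B x\<bar> < 2 * e" by linarith
  then show False unfolding e_def by simp
qed

lemma schwarz:
  fixes f :: "'a::euclidean_space \<Rightarrow> 'b::euclidean_space"
  assumes "open U" "x \<in> U" "smooth_on U f"
  shows "pd v (pd u f) x = pd u (pd v f) x"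
proof (rule euclidean_eqI)
  fix b :: 'b
  let ?f = "\<lambda>y. f y \<bullet> b"
  have bl: "bounded_linear (\<lambda>y::'b. y \<bullet> b)" by (rule bounded_linear_inner_left)
  have s: "smooth_on U ?f" by (rule smooth_on_linear_compose[OF bl assms(1,3)])
  have 1: "pd w ?f y = pd w f y \<bullet> b" if "y \<in> U" for w y
    by (rule pd_linear[OF bl smooth_on_differentiable[OF assms(3) that]])
  have 2: "pd w' (pd w ?f) x = pd w' (pd w f) x \<bullet> b" for w w'
  proof -
    have "pd w' (pd w ?f) x = pd w' (\<lambda>y. pd w f y \<bullet> b) x"
      by (rule pd_cong_open(1)[OF assms(1,2) 1 smooth_on_differentiable[OF smooth_on_pd[OF s] assms(2)]])
    also have "\<dots> = pd w' (pd w f) x \<bullet> b"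
      by (rule pd_linear[OF bl smooth_on_differentiable[OF smooth_on_pd[OF assms(3)] assms(2)]])
    finally show ?thesis .
  qed
  show "pd v (pd u f) x \<bullet> b = pd u (pd v f) x \<bullet> b"
    using schwarz_real[OF assms(1,2) s, of v u] 2 by simp
qed


section \<open>Second order terms averaged over a leaf\<close>

lemma pd_shift:
  assumes "f differentiable (at (x + w))"
  shows "pd v (\<lambda>y. f (y + w)) x = pd v f (x + w)"
proof -
  have "((\<lambda>y. y + w) has_derivative (\<lambda>h. h)) (at x)" by (auto intro!: derivative_eq_intros)
  then have "((\<lambda>y. f (y + w)) has_derivative frechet_derivative f (at (x + w))) (at x)"
    using diff_chain_at[of "\<lambda>y. y + w" _ x f] assms by (simp add: frechet_derivative_works o_def)
  then show ?thesis by (rule pd_eq)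
qed

lemma pd_periodic:
  assumes "smooth_on UNIV f" "\<And>y. f (y + w) = f y"
  shows "pd v f (x + w) = pd v f x"
  using pd_shift[OF smooth_on_differentiable[OF assms(1)], of x w v] assms(2) by simp

text \<open>The mean over a leaf torus of a divergence \<open>D\<^sub>1 a + D\<^sub>2 b\<close> vanishes, so that a constant
  divergence is zero.\<close>

lemma constant_periodic_divergence:
  fixes a b :: "'a::euclidean_space \<Rightarrow> real"
  assumes sm: "smooth_on UNIV a" "smooth_on UNIV b" and T: "T1 > 0" "T2 > 0"
    and per: "\<And>x. a (x + T1 *\<^sub>R u) = a x" "\<And>x. b (x + T2 *\<^sub>R v) = b x"
    and div: "\<And>s r. pd u a (x + s *\<^sub>R u + r *\<^sub>R v) + pd v b (x + s *\<^sub>R u + r *\<^sub>R v) = \<kappa>"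
  shows "\<kappa> = 0"
proof -
  let ?p = "\<lambda>s r. x + s *\<^sub>R u + r *\<^sub>R v"
  define A where "A s = integral (cbox 0 T2) (\<lambda>r. a (?p s r))" for s
  have d: "a differentiable (at y)" "b differentiable (at y)" for y
    using sm smooth_on_differentiable by blast+
  have ca: "continuous_on S (\<lambda>y. a (h y))" "continuous_on S (\<lambda>y. pd u a (h y))"
    if "continuous_on S h" for S :: "'c::topological_space set" and h
    using continuous_on_compose2[OF smooth_on_continuous[OF sm(1)] that]
      continuous_on_compose2[OF smooth_on_continuous[OF smooth_on_pd[OF sm(1)]] that] by auto
  have "(A has_vector_derivative integral (cbox 0 T2) (\<lambda>r. pd u a (?p s r))) (at s within UNIV)" for s
    unfolding A_def
  proof (rule leibniz_rule_vector_derivative)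
    show "((\<lambda>s. a (?p s r)) has_vector_derivative pd u a (?p s r)) (at s within UNIV)" for s r
      using has_vector_derivative_along_line[of a "x + r *\<^sub>R v" s u] d by (simp add: algebra_simps)
    show "(\<lambda>r. a (?p s r)) integrable_on cbox 0 T2" for s
      by (intro integrable_continuous ca continuous_intros)
    have "continuous_on (UNIV \<times> cbox 0 T2) (\<lambda>y. pd u a (?p (fst y) (snd y)))"
      by (intro ca continuous_intros)
    then show "continuous_on (UNIV \<times> cbox 0 T2) (\<lambda>(s, r). pd u a (?p s r))" by (simp add: split_beta)
  qed auto
  moreover have "((\<lambda>r. pd u a (?p s r)) has_integral T2 * \<kappa>) (cbox 0 T2)" for s
  proof -
    have "((\<lambda>r. pd v b (?p s r)) has_integral (b (?p s T2) - b (?p s 0))) {0..T2}"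
      using T has_vector_derivative_along_line[of b "x + s *\<^sub>R u" _ v] d
      by (intro fundamental_theorem_of_calculus) (auto intro: has_vector_derivative_at_within)
    then have "((\<lambda>r. pd v b (?p s r)) has_integral 0) (cbox 0 T2)"
      using per(2)[of "x + s *\<^sub>R u"] by simp
    moreover have "((\<lambda>r. \<kappa>) has_integral (T2 * \<kappa>)) (cbox 0 T2)"
      using has_integral_const_real[of \<kappa> 0 T2] T by simp
    ultimately have "((\<lambda>r. \<kappa> - pd v b (?p s r)) has_integral (T2 * \<kappa> - 0)) (cbox 0 T2)"
      by (intro has_integral_diff)
    moreover have "\<kappa> - pd v b (?p s r) = pd u a (?p s r)" for r using div[of s r] by linarith
    ultimately show ?thesis by simp
  qed
  then have "integral (cbox 0 T2) (\<lambda>r. pd u a (?p s r)) = T2 * \<kappa>" for s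
    by (rule integral_unique)
  ultimately have "(A has_real_derivative T2 * \<kappa>) (at s)" for s
    by (simp add: has_real_derivative_iff_has_vector_derivative)
  then obtain z where "A T1 - A 0 = (T1 - 0) * (T2 * \<kappa>)"
    using MVT2[OF T(1), of A "\<lambda>_. T2 * \<kappa>"] by auto
  moreover have "A T1 = A 0"
    unfolding A_def using per(1)[of "x + r *\<^sub>R v" for r] by (simp add: algebra_simps)
  ultimately show ?thesis using T by simp
qed

text \<open>Here \<open>m\<close> and \<open>n\<close> are the first and second time derivatives of a path of one-forms and \<open>a 1\<close>,
  \<open>a 2\<close> span the leaves; the hypothesis \<open>eq\<close> is the second order part of the vanishing of the
  Pfaffian. Writing \<open>m\<close> as \<open>f + dg + M\<close> with \<open>M\<close> zero on the leaves, every term of \<open>eq\<close> is a leafwise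
  divergence, except for the Jacobian of \<open>f 1, f 2\<close> in the transverse directions, which is constant on
  the leaf. This is, up to a factor, the Poisson bracket of \<open>f 1\<close> and \<open>f 2\<close> on the leaf space.\<close>

lemma leafwise_average_of_second_order_term:
  fixes a :: "nat \<Rightarrow> 'a::euclidean_space" and m n f :: "nat \<Rightarrow> 'a \<Rightarrow> real" and T :: "nat \<Rightarrow> real"
  assumes T: "T 1 > 0" "T 2 > 0"
    and sm: "\<And>j. smooth_on UNIV (m j)" "\<And>j. smooth_on UNIV (n j)" "\<And>j. smooth_on UNIV (f j)" "smooth_on UNIV g"
    and per: "\<And>j k x. k \<in> {1, 2} \<Longrightarrow> m j (x + T k *\<^sub>R a k) = m j x" 
      "\<And>j k x. k \<in> {1, 2} \<Longrightarrow> n j (x + T k *\<^sub>R a k) = n j x"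
      "\<And>k x. k \<in> {1, 2} \<Longrightarrow> g (x + T k *\<^sub>R a k) = g x"
    and leaf: "\<And>j x s r. j \<in> {1, 2} \<Longrightarrow> f j (x + (s *\<^sub>R a 1 + r *\<^sub>R a 2)) = f j x"
    and m: "\<And>j x. j \<in> {1, 2} \<Longrightarrow> m j x = f j x + pd (a j) g x"
    and eq: "\<And>s r x. x = x0 + (s *\<^sub>R a 1 + r *\<^sub>R a 2) \<Longrightarrow>
        c * (pd (a 1) (n 2) x - pd (a 2) (n 1) x) =
        2 * ((pd (a 1) (m 3) x - pd (a 3) (m 1) x) * (pd (a 2) (m 4) x - pd (a 4) (m 2) x)
           - (pd (a 1) (m 4) x - pd (a 4) (m 1) x) * (pd (a 2) (m 3) x - pd (a 3) (m 2) x))"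
  shows "pd (a 3) (f 1) x0 * pd (a 4) (f 2) x0 = pd (a 4) (f 1) x0 * pd (a 3) (f 2) x0"
proof -
  define M where "M j x = m j x - pd (a j) g x" for j x
  define C where "C i j = pd (a j) (f i) x0" for i j
  have sM: "smooth_on UNIV (M j)" for j
    unfolding M_def using sm by (intro smooth_on_diff smooth_on_pd) auto
  have perM: "M j (x + T k *\<^sub>R a k) = M j x" if "k \<in> {1,2}" for j k x
    unfolding M_def using per(1,3)[OF that] pd_periodic[OF sm(4)] that by auto
  note D = smooth_on_differentiable[OF _ UNIV_I]
  have B: "pd (a i) (m j) x - pd (a j) (m i) x = pd (a i) (M j) x - pd (a j) (f i) x"
    if "i \<in> {1,2}" for i j x
  proof -
    have "m i = (\<lambda>x. f i x + pd (a i) g x)" using m[OF that] by auto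
    then have 1: "pd (a j) (m i) x = pd (a j) (f i) x + pd (a j) (pd (a i) g) x"
      using pd_add[OF D[OF sm(3)] D[OF smooth_on_pd[OF sm(4)]], where v = "a j" and x = x] by simp
    have "M j = (\<lambda>x. m j x - pd (a j) g x)" unfolding M_def by auto
    then have 2: "pd (a i) (M j) x = pd (a i) (m j) x - pd (a i) (pd (a j) g) x"
      using pd_diff[OF D[OF sm(1)] D[OF smooth_on_pd[OF sm(4)]], where v = "a i" and x = x] by simp
    show ?thesis using 1 2 schwarz[OF open_UNIV UNIV_I sm(4), where v = "a i" and u = "a j" and x = x] by simp
  qed
  have Cleaf: "pd (a j) (f i) x = C i j" if "i \<in> {1,2}" "x = x0 + (s *\<^sub>R a 1 + r *\<^sub>R a 2)" for i j x s r
    unfolding C_def that(2) using pd_periodic[OF sm(3) leaf[OF that(1)]] by simp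
  define A where "A x = M 3 x * pd (a 2) (M 4) x - C 2 4 * M 3 x + C 2 3 * M 4 x - c / 2 * n 2 x" for x
  define E where "E x = c / 2 * n 1 x - M 3 x * pd (a 1) (M 4) x - C 1 3 * M 4 x + C 1 4 * M 3 x" for x
  have sAE: "smooth_on UNIV A" "smooth_on UNIV E"
    unfolding A_def E_def using sM sm by (intro smooth_on_diff smooth_on_add smooth_on_mult smooth_on_pd smooth_on_const; simp)+
  have perAE: "A (x + T k *\<^sub>R a k) = A x" "E (x + T k *\<^sub>R a k) = E x" if "k \<in> {1,2}" for k x
    unfolding A_def E_def using perM[OF that] per(2)[OF that] pd_periodic[OF sM perM[OF that]] by simp_all
  \<comment> \<open>\<open>A\<close> and \<open>E\<close> collect the terms of \<open>eq\<close> that are derivatives along \<open>a 1\<close> and \<open>a 2\<close>; the quadratic part uses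
    \<open>D\<^sub>1 p D\<^sub>2 q - D\<^sub>1 q D\<^sub>2 p = D\<^sub>1 (p D\<^sub>2 q) - D\<^sub>2 (p D\<^sub>1 q)\<close>, and the transverse derivatives \<open>C\<close> of \<open>f\<close> are constant on the leaf.\<close>
  have "C 1 4 * C 2 3 - C 1 3 * C 2 4 = 0"
  proof (rule constant_periodic_divergence[OF sAE T perAE(1) perAE(2)])
    fix s r
    define x where "x = x0 + s *\<^sub>R a 1 + r *\<^sub>R a 2"
    have x: "x = x0 + (s *\<^sub>R a 1 + r *\<^sub>R a 2)" by (simp add: x_def add.assoc)
    have A: "pd (a 1) A x = M 3 x * pd (a 1) (pd (a 2) (M 4)) x + pd (a 1) (M 3) x * pd (a 2) (M 4) x
        - C 2 4 * pd (a 1) (M 3) x + C 2 3 * pd (a 1) (M 4) x - c / 2 * pd (a 1) (n 2) x"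
      unfolding A_def
      by (rule pd_eq) (use D[OF sM] D[OF smooth_on_pd[OF sM]] D[OF sm(2)] in 
          \<open>auto intro!: derivative_eq_intros simp: frechet_derivative_works\<close>)
    have E: "pd (a 2) E x = c / 2 * pd (a 2) (n 1) x - (M 3 x * pd (a 2) (pd (a 1) (M 4)) x 
        + pd (a 2) (M 3) x * pd (a 1) (M 4) x) - C 1 3 * pd (a 2) (M 4) x + C 1 4 * pd (a 2) (M 3) x"
      unfolding E_def
      by (rule pd_eq) (use D[OF sM] D[OF smooth_on_pd[OF sM]] D[OF sm(2)] in 
          \<open>auto intro!: derivative_eq_intros simp: frechet_derivative_works\<close>)
    have S: "pd (a 2) (pd (a 1) (M 4)) x = pd (a 1) (pd (a 2) (M 4)) x"
      by (rule schwarz[OF open_UNIV UNIV_I sM])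
    have "c / 2 * (pd (a 1) (n 2) x - pd (a 2) (n 1) x) =
        (pd (a 1) (M 3) x - C 1 3) * (pd (a 2) (M 4) x - C 2 4)
           - (pd (a 1) (M 4) x - C 1 4) * (pd (a 2) (M 3) x - C 2 3)"
      using eq[OF x] B[of 1] B[of 2] Cleaf[OF _ x] by simp
    then show "pd (a 1) A (x0 + s *\<^sub>R a 1 + r *\<^sub>R a 2) + pd (a 2) E (x0 + s *\<^sub>R a 1 + r *\<^sub>R a 2) 
        = C 1 4 * C 2 3 - C 1 3 * C 2 4"
      unfolding x_def[symmetric] A E S by (simp add: algebra_simps)
  qed auto
  then show ?thesis unfolding C_def by simp
qed

text \<open>Two derivatives of the Pfaffian identity at a time where all entries but \<open>x 6\<close> vanish: the first
  one gives \<open>x' 1 0 = 0\<close>, and then every term of the second one that is missing in the conclusion has a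
  vanishing factor.\<close>

lemma pfaffian_second_order:
  fixes x x' x'' :: "nat \<Rightarrow> real \<Rightarrow> real"
  assumes e: "e > 0"
    and d: "\<And>j t. \<bar>t\<bar> < e \<Longrightarrow> (x j has_real_derivative x' j t) (at t)"
      "\<And>j. (x' j has_real_derivative x'' j 0) (at 0)"
    and z: "\<And>t. \<bar>t\<bar> < e \<Longrightarrow> x 1 t * x 6 t - x 2 t * x 5 t + x 3 t * x 4 t = 0"
    and z0: "\<And>j. j \<in> {1..5} \<Longrightarrow> x j 0 = 0" and "x 6 0 \<noteq> 0"
  shows "x 6 0 * x'' 1 0 = 2 * (x' 2 0 * x' 5 0 - x' 3 0 * x' 4 0)"
proof -
  have zero: "D = 0" if "(f has_real_derivative D) (at t)" "\<And>t. \<bar>t\<bar> < e \<Longrightarrow> f t = 0" "\<bar>t\<bar> < e" for f D t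
  proof -
    have "((\<lambda>_. 0) has_real_derivative D) (at t)"
      by (rule has_field_derivative_transform_within_open[OF that(1), of "{-e<..<e}"]) (use that in auto)
    then show ?thesis by (rule DERIV_unique) simp
  qed
  let ?P' = "\<lambda>t. x 1 t * x' 6 t + x' 1 t * x 6 t - (x 2 t * x' 5 t + x' 2 t * x 5 t) + (x 3 t * x' 4 t + x' 3 t * x 4 t)"
  have 1: "?P' t = 0" if "\<bar>t\<bar> < e" for t
    by (rule zero[OF _ z that]) (auto intro!: derivative_eq_intros d that simp: algebra_simps)
  then have x1: "x' 1 0 = 0" using z0 e assms(6) 1[of 0] by simp
  have "x 1 0 * x'' 6 0 + x' 1 0 * x' 6 0 + (x' 1 0 * x' 6 0 + x'' 1 0 * x 6 0) 
      - (x 2 0 * x'' 5 0 + x' 2 0 * x' 5 0 + (x' 2 0 * x' 5 0 + x'' 2 0 * x 5 0)) 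
      + (x 3 0 * x'' 4 0 + x' 3 0 * x' 4 0 + (x' 3 0 * x' 4 0 + x'' 3 0 * x 4 0)) = 0"
    by (rule zero[OF _ 1, where t = 0]) (use e in \<open>auto intro!: derivative_eq_intros d simp: algebra_simps\<close>)
  then show ?thesis using x1 z0 by (simp add: algebra_simps)
qed

lemma smooth_on_slice:
  fixes h :: "real \<times> 'a::euclidean_space \<Rightarrow> 'b::real_normed_vector"
  assumes "smooth_on ({-e<..<e} \<times> UNIV) h" "\<bar>t\<bar> < e"
  shows "smooth_on UNIV (\<lambda>x. h (t, x))"
proof (rule smooth_on_compose[OF open_UNIV _ assms(1)])
  show "smooth_on UNIV (\<lambda>x::'a. (t, x))"
    by (intro smooth_on_Pair smooth_on_const smooth_on_bounded_linear bounded_linear_ident open_UNIV)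
qed (use assms(2) in auto)

lemma pd_slice:
  assumes "h differentiable (at (t, x))"
  shows "pd v (\<lambda>x. h (t, x)) x = pd (0, v) h (t, x)"
proof -
  have "((\<lambda>x. (t, x)) has_derivative (\<lambda>v. (0, v))) (at x)"
    by (auto intro!: derivative_eq_intros)
  then have "((\<lambda>x. h (t, x)) has_derivative (\<lambda>v. pd (0, v) h (t, x))) (at x)"
    using diff_chain_at[of "\<lambda>x. (t, x)" _ x h] assms by (simp add: frechet_derivative_works o_def)
  then show ?thesis by (rule pd_eq)
qed

text \<open>Here \<open>L j\<close> are the components of a path of primitives of the two-forms with the entries \<open>F i j\<close>, and
  \<open>a 1, a 2\<close> are the leaf directions. The second order part of the Pfaffian identity is exactly the
  hypothesis of the averaging lemma, once time derivatives are commuted with space derivatives.\<close>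

lemma commuting_of_pfaffian_zero:
  fixes a :: "nat \<Rightarrow> 'a::euclidean_space" and f :: "nat \<Rightarrow> 'a \<Rightarrow> real" and T :: "nat \<Rightarrow> real"
    and L :: "nat \<Rightarrow> real \<times> 'a \<Rightarrow> real"
  assumes e: "e > 0" and T: "T 1 > 0" "T 2 > 0"
    and sm: "\<And>j. smooth_on ({-e<..<e} \<times> UNIV) (L j)" "\<And>j. smooth_on UNIV (f j)" "smooth_on UNIV g"
    and per: "\<And>j k t x. k \<in> {1, 2} \<Longrightarrow> \<bar>t\<bar> < e \<Longrightarrow> L j (t, x + T k *\<^sub>R a k) = L j (t, x)" 
      "\<And>k x. k \<in> {1, 2} \<Longrightarrow> g (x + T k *\<^sub>R a k) = g x"
    and F: "\<And>i j p. F i j p = pd (0, a i) (L j) p - pd (0, a j) (L i) p"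
    and pf: "\<And>t s r x. x = x0 + (s *\<^sub>R a 1 + r *\<^sub>R a 2) \<Longrightarrow> \<bar>t\<bar> < e \<Longrightarrow>
       F 1 2 (t, x) * F 3 4 (t, x) - F 1 3 (t, x) * F 2 4 (t, x) + F 1 4 (t, x) * F 2 3 (t, x) = 0"
    and F0: "\<And>s r x i j. x = x0 + (s *\<^sub>R a 1 + r *\<^sub>R a 2) \<Longrightarrow> i \<in> {1, 2} \<Longrightarrow> F i j (0, x) = 0"
      "\<And>s r x. x = x0 + (s *\<^sub>R a 1 + r *\<^sub>R a 2) \<Longrightarrow> F 3 4 (0, x) = c" and c: "c \<noteq> 0"
    and leaf: "\<And>j x s r. j \<in> {1, 2} \<Longrightarrow> f j (x + (s *\<^sub>R a 1 + r *\<^sub>R a 2)) = f j x"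
    and m: "\<And>j x. j \<in> {1, 2} \<Longrightarrow> pd (1, 0) (L j) (0, x) = f j x + pd (a j) g x"
  shows "pd (a 3) (f 1) x0 * pd (a 4) (f 2) x0 = pd (a 4) (f 1) x0 * pd (a 3) (f 2) x0"
proof -
  let ?U = "{-e<..<e} \<times> (UNIV :: 'a set)" and ?\<tau> = "(1, 0) :: real \<times> 'a"
  have U: "open ?U" by (intro open_Times) auto
  have inU: "(t, x) \<in> ?U" if "\<bar>t\<bar> < e" for t x using that by auto
  have inU0: "(0, x) \<in> ?U" for x using e by auto
  have e0: "\<bar>0\<bar> < e" using e by simp
  note slice = smooth_on_slice[where t = 0, OF _ e0] pd_slice[OF smooth_on_differentiable[OF _ inU0]]
  have along: "((\<lambda>t. h (t, x)) has_real_derivative pd ?\<tau> h (t, x)) (at t)"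
    if "smooth_on ?U h" "\<bar>t\<bar> < e" for h :: "real \<times> 'a \<Rightarrow> real" and t x
    using has_vector_derivative_along_line[of h "(0, x)" t ?\<tau>] smooth_on_differentiable[OF that(1) inU[OF that(2)], of x]
    by (simp add: has_real_derivative_iff_has_vector_derivative)
  define m n where "m j x = pd ?\<tau> (L j) (0, x)" and "n j x = pd ?\<tau> (pd ?\<tau> (L j)) (0, x)" for j x
  have sF: "smooth_on ?U (F i j)" for i j
  proof -
    have "smooth_on ?U (\<lambda>p. pd (0, a i) (L j) p - pd (0, a j) (L i) p)"
      by (intro smooth_on_diff smooth_on_pd sm U)
    then show ?thesis using F by presburger
  qed
  have F': "pd ?\<tau> (F i j) p = pd (0, a i) (pd ?\<tau> (L j)) p - pd (0, a j) (pd ?\<tau> (L i)) p" if p: "p \<in> ?U" for i j p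
  proof -
    have "F i j = (\<lambda>p. pd (0, a i) (L j) p - pd (0, a j) (L i) p)" using F by blast
    then show ?thesis 
      using pd_diff[OF smooth_on_differentiable[OF smooth_on_pd[OF sm(1)] p] smooth_on_differentiable[OF smooth_on_pd[OF sm(1)] p], 
          where v = ?\<tau>] schwarz[OF U p sm(1), where u = "(0, a i)" and v = ?\<tau>] 
        schwarz[OF U p sm(1), where u = "(0, a j)" and v = ?\<tau>] by simp
  qed
  have F'': "pd ?\<tau> (pd ?\<tau> (F i j)) p = pd (0, a i) (pd ?\<tau> (pd ?\<tau> (L j))) p - pd (0, a j) (pd ?\<tau> (pd ?\<tau> (L i))) p" 
    if p: "p \<in> ?U" for i j p
  proof -
    note s1 = smooth_on_pd[OF sm(1), where v = ?\<tau>]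
    have "pd ?\<tau> (pd ?\<tau> (F i j)) p = pd ?\<tau> (\<lambda>p. pd (0, a i) (pd ?\<tau> (L j)) p - pd (0, a j) (pd ?\<tau> (L i)) p) p"
      by (rule pd_cong_open(1)[OF U p F' smooth_on_differentiable[OF smooth_on_pd[OF sF] p]])
    then show ?thesis 
      using pd_diff[OF smooth_on_differentiable[OF smooth_on_pd[OF s1] p] smooth_on_differentiable[OF smooth_on_pd[OF s1] p], 
          where v = ?\<tau>] schwarz[OF U p s1, where u = "(0, a i)" and v = ?\<tau>] 
        schwarz[OF U p s1, where u = "(0, a j)" and v = ?\<tau>] by simp
  qed
  have mF: "pd ?\<tau> (F i j) (0, x) = pd (a i) (m j) x - pd (a j) (m i) x" for i j x
    unfolding F'[OF inU0] m_def slice(2)[OF smooth_on_pd[OF sm(1)]] ..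
  have nF: "pd ?\<tau> (pd ?\<tau> (F i j)) (0, x) = pd (a i) (n j) x - pd (a j) (n i) x" for i j x
    unfolding F''[OF inU0] n_def slice(2)[OF smooth_on_pd[OF smooth_on_pd[OF sm(1)]]] ..
  have perd: "pd ?\<tau> h (t, x + w) = pd ?\<tau> h (t, x)" 
    if "smooth_on ?U h" "\<And>t x. \<bar>t\<bar> < e \<Longrightarrow> h (t, x + w) = h (t, x)" "\<bar>t\<bar> < e"
    for h :: "real \<times> 'a \<Rightarrow> real" and w t x
  proof -
    have "((\<lambda>t. h (t, x)) has_real_derivative pd ?\<tau> h (t, x + w)) (at t)"
      by (rule has_field_derivative_transform_within_open[OF along[OF that(1,3), of "x + w"], of "{-e<..<e}"]) 
        (use that in auto)
    then show ?thesis using along[OF that(1,3), of x] by (rule DERIV_unique)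
  qed
  show ?thesis
  proof (rule leafwise_average_of_second_order_term[where m = m and n = n and T = T and g = g and c = c])
    show "smooth_on UNIV (m j)" "smooth_on UNIV (n j)" for j
      unfolding m_def n_def by (intro slice(1) smooth_on_pd sm)+
    show "m j (x + T k *\<^sub>R a k) = m j x" "n j (x + T k *\<^sub>R a k) = n j x" if "k \<in> {1, 2}" for j k x
      unfolding m_def n_def using e by (auto intro!: perd smooth_on_pd sm per(1)[OF that])
    show "m j x = f j x + pd (a j) g x" if "j \<in> {1, 2}" for j x
      unfolding m_def using m[OF that] .
    show "c * (pd (a 1) (n 2) x - pd (a 2) (n 1) x) =
        2 * ((pd (a 1) (m 3) x - pd (a 3) (m 1) x) * (pd (a 2) (m 4) x - pd (a 4) (m 2) x)
           - (pd (a 1) (m 4) x - pd (a 4) (m 1) x) * (pd (a 2) (m 3) x - pd (a 3) (m 2) x))" 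
      if x: "x = x0 + (s *\<^sub>R a 1 + r *\<^sub>R a 2)" for s r x
    proof -
      \<comment> \<open>The entry at index 0 is a dummy; the six entries of the form are numbered from 1.\<close>
      let ?F = "\<lambda>k. [F 1 2, F 1 2, F 1 3, F 1 4, F 2 3, F 2 4, F 3 4] ! (min k 6)"
      have s: "smooth_on ?U (?F k)" for k
      proof -
        have "?F k \<in> set [F 1 2, F 1 2, F 1 3, F 1 4, F 2 3, F 2 4, F 3 4]" by (intro nth_mem) auto
        then show ?thesis using sF by auto
      qed
      have "?F 6 (0, x) * pd ?\<tau> (pd ?\<tau> (?F 1)) (0, x) = 
        2 * (pd ?\<tau> (?F 2) (0, x) * pd ?\<tau> (?F 5) (0, x) - pd ?\<tau> (?F 3) (0, x) * pd ?\<tau> (?F 4) (0, x))"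
      proof (rule pfaffian_second_order[OF e, where x = "\<lambda>j t. ?F j (t, x)" and x' = "\<lambda>j t. pd ?\<tau> (?F j) (t, x)"
            and x'' = "\<lambda>j t. pd ?\<tau> (pd ?\<tau> (?F j)) (t, x)"])
        show "?F 1 (t, x) * ?F 6 (t, x) - ?F 2 (t, x) * ?F 5 (t, x) + ?F 3 (t, x) * ?F 4 (t, x) = 0"
          if "\<bar>t\<bar> < e" for t using pf[OF x that] by simp
        have "{1..5} = {1, 2, 3, 4, 5::nat}" by auto
        then show "?F j (0, x) = 0" if "j \<in> {1..5}" for j using F0(1)[OF x] that by auto
        show "?F 6 (0, x) \<noteq> 0" using F0(2)[OF x] c by simp
        show "((\<lambda>t. ?F j (t, x)) has_real_derivative pd ?\<tau> (?F j) (t, x)) (at t)" if "\<bar>t\<bar> < e" for j t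
          by (rule along[OF s that])
        show "((\<lambda>t. pd ?\<tau> (?F j) (t, x)) has_real_derivative pd ?\<tau> (pd ?\<tau> (?F j)) (0, x)) (at 0)" for j
          by (rule along[OF smooth_on_pd[OF s]]) (use e in simp)
      qed
      then show ?thesis by (simp add: mF nF F0(2)[OF x])
    qed
  qed (use T sm per leaf in auto)
qed


section \<open>Phase space in complex coordinates\<close>

definition zc :: "3 \<Rightarrow> phase \<Rightarrow> complex" where
  "zc j z = Complex (fst z $ j) (snd z $ j)"

definition of_zc :: "(3 \<Rightarrow> complex) \<Rightarrow> phase" where
  "of_zc w = (\<chi> j. Re (w j), \<chi> j. Im (w j))"

text \<open>The standard symplectic form, which is the same bilinear form at all points, in complex coordinates.\<close>

definition om :: "phase \<Rightarrow> phase \<Rightarrow> real" where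
  "om u v = (\<Sum>j\<in>UNIV. Im (cnj (zc j u) * zc j v))"

lemma zc_of_zc [simp]: "zc j (of_zc w) = w j"
  by (simp add: zc_def of_zc_def)

lemma phase_eqI: "(\<And>j. zc j u = zc j v) \<Longrightarrow> u = v"
  by (simp add: zc_def prod_eq_iff vec_eq_iff)

lemma zc_linear [simp]: "zc j (u + v) = zc j u + zc j v" "zc j (u - v) = zc j u - zc j v"
    "zc j (a *\<^sub>R u) = a *\<^sub>R zc j u" "zc j 0 = 0" "zc j (- u) = - zc j u"
  by (simp_all add: zc_def complex_eq_iff)

lemma bounded_linear_zc: "bounded_linear (zc j)"
  by (intro linear_conv_bounded_linear[THEN iffD1] linearI) simp_all

lemma of_zc_sum: "of_zc w = (\<Sum>j\<in>UNIV. (Re (w j) *\<^sub>R axis j 1, Im (w j) *\<^sub>R axis j 1))"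
  by (simp add: of_zc_def prod_eq_iff vec_eq_iff sum_prod axis_def fst_sum snd_sum if_distrib cong: if_cong)

lemma bounded_linear_axis_pair: "bounded_linear (\<lambda>c. (Re c *\<^sub>R axis (j::3) (1::real), Im c *\<^sub>R axis j (1::real)))"
  by (intro bounded_linear_intros bounded_linear_Re bounded_linear_Im)

lemma smooth_on_zc: "open U \<Longrightarrow> smooth_on U f \<Longrightarrow> smooth_on U (\<lambda>x. zc j (f x))"
  by (rule smooth_on_linear_compose[OF bounded_linear_zc])

lemma smooth_on_of_zc:
  assumes "open U" "\<And>j. smooth_on U (w j)" shows "smooth_on U (\<lambda>x. of_zc (\<lambda>j. w j x))"
  unfolding of_zc_sum by (intro smooth_on_sum assms smooth_on_linear_compose[OF bounded_linear_axis_pair])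

lemma has_derivative_zcI:
  assumes "\<And>j. ((\<lambda>x. zc j (f x)) has_derivative (\<lambda>v. zc j (f' v))) F"
  shows "(f has_derivative f') F"
proof -
  have "((\<lambda>x. of_zc (\<lambda>j. zc j (f x))) has_derivative (\<lambda>v. of_zc (\<lambda>j. zc j (f' v)))) F"
    unfolding of_zc_sum
    by (intro has_derivative_sum bounded_linear.has_derivative[OF bounded_linear_axis_pair] assms)
  moreover have "of_zc (\<lambda>j. zc j u) = u" for u by (rule phase_eqI) simp
  ultimately show ?thesis by simp
qed

lemma omega_std_eq_om: "omega_std z u v = om u v"
  by (simp add: omega_std_def om_def zc_def)

lemma om_linear [simp]:
  "om (u + v) w = om u w + om v w" "om w (u + v) = om w u + om w v" 
  "om (u - v) w = om u w - om v w" "om w (u - v) = om w u - om w v" 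
  "om (a *\<^sub>R u) w = a * om u w" "om w (a *\<^sub>R u) = a * om w u" "om 0 w = 0" "om w 0 = 0"
  "om (- u) w = - om u w" "om w (- u) = - om w u"
  by (simp_all add: om_def sum.distrib sum_subtractf sum_distrib_left sum_negf algebra_simps)

lemma om_skew: "om v u = - om u v"
  by (simp add: om_def sum_negf[symmetric] mult.commute)

lemma om_self [simp]: "om u u = 0"
  using om_skew[of u u] by simp

lemma bounded_bilinear_om: "bounded_bilinear om"
  by (intro bilinear_conv_bounded_bilinear[THEN iffD1]) (simp add: bilinear_def linear_iff)

lemma om_sum: "om u v = Im (cnj (zc 1 u) * zc 1 v) + Im (cnj (zc 2 u) * zc 2 v) + Im (cnj (zc 3 u) * zc 3 v)"
  by (simp add: om_def sum_3)

text \<open>The linear vector field of the torus rotation with weights \<open>\<beta>\<close>, i.e. the Hamiltonian vector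
  field of \<open>\<beta> 1 H 1 + \<beta> 2 H 2 + \<beta> 3 H 3\<close> up to sign.\<close>

definition rot :: "(3 \<Rightarrow> real) \<Rightarrow> phase \<Rightarrow> phase" where
  "rot \<beta> z = of_zc (\<lambda>j. \<i> * of_real (\<beta> j) * zc j z)"

lemma zc_rot [simp]: "zc j (rot \<beta> z) = \<i> * of_real (\<beta> j) * zc j z"
  by (simp add: rot_def)

lemma rot_linear [simp]: "rot \<beta> (u + v) = rot \<beta> u + rot \<beta> v" "rot \<beta> (a *\<^sub>R u) = a *\<^sub>R rot \<beta> u"
    "rot \<beta> (u - v) = rot \<beta> u - rot \<beta> v"
  by (auto intro!: phase_eqI simp: algebra_simps)

lemma bounded_linear_rot: "bounded_linear (rot \<beta>)"
  by (intro linear_conv_bounded_linear[THEN iffD1] linearI) simp_all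

lemma om_rot: "om (rot \<beta> z) v = - (\<Sum>j\<in>UNIV. \<beta> j * Re (cnj (zc j z) * zc j v))"
  by (simp add: om_def sum_negf[symmetric] algebra_simps)

lemma om_rot_swap: "om z (rot \<beta> v) = - om (rot \<beta> z) v"
  by (simp add: om_def sum_negf[symmetric] algebra_simps)

text \<open>The weights of the second Hamiltonian of \<open>Y_alpha\<close>; those of the first one are all 1.\<close>

definition wt :: "real \<Rightarrow> 3 \<Rightarrow> real" where
  "wt \<alpha> j = (if j = 1 then 1 else if j = 2 then \<alpha> else 0)"

lemma wt_simps [simp]: "wt \<alpha> 1 = 1" "wt \<alpha> 2 = \<alpha>" "wt \<alpha> 3 = 0"
  by (simp_all add: wt_def)

lemma om_rot_self: "om z (rot \<beta> z) = (\<Sum>j\<in>UNIV. \<beta> j * (cmod (zc j z))\<^sup>2)"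
  unfolding om_def cmod_power2 by (simp add: power2_eq_square algebra_simps)

text \<open>As \<open>om z (rot \<beta> z)\<close> is twice the Hamiltonian with weights \<open>\<beta>\<close>, both equations of \<open>Y_alpha\<close> take the same
  shape, and the differential of the left-hand side is a multiple of \<open>om (rot \<beta> z)\<close>.\<close>

lemma Y_alpha_iff: "z \<in> Y_alpha \<alpha> \<longleftrightarrow> om z (rot (\<lambda>_. 1) z) = 1 \<and> om z (rot (wt \<alpha>) z) = 1/2"
proof -
  have "(cmod (zc j z))\<^sup>2 = 2 * H j z" for j unfolding cmod_power2 by (simp add: H_def zc_def)
  then show ?thesis unfolding om_rot_self sum_3 Y_alpha_def by (auto simp: algebra_simps)
qed

lemma Y_alpha_cmod:
  assumes "z \<in> Y_alpha \<alpha>"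
  shows "(cmod (zc 1 z))\<^sup>2 + (cmod (zc 2 z))\<^sup>2 + (cmod (zc 3 z))\<^sup>2 = 1"
    "(cmod (zc 1 z))\<^sup>2 + \<alpha> * (cmod (zc 2 z))\<^sup>2 = 1/2"
  using assms unfolding Y_alpha_iff om_rot_self sum_3 by simp_all

lemma has_derivative_constraint:
  "((\<lambda>z. om z (rot \<beta> z)) has_derivative (\<lambda>v. - 2 * om (rot \<beta> z) v)) (at z)"
proof -
  have "((\<lambda>z. om z (rot \<beta> z)) has_derivative (\<lambda>v. om z (rot \<beta> v) + om v (rot \<beta> z))) (at z)"
    by (rule bounded_bilinear.FDERIV[OF bounded_bilinear_om])
      (auto intro!: bounded_linear_imp_has_derivative bounded_linear_rot)
  moreover have "om z (rot \<beta> v) + om v (rot \<beta> z) = - 2 * om (rot \<beta> z) v" for v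
    using om_rot_swap[of z \<beta> v] om_skew[of v "rot \<beta> z"] by simp
  ultimately show ?thesis by simp
qed

section \<open>Tangent spaces and the null foliation\<close>

text \<open>The candidate for the tangent space: the solutions of the two linearised equations.\<close>

definition TY :: "real \<Rightarrow> phase \<Rightarrow> phase set" where
  "TY \<alpha> p = {v. om (rot (\<lambda>_. 1) p) v = 0 \<and> om (rot (wt \<alpha>) p) v = 0}"

text \<open>Differentiability of the curve at the single time 0 suffices. This is convenient for curves that
  arise from other curves by local extensions of maps.\<close>

lemma velocity_in_TY:
  assumes "(c has_vector_derivative v) (at 0)" "c 0 = p" "d > 0" "\<And>t. \<bar>t\<bar> < d \<Longrightarrow> c t \<in> Y_alpha \<alpha>"
  shows "v \<in> TY \<alpha> p"
proof -
  have "om (rot \<beta> p) v = 0" if "\<And>t. \<bar>t\<bar> < d \<Longrightarrow> om (c t) (rot \<beta> (c t)) = k" for \<beta> k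
  proof -
    have "((\<lambda>z. om z (rot \<beta> z)) has_derivative (\<lambda>v. - 2 * om (rot \<beta> p) v)) (at (c 0))"
      using has_derivative_constraint assms(2) by simp
    then have "((\<lambda>t. om (c t) (rot \<beta> (c t))) has_derivative (\<lambda>h. - 2 * om (rot \<beta> p) (h *\<^sub>R v))) (at 0)"
      using diff_chain_at[of c "\<lambda>h. h *\<^sub>R v" 0] assms(1) unfolding has_vector_derivative_def o_def by blast
    then have "((\<lambda>t. k) has_derivative (\<lambda>h. - 2 * om (rot \<beta> p) (h *\<^sub>R v))) (at 0)"
      by (rule has_derivative_transform_within_open[where s = "{-d<..<d}"]) (use that assms(3) in auto)
    then have "(\<lambda>h. - 2 * om (rot \<beta> p) (h *\<^sub>R v)) = (\<lambda>_. 0)"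
      by (rule has_derivative_unique) simp
    from fun_cong[OF this, of 1] show ?thesis by simp
  qed
  then show ?thesis using assms(4) unfolding TY_def Y_alpha_iff by blast
qed

lemma tangent_space_velocity:
  assumes "v \<in> tangent_space S p"
  obtains c e where "e > 0" "(c has_vector_derivative v) (at 0)" "c 0 = p" "\<And>t. \<bar>t\<bar> < e \<Longrightarrow> c t \<in> S"
    "smooth_on {-e<..<e} c"
proof -
  obtain c e where "e > 0" "smooth_on {-e<..<e} c" "c ` {-e<..<e} \<subseteq> S" "c 0 = p" "(c has_vector_derivative v) (at 0)"
    using assms unfolding tangent_space_def by blast
  then show ?thesis by (intro that[of e c]) (auto simp: image_subset_iff abs_less_iff)
qed

lemma tangent_spaceI:
  fixes c :: "real \<Rightarrow> 'a::euclidean_space"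
  assumes "open V" "0 \<in> V" "smooth_on V c" "\<And>t. t \<in> V \<Longrightarrow> c t \<in> S" "(c has_vector_derivative v) (at 0)"
  shows "v \<in> tangent_space S (c 0)"
proof -
  obtain e where e: "e > 0" "ball 0 e \<subseteq> V" using assms(1,2) open_contains_ball by blast
  then have "{-e<..<e} \<subseteq> V" by (auto simp: dist_real_def subset_eq)
  then show ?thesis unfolding tangent_space_def
    using e(1) smooth_on_subset[OF assms(3)] assms(4,5) by blast
qed

text \<open>For the converse inclusion the line \<open>p + t v\<close> is projected to \<open>Y_alpha\<close>: rescaling the first two
  coordinates restores the second equation, then rescaling the third one restores the first. If \<open>v\<close>
  satisfies the linearised equations, the scaling factors are stationary at \<open>t = 0\<close>.\<close>

lemma TY_subset_tangent_space:
  assumes a: "\<alpha> > 1" and p: "p \<in> Y_alpha \<alpha>" and v: "v \<in> TY \<alpha> p"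
  shows "v \<in> tangent_space (Y_alpha \<alpha>) p"
proof -
  define q where "q t = p + t *\<^sub>R v" for t
  define N where "N j t = Re (cnj (zc j (q t)) * zc j (q t))" for j t
  define A where "A t = 2 * (N 1 t + \<alpha> * N 2 t)" for t
  define s where "s t = A t powr (- 1/2)" for t
  define B where "B t = 1 - s t * s t * (N 1 t + N 2 t)" for t
  define r where "r t = B t powr (1/2) * N 3 t powr (- 1/2)" for t
  define c where "c t = of_zc (\<lambda>j. of_real (if j = 3 then r t else s t) * zc j (q t))" for t
  define V where "V = {t. 0 < A t \<and> 0 < N 3 t}"
  have N: "N j t = (cmod (zc j (q t)))\<^sup>2" for j t
    unfolding N_def cmod_power2 by (simp add: power2_eq_square)
  have Np: "N j t \<ge> 0" for j t by (simp add: N)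
  have sq: "smooth_on V q" for V
  proof (rule smooth_on_subset[OF _ subset_UNIV])
    show "smooth_on UNIV q" unfolding q_def
      by (intro smooth_on_add smooth_on_const smooth_on_bounded_linear bounded_linear_scaleR_left open_UNIV)
  qed
  have sN: "smooth_on V (N j)" if "open V" for V j
    unfolding N_def using that sq 
    by (intro smooth_on_linear_compose[OF bounded_linear_Re] smooth_on_mult
        smooth_on_linear_compose[OF bounded_linear_cnj] smooth_on_zc)
  have sA: "smooth_on V A" if "open V" for V
    unfolding A_def using that sN by (intro smooth_on_mult smooth_on_add smooth_on_const)
  have "V = (A -` {0<..} \<inter> N 3 -` {0<..})" unfolding V_def by auto
  moreover have "open (A -` {0<..})" "open (N 3 -` {0<..})"
    using smooth_on_continuous[OF sA[OF open_UNIV]] smooth_on_continuous[OF sN[OF open_UNIV, of 3]]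
    by (auto intro!: open_vimage)
  ultimately have V: "open V" by auto
  have ss: "s t * s t = 1 / A t" if "t \<in> V" for t
    using that unfolding s_def V_def by (simp add: powr_add[symmetric] powr_minus_divide)
  have B: "B t > 0" if "t \<in> V" for t
  proof -
    have "N 1 t + N 2 t \<le> N 1 t + \<alpha> * N 2 t" using a Np[of 2 t] by (simp add: mult_le_cancel_right1)
    then have "2 * (N 1 t + N 2 t) \<le> A t" unfolding A_def by simp
    moreover have "A t > 0" using that by (simp add: V_def)
    ultimately show ?thesis unfolding B_def ss[OF that] by (simp add: field_simps)
  qed
  have ss_sm: "smooth_on V s" unfolding s_def by (intro smooth_on_real_compose sA V) (simp add: V_def)
  have sr: "smooth_on V r" unfolding r_def
    using B ss_sm sN V unfolding B_def 
    by (intro smooth_on_mult smooth_on_real_compose smooth_on_diff smooth_on_add smooth_on_const) (auto simp: V_def)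
  have "smooth_on V (\<lambda>t. if j = 3 then r t else s t)" for j :: 3
    using ss_sm sr by (cases "j = 3") simp_all
  then have sc: "smooth_on V c" unfolding c_def
    by (intro smooth_on_of_zc smooth_on_mult smooth_on_zc V sq smooth_on_linear_compose[OF bounded_linear_of_real])
  have Nc: "(cmod (zc j (c t)))\<^sup>2 = (if j = 3 then r t else s t) * (if j = 3 then r t else s t) * N j t" for j t
    by (simp add: c_def N norm_mult power_mult_distrib power2_eq_square)
  have cY: "c t \<in> Y_alpha \<alpha>" if "t \<in> V" for t
  proof -
    have "r t * r t * N 3 t = B t"
      using that B[OF that] unfolding r_def V_def 
      by (simp add: powr_add[symmetric] powr_minus_divide mult.assoc mult.left_commute[of "N 3 t powr (- 1 / 2)"])
    moreover have "s t * s t * (N 1 t + \<alpha> * N 2 t) = 1/2"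
      using that ss[OF that] unfolding V_def by (simp add: A_def)
    ultimately show ?thesis
      unfolding Y_alpha_iff om_rot_self sum_3 Nc B_def by (simp add: algebra_simps)
  qed
  have N0: "N 1 0 + \<alpha> * N 2 0 = 1/2" "N 1 0 + N 2 0 + N 3 0 = 1"
    using Y_alpha_cmod[OF p] unfolding N q_def by simp_all
  have "\<alpha> * N 2 0 \<ge> N 2 0" using a Np[of 2 0] by (simp add: mult_le_cancel_right1)
  then have "N 3 0 > 0" using N0 by linarith
  then have V0: "0 \<in> V" using N0 unfolding V_def A_def by simp
  have A0: "A 0 = 1" using N0 by (simp add: A_def)
  have s0: "s 0 = 1" by (simp add: s_def A0)
  have B0: "B 0 = N 3 0" using N0 s0 by (simp add: B_def)
  have r0: "r 0 = 1" using \<open>N 3 0 > 0\<close> by (simp add: r_def B0 powr_add[symmetric])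
  define R where "R j = Re (cnj (zc j p) * zc j v)" for j
  have dN: "(N j has_real_derivative 2 * R j) (at 0)" for j
  proof -
    have "((\<lambda>t. zc j (q t)) has_vector_derivative zc j v) (at 0)"
      unfolding q_def by (auto intro!: derivative_eq_intros)
    then have "((\<lambda>t. cnj (zc j (q t)) * zc j (q t)) has_vector_derivative cnj (zc j p) * zc j v + cnj (zc j v) * zc j p) (at 0)"
      unfolding q_def by (auto intro!: derivative_eq_intros has_vector_derivative_cnj)
    from bounded_linear.has_vector_derivative[OF bounded_linear_Re this] show ?thesis
      unfolding N_def R_def has_real_derivative_iff_has_vector_derivative by (simp add: algebra_simps)
  qed
  have lin: "R 1 + R 2 + R 3 = 0" "R 1 + \<alpha> * R 2 = 0"
    using v unfolding TY_def om_rot sum_3 R_def by (simp_all add: algebra_simps)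
  have dA: "(A has_real_derivative 0) (at 0)"
    unfolding A_def by (rule derivative_eq_intros dN refl)+ (use lin in \<open>simp add: algebra_simps\<close>)
  have ds: "(s has_real_derivative 0) (at 0)"
    unfolding s_def using A0 by (auto intro!: derivative_eq_intros dA)
  have dB: "(B has_real_derivative 2 * R 3) (at 0)"
    unfolding B_def using s0 lin by (auto intro!: derivative_eq_intros dN ds simp: algebra_simps)
  have dr: "(r has_real_derivative 0) (at 0)"
    unfolding r_def using \<open>N 3 0 > 0\<close> B0
    by (auto intro!: derivative_eq_intros dN dB simp: powr_diff powr_add[symmetric] field_simps)
  have "(c has_vector_derivative v) (at 0)"
    unfolding has_vector_derivative_def
  proof (rule has_derivative_zcI)
    fix j
    have 1: "((\<lambda>t. zc j (q t)) has_vector_derivative zc j v) (at 0)"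
      unfolding q_def by (auto intro!: derivative_eq_intros)
    have 2: "((\<lambda>t. if j = 3 then r t else s t) has_real_derivative 0) (at 0)" using dr ds by (cases "j = 3") simp_all
    have "((\<lambda>t. (if j = 3 then r t else s t) *\<^sub>R zc j (q t)) has_vector_derivative zc j v) (at 0)"
      using has_vector_derivative_scaleR[OF 2 1] r0 s0 by (simp split: if_splits)
    then show "((\<lambda>t. zc j (c t)) has_derivative (\<lambda>h. zc j (h *\<^sub>R v))) (at 0)"
      unfolding c_def has_vector_derivative_def by (simp add: scaleR_conv_of_real)
  qed
  moreover have "c 0 = p" by (rule phase_eqI) (simp add: c_def r0 s0 q_def)
  ultimately show ?thesis using tangent_spaceI[OF V V0 sc cY] by simp
qed

lemma tangent_space_Y_alpha:
  assumes "\<alpha> > 1" "p \<in> Y_alpha \<alpha>"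
  shows "tangent_space (Y_alpha \<alpha>) p = TY \<alpha> p"
proof
  show "tangent_space (Y_alpha \<alpha>) p \<subseteq> TY \<alpha> p"
    by (auto elim!: tangent_space_velocity intro: velocity_in_TY)
qed (use TY_subset_tangent_space[OF assms] in auto)


lemma Y_alpha_nonzero:
  assumes "\<alpha> > 1" "p \<in> Y_alpha \<alpha>"
  shows "zc 3 p \<noteq> 0" "zc 1 p \<noteq> 0 \<or> zc 2 p \<noteq> 0"
proof -
  note c = Y_alpha_cmod[OF assms(2)]
  have "(cmod (zc 2 p))\<^sup>2 \<le> \<alpha> * (cmod (zc 2 p))\<^sup>2" using assms(1) by (simp add: mult_le_cancel_right1)
  then show "zc 3 p \<noteq> 0" using c by auto
  show "zc 1 p \<noteq> 0 \<or> zc 2 p \<noteq> 0" using c(2) by auto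
qed

lemma om_eq_inner: "om u v = rot (\<lambda>_. 1) u \<bullet> v"
  by (simp add: om_def rot_def of_zc_def inner_prod_def inner_vec_def zc_def sum.distrib[symmetric] algebra_simps)

lemma rot_in_TY: "rot (\<lambda>_. 1) p \<in> TY \<alpha> p" "rot (wt \<alpha>) p \<in> TY \<alpha> p"
  by (auto simp: TY_def om_rot algebra_simps)

lemma rot_independent:
  assumes "\<alpha> > 1" "p \<in> Y_alpha \<alpha>" "a *\<^sub>R rot (\<lambda>_. 1) p + b *\<^sub>R rot (wt \<alpha>) p = 0"
  shows "a = 0" "b = 0"
proof -
  have z: "zc j (a *\<^sub>R rot (\<lambda>_. 1) p + b *\<^sub>R rot (wt \<alpha>) p) = 0" for j
    using assms(3) by simp
  show "a = 0" using z[of 3] Y_alpha_nonzero(1)[OF assms(1,2)] by simp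
  then show "b = 0" using z[of 1] z[of 2] Y_alpha_nonzero(2)[OF assms(1,2)] assms(1) by auto
qed

text \<open>With the complex structure \<open>J = rot 1\<close> the form is \<open>\<omega>(u, v) = J u \<bullet> v\<close>, hence the tangent space is the Euclidean
  complement of the two vectors \<open>J X\<close>. A null vector \<open>u\<close> has \<open>J u\<close> in the double complement, which is
  their span.\<close>

lemma null_space_Y_alpha:
  assumes "\<alpha> > 1" "p \<in> Y_alpha \<alpha>"
  shows "null_space (Y_alpha \<alpha>) omega_std p = span {rot (\<lambda>_. 1) p, rot (wt \<alpha>) p}"
proof -
  let ?J = "rot (\<lambda>_. 1)"
  let ?W = "span {?J (?J p), ?J (rot (wt \<alpha>) p)}"
  have TY: "TY \<alpha> p = ?W\<^sup>\<bottom>"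
  proof -
    have "orthogonal y x" if "x \<in> TY \<alpha> p" "y \<in> ?W" for x y
    proof -
      have "{?J (?J p), ?J (rot (wt \<alpha>) p)} \<subseteq> {y. orthogonal y x}"
        using that(1) unfolding TY_def om_eq_inner orthogonal_def by auto
      moreover have "subspace {y. orthogonal y x}"
        by (simp add: subspace_orthogonal_to_vector orthogonal_commute[of _ x])
      ultimately show ?thesis using that(2) span_minimal by blast
    qed
    moreover have "?J (?J p) \<in> ?W" "?J (rot (wt \<alpha>) p) \<in> ?W" by (auto intro: span_base)
    ultimately show ?thesis unfolding orthogonal_comp_def TY_def om_eq_inner orthogonal_def by blast
  qed
  show ?thesis
  proof (intro equalityI subsetI)
    fix u assume "u \<in> null_space (Y_alpha \<alpha>) omega_std p"
    then have "\<And>v. v \<in> TY \<alpha> p \<Longrightarrow> om u v = 0"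
      unfolding null_space_def tangent_space_Y_alpha[OF assms] omega_std_eq_om by simp
    then have "?J u \<in> (TY \<alpha> p)\<^sup>\<bottom>"
      unfolding orthogonal_comp_def om_eq_inner orthogonal_def by (simp add: inner_commute)
    then have "?J u \<in> ?W" using orthogonal_comp_self[OF subspace_span, of "{?J (?J p), ?J (rot (wt \<alpha>) p)}"] TY by simp
    then obtain a b where "?J u = a *\<^sub>R ?J (?J p) + b *\<^sub>R ?J (rot (wt \<alpha>) p)"
      unfolding span_insert span_singleton by (auto simp: algebra_simps)
    then have "?J u = ?J (a *\<^sub>R ?J p + b *\<^sub>R rot (wt \<alpha>) p)" by simp
    then have "u = a *\<^sub>R ?J p + b *\<^sub>R rot (wt \<alpha>) p"
      by (intro phase_eqI) (metis zc_rot mult_cancel_left of_real_1 mult_1_right complex_i_not_zero)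
    then show "u \<in> span {?J p, rot (wt \<alpha>) p}"
      by (auto intro!: span_add span_scale intro: span_base)
  next
    fix u assume "u \<in> span {?J p, rot (wt \<alpha>) p}"
    then obtain a b where u: "u = a *\<^sub>R ?J p + b *\<^sub>R rot (wt \<alpha>) p"
      unfolding span_insert span_singleton by (auto simp: algebra_simps)
    have "u \<in> TY \<alpha> p" using rot_in_TY[where p = p and \<alpha> = \<alpha>] unfolding u TY_def by simp
    moreover have "om u v = 0" if "v \<in> TY \<alpha> p" for v using that unfolding u TY_def by simp
    ultimately show "u \<in> null_space (Y_alpha \<alpha>) omega_std p"
      unfolding null_space_def tangent_space_Y_alpha[OF assms] omega_std_eq_om by simp
  qed
qed

lemma null_spaceE:
  assumes "\<alpha> > 1" "p \<in> Y_alpha \<alpha>" "u \<in> null_space (Y_alpha \<alpha>) omega_std p"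
  obtains a b where "u = a *\<^sub>R rot (\<lambda>_. 1) p + b *\<^sub>R rot (wt \<alpha>) p"
  using assms(3) unfolding null_space_Y_alpha[OF assms(1,2)] span_insert span_singleton by (auto simp: algebra_simps)

lemma rot_in_null_space:
  assumes "\<alpha> > 1" "p \<in> Y_alpha \<alpha>"
  shows "a *\<^sub>R rot (\<lambda>_. 1) p + b *\<^sub>R rot (wt \<alpha>) p \<in> null_space (Y_alpha \<alpha>) omega_std p"
  unfolding null_space_Y_alpha[OF assms] by (auto intro!: span_add span_scale intro: span_base)

lemma dim_null_space_Y_alpha:
  assumes "\<alpha> > 1" "p \<in> Y_alpha \<alpha>"
  shows "dim (null_space (Y_alpha \<alpha>) omega_std p) = 2"
proof -
  let ?u = "rot (\<lambda>_. 1) p" and ?v = "rot (wt \<alpha>) p"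
  have "?u \<notin> span {?v}"
  proof
    assume "?u \<in> span {?v}"
    then obtain k where "?u = k *\<^sub>R ?v" unfolding span_singleton by auto
    then show False using rot_independent(1)[OF assms, of 1 "- k"] by simp
  qed
  moreover have "?v \<noteq> 0" using rot_independent(2)[OF assms, of 0 1] by auto
  ultimately have "independent {?u, ?v}" "?u \<noteq> ?v"
    by (auto simp: independent_insert span_base)
  then show ?thesis unfolding null_space_Y_alpha[OF assms] by (simp add: dim_eq_card_independent)
qed

lemma tangent_space_UNIV: "tangent_space UNIV p = UNIV"
proof (intro equalityI subsetI)
  fix v :: 'a
  have "smooth_on UNIV (\<lambda>t::real. p + t *\<^sub>R v)"
    by (intro smooth_on_add smooth_on_const smooth_on_bounded_linear bounded_linear_scaleR_left open_UNIV)
  moreover have "((\<lambda>t. p + t *\<^sub>R v) has_vector_derivative v) (at 0)"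
    by (auto intro!: derivative_eq_intros)
  ultimately show "v \<in> tangent_space UNIV p"
    using tangent_spaceI[of UNIV "\<lambda>t. p + t *\<^sub>R v" UNIV v] by simp
qed simp

lemma submanifold_Y_alpha:
  assumes "\<alpha> > 1" shows "submanifold 4 (Y_alpha \<alpha>)"
  unfolding submanifold_def
proof
  fix p assume p: "p \<in> Y_alpha \<alpha>"
  define b1 b2 :: phase where "b1 = (axis 1 1, 0)" and "b2 = (axis 2 1, 0)"
  let ?M = "\<lambda>\<beta> z. om z (rot \<beta> z)"
  define F where "F z = (?M (\<lambda>_. 1) z - 1) *\<^sub>R b1 + (?M (wt \<alpha>) z - 1/2) *\<^sub>R b2" for z
  define L where "L = span {b1, b2}"
  define U where "U = {z. zc 3 z \<noteq> 0 \<and> ?M (wt \<alpha>) z > 0}"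
  have b: "fst b1 $ 1 = 1" "fst b1 $ 2 = 0" "fst b2 $ 1 = 0" "fst b2 $ 2 = 1"
    by (simp_all add: b1_def b2_def axis_def)
  have ind: "k *\<^sub>R b1 + l *\<^sub>R b2 = 0 \<longleftrightarrow> k = 0 \<and> l = 0" for k l
  proof
    assume "k *\<^sub>R b1 + l *\<^sub>R b2 = 0"
    from arg_cong[OF this, of "\<lambda>z. fst z $ 1"] arg_cong[OF this, of "\<lambda>z. fst z $ 2"]
    show "k = 0 \<and> l = 0" by (simp add: b)
  qed simp
  have sM: "smooth_on V (?M \<beta>)" if "open V" for V \<beta>
    by (intro smooth_on_bilinear[OF bounded_bilinear_om] that smooth_on_bounded_linear bounded_linear_rot bounded_linear_ident)
  have "U = (zc 3 -` (- {0})) \<inter> (?M (wt \<alpha>) -` {0<..})" unfolding U_def by auto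
  moreover have "open (zc 3 -` (- {0}))"
    by (intro open_vimage) (auto intro: linear_continuous_on bounded_linear_zc)
  moreover have "open (?M (wt \<alpha>) -` {0<..})"
    by (intro open_vimage smooth_on_continuous sM) auto
  ultimately have U: "open U" by auto
  have pU: "p \<in> U" using Y_alpha_nonzero(1)[OF assms p] p unfolding U_def Y_alpha_iff by simp
  have sF: "smooth_on U F" unfolding F_def
    by (intro smooth_on_add smooth_on_scaleR smooth_on_diff smooth_on_const sM U)
  have "b1 \<notin> span {b2}"
  proof
    assume "b1 \<in> span {b2}"
    then obtain k where "b1 = k *\<^sub>R b2" unfolding span_singleton by auto
    then show False using ind[of 1 "- k"] by simp
  qed
  moreover have "b2 \<noteq> 0" using ind[of 0 1] by auto
  ultimately have "independent {b1, b2}" "b1 \<noteq> b2"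
    by (auto simp: independent_insert span_base)
  then have dL: "dim L + 4 = DIM(phase)" unfolding L_def by (simp add: dim_eq_card_independent)
  have dF: "pd v F x = (- 2 * om (rot (\<lambda>_. 1) x) v) *\<^sub>R b1 + (- 2 * om (rot (wt \<alpha>) x) v) *\<^sub>R b2" for v x
    unfolding F_def by (rule pd_eq) (auto intro!: derivative_eq_intros has_derivative_constraint)
  have "range (frechet_derivative F (at x)) = L" if x: "x \<in> U" for x
  proof (intro equalityI subsetI)
    fix y assume "y \<in> range (frechet_derivative F (at x))"
    then show "y \<in> L" unfolding L_def by (auto simp: dF intro!: span_add span_diff span_scale span_neg intro: span_base)
  next
    fix y assume "y \<in> L"
    then obtain k l where y: "y = k *\<^sub>R b1 + l *\<^sub>R b2" 
      unfolding L_def span_insert span_singleton by (auto simp: algebra_simps)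
    let ?N = "\<lambda>j. (cmod (zc j x))\<^sup>2"
    define A where "A = ?N 1 + \<alpha> * ?N 2"
    have A: "A > 0" using x unfolding U_def om_rot_self sum_3 A_def by simp
    have N3: "?N 3 > 0" using x unfolding U_def by simp
    \<comment> \<open>Scaling of the first two coordinates moves the second function, scaling of the third
      coordinate moves the first function only.\<close>
    define s t where "s = l / (2 * A)" and "t = (k - 2 * s * (?N 1 + ?N 2)) / (2 * ?N 3)"
    define v where "v = of_zc (\<lambda>j. of_real (if j = 3 then t else s) * zc j x)"
    have R: "Re (cnj (zc j x) * zc j v) = (if j = 3 then t else s) * ?N j" for j
      unfolding cmod_power2 by (simp add: v_def power2_eq_square algebra_simps)
    have "- 2 * om (rot (wt \<alpha>) x) v = 2 * (s * A)"
      unfolding om_rot sum_3 R A_def by (simp add: algebra_simps)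
    also have "\<dots> = l" using A by (simp add: s_def)
    finally have 1: "- 2 * om (rot (wt \<alpha>) x) v = l" .
    have "- 2 * om (rot (\<lambda>_. 1) x) v = 2 * s * (?N 1 + ?N 2) + 2 * t * ?N 3"
      unfolding om_rot sum_3 R by (simp add: algebra_simps)
    also have "2 * t * ?N 3 = k - 2 * s * (?N 1 + ?N 2)"
      using N3 unfolding t_def by (simp add: divide_simps)
    also have "2 * s * (?N 1 + ?N 2) + (k - 2 * s * (?N 1 + ?N 2)) = k" by simp
    finally have "pd v F x = y" unfolding dF 1 y by simp
    then show "y \<in> range (frechet_derivative F (at x))" by blast
  qed
  moreover have "F ` U \<subseteq> L" unfolding F_def L_def by (auto intro!: span_add span_scale intro: span_base)
  moreover have "Y_alpha \<alpha> \<inter> U = {x \<in> U. F x = 0}"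
    unfolding F_def ind Y_alpha_iff[abs_def] by (auto simp: Y_alpha_iff)
  moreover have "subspace L" unfolding L_def by (rule subspace_span)
  ultimately show "\<exists>U (F :: phase \<Rightarrow> phase) L. open U \<and> p \<in> U \<and> smooth_on U F \<and> subspace L \<and>
      dim L + 4 = DIM(phase) \<and> F ` U \<subseteq> L \<and> (\<forall>x\<in>U. range (frechet_derivative F (at x)) = L) \<and>
      Y_alpha \<alpha> \<inter> U = {x \<in> U. F x = 0}"
    using U pU sF dL by (intro exI[of _ U] exI[of _ F] exI[of _ L] conjI ballI) auto
qed

text \<open>The derivative within \<open>S\<close> is an arbitrarily chosen linear map, but along a curve in \<open>S\<close> the chain rule
  fixes its value on the velocity. So on tangent vectors it may be computed from any local extension.\<close>

lemma dir_deriv_eq: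
  assumes "v \<in> tangent_space S p" "p \<in> S" "open U" "p \<in> U" "\<And>y. y \<in> U \<Longrightarrow> y \<in> S \<Longrightarrow> g y = f y"
    and "g differentiable (at p)"
  shows "dir_deriv S f p v = pd v g p"
proof -
  obtain c e where c: "e > 0" "(c has_vector_derivative v) (at 0)" "c 0 = p" "\<And>t. \<bar>t\<bar> < e \<Longrightarrow> c t \<in> S"
    using assms(1) by (auto elim: tangent_space_velocity)
  have "(g has_derivative frechet_derivative g (at p)) (at p within S)"
    using assms(6) by (simp add: frechet_derivative_works has_derivative_at_withinI)
  moreover obtain d where "d > 0" "ball p d \<subseteq> U" using assms(3,4) open_contains_ball by blast
  ultimately have gf: "(f has_derivative frechet_derivative g (at p)) (at p within S)"
    using assms(2,5) by (elim has_derivative_transform_within[where d = d]) (auto simp: dist_commute subset_eq)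
  then have "f differentiable (at p within S)" by (auto simp: differentiable_def)
  then have f: "(f has_derivative frechet_derivative f (at p within S)) (at p within S)"
    by (simp add: frechet_derivative_works)
  have cd: "(c has_derivative (\<lambda>h. h *\<^sub>R v)) (at 0 within {-e<..<e})"
    using c(2) unfolding has_vector_derivative_def by (rule has_derivative_at_withinI)
  have "c ` {-e<..<e} \<subseteq> S" using c(4) by auto
  then have comp: "((\<lambda>t. f (c t)) has_derivative (\<lambda>h. D (h *\<^sub>R v))) (at 0 within {-e<..<e})"
    if "(f has_derivative D) (at p within S)" for D
    using diff_chain_within[OF cd, of f D] has_derivative_subset[OF that] c(3) by (simp add: o_def)
  have 0: "(0::real) \<in> {-e<..<e}" using c(1) by simp
  have "(\<lambda>h::real. frechet_derivative f (at p within S) (h *\<^sub>R v)) = (\<lambda>h. pd (h *\<^sub>R v) g p)"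
  proof (rule has_derivative_unique)
    show "((\<lambda>t. f (c t)) has_derivative (\<lambda>h. frechet_derivative f (at p within S) (h *\<^sub>R v))) (at 0)"
      using comp[OF f] at_within_open[OF 0] by simp
    show "((\<lambda>t. f (c t)) has_derivative (\<lambda>h. pd (h *\<^sub>R v) g p)) (at 0)"
      using comp[OF gf] at_within_open[OF 0] by simp
  qed
  from fun_cong[OF this, of 1] show ?thesis unfolding dir_deriv_def by simp
qed

lemma presymplectic_Y_alpha:
  assumes "\<alpha> > 1" shows "presymplectic_manifold 3 1 (Y_alpha \<alpha>) omega_std"
proof -
  have d: "dir_deriv (Y_alpha \<alpha>) (\<lambda>x. k) x u = 0" 
    if "x \<in> Y_alpha \<alpha>" "u \<in> tangent_space (Y_alpha \<alpha>) x" for x u and k :: real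
    using dir_deriv_eq[OF that(2,1) open_UNIV, of "\<lambda>_. k" "\<lambda>_. k"] by simp
  have "bilinear om" using bounded_bilinear_om bilinear_conv_bounded_bilinear by blast
  moreover have "smooth_map_on (Y_alpha \<alpha>) (\<lambda>x. k)" for k :: real
    unfolding smooth_map_on_def using smooth_on_const open_UNIV by blast
  ultimately have "closed_twoform (Y_alpha \<alpha>) omega_std"
    unfolding closed_twoform_def ext_deriv2_def omega_std_eq_om[abs_def] by (simp add: d)
  then show ?thesis unfolding presymplectic_manifold_def
    using submanifold_Y_alpha[OF assms] dim_null_space_Y_alpha[OF assms] by simp
qed

lemma coisotropic_Y_alpha:
  assumes "\<alpha> > 1" shows "coisotropic_submanifold UNIV omega_std (Y_alpha \<alpha>)"
proof -
  have "u \<in> tangent_space (Y_alpha \<alpha>) p" 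
    if p: "p \<in> Y_alpha \<alpha>" and u: "\<forall>v\<in>tangent_space (Y_alpha \<alpha>) p. omega_std p u v = 0" for p u
  proof -
    have "om u (rot (\<lambda>_. 1) p) = 0" "om u (rot (wt \<alpha>) p) = 0"
      using u rot_in_TY[where p = p and \<alpha> = \<alpha>] unfolding tangent_space_Y_alpha[OF assms p] omega_std_eq_om by auto
    then show ?thesis unfolding tangent_space_Y_alpha[OF assms p] TY_def
      by (simp add: om_skew[of _ u])
  qed
  then show ?thesis unfolding coisotropic_submanifold_def
    using submanifold_Y_alpha[OF assms] by blast
qed


section \<open>A leafwise cohomology class with nonzero bracket\<close>

lemma smooth_map_onE:
  assumes "smooth_map_on S f" "x \<in> S"
  obtains U g where "open U" "x \<in> U" "smooth_on U g" "\<And>y. y \<in> U \<Longrightarrow> y \<in> S \<Longrightarrow> g y = f y"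
proof -
  have "\<exists>U g. open U \<and> x \<in> U \<and> smooth_on U g \<and> (\<forall>y\<in>U \<inter> S. g y = f y)"
    using assms unfolding smooth_map_on_def by (rule bspec)
  then obtain U g where "open U" "x \<in> U" "smooth_on U g" "\<forall>y\<in>U \<inter> S. g y = f y" by (elim exE conjE)
  then show thesis by (intro that[of U g]) simp_all
qed

lemma smooth_map_on_compose:
  fixes h :: "'a::euclidean_space \<Rightarrow> 'b::euclidean_space"
  assumes "smooth_map_on S f" "open V" "smooth_on V h" "h ` V \<subseteq> S"
  shows "smooth_on V (\<lambda>x. f (h x))"
proof (rule smooth_on_local)
  fix x assume x: "x \<in> V"
  then have "h x \<in> S" using assms(4) by auto
  from smooth_map_onE[OF assms(1) this] obtain U g
    where U: "open U" "h x \<in> U" "smooth_on U g" "\<And>y. y \<in> U \<Longrightarrow> y \<in> S \<Longrightarrow> g y = f y" by blast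
  let ?W = "V \<inter> h -` U"
  have W: "open ?W" using assms(2) U(1) smooth_on_continuous[OF assms(3)] continuous_open_preimage by blast
  have "smooth_on ?W (\<lambda>x. g (h x))"
    by (rule smooth_on_compose[OF W smooth_on_subset[OF assms(3)] U(3)]) auto
  moreover have "\<forall>y\<in>?W. g (h y) = f (h y)" using U(4) assms(4) by auto
  moreover have "x \<in> ?W" using x U(2) by simp
  ultimately show "\<exists>V g. open V \<and> x \<in> V \<and> smooth_on V g \<and> (\<forall>y\<in>V. g y = f (h y))"
    using W by (intro exI[of _ ?W] exI[of _ "\<lambda>y. g (h y)"]) simp
qed

text \<open>For \<open>\<alpha> = m / n\<close> the monomial below is invariant under the flows of both Hamiltonians.\<close>

definition resonance :: "nat \<Rightarrow> nat \<Rightarrow> phase \<Rightarrow> real" where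
  "resonance m n z = Re (zc 1 z ^ m * cnj (zc 2 z) ^ n * zc 3 z ^ n * cnj (zc 3 z) ^ m)"

text \<open>The first summand is \<open>Q\<^sup>3 dP\<^sup>3 - P\<^sup>3 dQ\<^sup>3\<close> and \<open>om p\<close> is twice the radial primitive of the symplectic form. On the
  two null vector fields these forms have the values \<open>|z\<^sub>3|\<^sup>2, 0\<close> and \<open>1, 1/2\<close>, so that the class
  corresponds to the pair \<open>|z\<^sub>3|\<^sup>2 + K, K/2\<close> with \<open>K\<close> the resonant monomial.\<close>

definition obstructed_class :: "nat \<Rightarrow> nat \<Rightarrow> phase oneform" where
  "obstructed_class m n p v = Im (cnj (zc 3 p) * zc 3 v) + resonance m n p * om p v"

lemma resonance_torus:
  assumes "\<And>j. zc j z = cis (\<theta> j) * w j"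
  shows "resonance m n z = Re (cis (m * \<theta> 1 - n * \<theta> 2 + (real n - real m) * \<theta> 3) * (w 1 ^ m * cnj (w 2) ^ n * w 3 ^ n * cnj (w 3) ^ m))"
proof -
  have p: "cis x ^ k = cis (real k * x)" for x k by (rule Complex.DeMoivre)
  have "m * \<theta> 1 - n * \<theta> 2 + (real n - real m) * \<theta> 3 = real m * \<theta> 1 + real n * - \<theta> 2 + real n * \<theta> 3 + real m * - \<theta> 3"
    by (simp add: algebra_simps)
  then have "cis (m * \<theta> 1 - n * \<theta> 2 + (real n - real m) * \<theta> 3) = cis (\<theta> 1) ^ m * cnj (cis (\<theta> 2)) ^ n * cis (\<theta> 3) ^ n * cnj (cis (\<theta> 3)) ^ m"
    unfolding cis_cnj p cis_mult by (rule arg_cong)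
  then show ?thesis unfolding resonance_def assms
    by (intro arg_cong[of _ _ Re]) (simp add: power_mult_distrib mult_ac)
qed

lemma smooth_on_resonance: "smooth_on UNIV (resonance m n)"
  unfolding resonance_def
  by (intro smooth_on_linear_compose[OF bounded_linear_Re] smooth_on_mult smooth_on_power open_UNIV
      smooth_on_linear_compose[OF bounded_linear_cnj] smooth_on_bounded_linear bounded_linear_zc)

text \<open>The hypothesis says that the flow with weights \<open>\<beta>\<close> does not change the phase of the monomial.\<close>

lemma resonance_rot_invariant:
  assumes "m * \<beta> 1 - n * \<beta> 2 + (real n - real m) * \<beta> 3 = 0"
  shows "pd (rot \<beta> p) (resonance m n) p = 0"
proof -
  define c where "c t = of_zc (\<lambda>j. cis (\<beta> j * t) * zc j p)" for t
  have c0: "c 0 = p" by (rule phase_eqI) (simp add: c_def)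
  have "(c has_vector_derivative rot \<beta> p) (at 0)"
    unfolding has_vector_derivative_def
  proof (rule has_derivative_zcI)
    fix j
    have "((\<lambda>t. cis (\<beta> j * t) * zc j p) has_derivative (\<lambda>h. h *\<^sub>R (\<i> * of_real (\<beta> j) * zc j p))) (at 0)"
      by (auto intro!: derivative_eq_intros simp: scaleR_conv_of_real algebra_simps)
    then show "((\<lambda>t. zc j (c t)) has_derivative (\<lambda>h. zc j (h *\<^sub>R rot \<beta> p))) (at 0)"
      by (simp add: c_def)
  qed
  then have "((\<lambda>t. resonance m n (c t)) has_vector_derivative pd (rot \<beta> p) (resonance m n) (c 0)) (at 0)"
    by (intro has_vector_derivative_smooth_compose smooth_on_differentiable[OF smooth_on_resonance] UNIV_I)
  moreover have "resonance m n (c t) = resonance m n p" for t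
  proof -
    have "m * (\<beta> 1 * t) - n * (\<beta> 2 * t) + (real n - real m) * (\<beta> 3 * t) = t * (m * \<beta> 1 - n * \<beta> 2 + (real n - real m) * \<beta> 3)"
      by (simp add: algebra_simps)
    then show ?thesis
      using resonance_torus[of "c t" "\<lambda>j. \<beta> j * t" "\<lambda>j. zc j p" m n] assms
      by (simp add: c_def resonance_def)
  qed
  ultimately have "((\<lambda>t::real. resonance m n p) has_vector_derivative pd (rot \<beta> p) (resonance m n) p) (at 0)"
    using c0 by simp
  then show ?thesis using vector_derivative_unique_at has_vector_derivative_const by blast
qed

lemma obstructed_class_linear:
  "obstructed_class m n p (a *\<^sub>R u + b *\<^sub>R v) = a * obstructed_class m n p u + b * obstructed_class m n p v"
  "obstructed_class m n p (u - v) = obstructed_class m n p u - obstructed_class m n p v"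
  by (simp_all add: obstructed_class_def algebra_simps)

lemma obstructed_class_apply:
  assumes U: "open U" and g: "smooth_on U g"
  shows "smooth_on U (\<lambda>x. obstructed_class m n x (g x))"
    and "p \<in> U \<Longrightarrow> pd u (\<lambda>x. obstructed_class m n x (g x)) p = obstructed_class m n p (pd u g p)
      + Im (cnj (zc 3 u) * zc 3 (g p)) + pd u (resonance m n) p * om p (g p) + resonance m n p * om u (g p)"
proof -
  show "smooth_on U (\<lambda>x. obstructed_class m n x (g x))"
    unfolding obstructed_class_def
    by (intro smooth_on_add U smooth_on_mult smooth_on_bilinear[OF bounded_bilinear_om] g
      smooth_on_subset[OF smooth_on_resonance subset_UNIV] smooth_on_bounded_linear[OF bounded_linear_ident]
      smooth_on_linear_compose[OF bounded_linear_Im] smooth_on_linear_compose[OF bounded_linear_cnj]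
      smooth_on_zc)
  assume p: "p \<in> U"
  have dg: "(g has_derivative (\<lambda>v. pd v g p)) (at p)"
    using smooth_on_differentiable[OF g p] by (simp add: frechet_derivative_works)
  have dK: "(resonance m n has_derivative (\<lambda>v. pd v (resonance m n) p)) (at p)"
    using smooth_on_differentiable[OF smooth_on_resonance UNIV_I] by (simp add: frechet_derivative_works)
  have do: "((\<lambda>x. om x (g x)) has_derivative (\<lambda>v. om p (pd v g p) + om v (g p))) (at p)"
    by (rule bounded_bilinear.FDERIV[OF bounded_bilinear_om]) (auto intro: dg)
  have dz: "((\<lambda>x. zc 3 (g x)) has_derivative (\<lambda>v. zc 3 (pd v g p))) (at p)" "(zc 3 has_derivative zc 3) (at p)"
    by (auto intro: bounded_linear.has_derivative[OF bounded_linear_zc dg] bounded_linear_imp_has_derivative bounded_linear_zc)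
  have "((\<lambda>x. obstructed_class m n x (g x)) has_derivative (\<lambda>v. obstructed_class m n p (pd v g p)
      + Im (cnj (zc 3 v) * zc 3 (g p)) + pd v (resonance m n) p * om p (g p) + resonance m n p * om v (g p))) (at p)"
    unfolding obstructed_class_def
    by (rule has_derivative_eq_rhs, (rule has_derivative_add has_derivative_mult has_derivative_Im has_derivative_cnj dK do dz)+)
      (simp add: algebra_simps)
  then show "pd u (\<lambda>x. obstructed_class m n x (g x)) p = obstructed_class m n p (pd u g p)
      + Im (cnj (zc 3 u) * zc 3 (g p)) + pd u (resonance m n) p * om p (g p) + resonance m n p * om u (g p)"
    by (rule pd_eq)
qed

lemma resonance_derivative_null:
  assumes "\<alpha> > 1" "n * \<alpha> = real m" "p \<in> Y_alpha \<alpha>" "u \<in> null_space (Y_alpha \<alpha>) omega_std p"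
  shows "pd u (resonance m n) p = 0"
proof -
  obtain a b where u: "u = a *\<^sub>R rot (\<lambda>_. 1) p + b *\<^sub>R rot (wt \<alpha>) p"
    using null_spaceE[OF assms(1,3,4)] .
  have "resonance m n differentiable (at p)" using smooth_on_differentiable[OF smooth_on_resonance UNIV_I] .
  then show ?thesis
    using resonance_rot_invariant[of m "\<lambda>_. 1" n p] resonance_rot_invariant[of m "wt \<alpha>" n p] assms(2)
    unfolding u by (simp add: pd_vector_add)
qed

text \<open>The class is closed because on null vectors \<open>dQ\<^sup>3 \<and> dP\<^sup>3\<close>, \<open>\<omega>\<close> and the differential of
  the resonant monomial all vanish.\<close>

lemma obstructed_class_closed:
  assumes a: "\<alpha> > 1" "n * \<alpha> = real m"
  shows "leafwise_closed (Y_alpha \<alpha>) omega_std (obstructed_class m n)"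
proof -
  let ?Y = "Y_alpha \<alpha>" and ?\<Gamma> = "obstructed_class m n"
  have "smooth_map_on ?Y (\<lambda>p. ?\<Gamma> p (X p))" if "null_section ?Y omega_std X" for X
    unfolding smooth_map_on_def
  proof
    fix p assume "p \<in> ?Y"
    then obtain U g where "open U" "p \<in> U" "smooth_on U g" "\<And>y. y \<in> U \<Longrightarrow> y \<in> ?Y \<Longrightarrow> g y = X y"
      using smooth_map_onE \<open>null_section ?Y omega_std X\<close> unfolding null_section_def by metis
    then show "\<exists>U g. open U \<and> p \<in> U \<and> smooth_on U g \<and> (\<forall>y\<in>U \<inter> ?Y. g y = ?\<Gamma> y (X y))"
      using obstructed_class_apply(1) by (intro exI[of _ U] exI[of _ "\<lambda>y. ?\<Gamma> y (g y)"]) auto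
  qed
  moreover have "leafwise_d1 ?Y ?\<Gamma> X Z p = 0"
    if X: "null_section ?Y omega_std X" and Z: "null_section ?Y omega_std Z" and p: "p \<in> ?Y" for X Z p
  proof -
    obtain U g where U: "open U" "p \<in> U" "smooth_on U g" "\<And>y. y \<in> U \<Longrightarrow> y \<in> ?Y \<Longrightarrow> g y = X y"
      using smooth_map_onE X p unfolding null_section_def by metis
    obtain V h where V: "open V" "p \<in> V" "smooth_on V h" "\<And>y. y \<in> V \<Longrightarrow> y \<in> ?Y \<Longrightarrow> h y = Z y"
      using smooth_map_onE Z p unfolding null_section_def by metis
    have n: "X p \<in> null_space ?Y omega_std p" "Z p \<in> null_space ?Y omega_std p"
      using X Z p unfolding null_section_def by auto
    then have t: "X p \<in> tangent_space ?Y p" "Z p \<in> tangent_space ?Y p"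
      and om0: "om (X p) (Z p) = 0" "om (Z p) (X p) = 0" unfolding null_space_def omega_std_eq_om by auto
    have gh: "g p = X p" "h p = Z p" using U V p by auto
    have "lie_bracket ?Y X Z p = pd (X p) h p - pd (Z p) g p"
      unfolding lie_bracket_def using dir_deriv_eq[OF t(1) p V(1,2,4) smooth_on_differentiable[OF V(3,2)]]
        dir_deriv_eq[OF t(2) p U(1,2,4) smooth_on_differentiable[OF U(3,2)]] by simp
    moreover have "dir_deriv ?Y (\<lambda>x. ?\<Gamma> x (Z x)) p (X p) = pd (X p) (\<lambda>x. ?\<Gamma> x (h x)) p"
      by (rule dir_deriv_eq[OF t(1) p V(1,2) _ smooth_on_differentiable[OF obstructed_class_apply(1)[OF V(1,3)] V(2)]])
        (simp add: V(4))
    moreover have "dir_deriv ?Y (\<lambda>x. ?\<Gamma> x (X x)) p (Z p) = pd (Z p) (\<lambda>x. ?\<Gamma> x (g x)) p"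
      by (rule dir_deriv_eq[OF t(2) p U(1,2) _ smooth_on_differentiable[OF obstructed_class_apply(1)[OF U(1,3)] U(2)]])
        (simp add: U(4))
    moreover have "Im (cnj (zc 3 u) * zc 3 v) = 0" if un: "u \<in> null_space ?Y omega_std p" and vn: "v \<in> null_space ?Y omega_std p" for u v
    proof -
      obtain a b where u: "u = a *\<^sub>R rot (\<lambda>_. 1) p + b *\<^sub>R rot (wt \<alpha>) p"
        using null_spaceE[OF assms(1) p un] .
      obtain a' b' where v: "v = a' *\<^sub>R rot (\<lambda>_. 1) p + b' *\<^sub>R rot (wt \<alpha>) p"
        using null_spaceE[OF assms(1) p vn] .
      show ?thesis unfolding u v by simp
    qed
    ultimately show ?thesis
      unfolding leafwise_d1_def obstructed_class_apply(2)[OF U(1,3,2)] obstructed_class_apply(2)[OF V(1,3,2)] gh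
      using resonance_derivative_null[OF a p n(1)] resonance_derivative_null[OF a p n(2)] om0 n
      by (simp add: obstructed_class_linear)
  qed
  ultimately show ?thesis
    unfolding leafwise_closed_def leafwise_oneform_def by (simp add: obstructed_class_linear)
qed

lemma obstructed_class_rot:
  assumes "p \<in> Y_alpha \<alpha>"
  shows "obstructed_class m n p (rot (\<lambda>_. 1) p) = (cmod (zc 3 p))\<^sup>2 + resonance m n p"
    "obstructed_class m n p (rot (wt \<alpha>) p) = resonance m n p / 2"
  using assms unfolding Y_alpha_iff obstructed_class_def cmod_power2 by (simp_all add: power2_eq_square)

section \<open>Coordinates adapted to the null foliation\<close>

text \<open>The first two parameters are flow times of the two null vector fields, so that they run along the
  leaves. The third one is an angle on the ellipse which the second equation of \<open>Y_alpha\<close> cuts out in the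
  plane of the first two moduli, and the fourth one shifts the phase of the first coordinate.\<close>

type_synonym par = "real \<times> real \<times> real \<times> real"

definition ang :: "real \<Rightarrow> par \<Rightarrow> 3 \<Rightarrow> real" where
  "ang \<alpha> s j = (case s of (s1, s2, \<phi>, y) \<Rightarrow> s1 + wt \<alpha> j * s2 + (if j = 1 then y else 0))"

definition rad :: "real \<Rightarrow> 3 \<Rightarrow> real \<Rightarrow> real" where
  "rad \<alpha> j \<phi> = (if j = 1 then cos \<phi> / sqrt 2 else if j = 2 then sin \<phi> / sqrt (2 * \<alpha>)
     else (1 - cos \<phi> * cos \<phi> / 2 - sin \<phi> * sin \<phi> / (2 * \<alpha>)) powr (1/2))"

definition Psi :: "real \<Rightarrow> par \<Rightarrow> phase" where
  "Psi \<alpha> s = of_zc (\<lambda>j. of_real (rad \<alpha> j (fst (snd (snd s)))) * cis (ang \<alpha> s j))"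

definition bas :: "nat \<Rightarrow> par" where
  "bas k = (if k = 1 then (1, 0, 0, 0) else if k = 2 then (0, 1, 0, 0) else if k = 3 then (0, 0, 1, 0)
     else if k = 4 then (0, 0, 0, 1) else 0)"

lemma bas_simps: "bas 1 = (1, 0, 0, 0)" "bas (Suc 0) = (1, 0, 0, 0)" "bas 2 = (0, 1, 0, 0)" "bas 3 = (0, 0, 1, 0)" "bas 4 = (0, 0, 0, 1)"
  by (simp_all add: bas_def)

context
  fixes \<alpha> :: real
  assumes alpha: "\<alpha> > 1"
begin

lemma rad3_positive: "1 - cos \<phi> * cos \<phi> / 2 - sin \<phi> * sin \<phi> / (2 * \<alpha>) > 0"
proof -
  have "sin \<phi> * sin \<phi> / (2 * \<alpha>) \<le> sin \<phi> * sin \<phi> / 2"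
    using alpha by (intro divide_left_mono) auto
  moreover have "cos \<phi> * cos \<phi> + sin \<phi> * sin \<phi> = 1"
    using sin_cos_squared_add[of \<phi>] by (simp add: power2_eq_square)
  ultimately show ?thesis by linarith
qed

lemma rad_squares:
  "rad \<alpha> 1 \<phi> * rad \<alpha> 1 \<phi> = cos \<phi> * cos \<phi> / 2" "rad \<alpha> 2 \<phi> * rad \<alpha> 2 \<phi> = sin \<phi> * sin \<phi> / (2 * \<alpha>)"
  "rad \<alpha> 3 \<phi> * rad \<alpha> 3 \<phi> = 1 - cos \<phi> * cos \<phi> / 2 - sin \<phi> * sin \<phi> / (2 * \<alpha>)"
proof -
  show "rad \<alpha> 1 \<phi> * rad \<alpha> 1 \<phi> = cos \<phi> * cos \<phi> / 2" by (simp add: rad_def)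
  show "rad \<alpha> 2 \<phi> * rad \<alpha> 2 \<phi> = sin \<phi> * sin \<phi> / (2 * \<alpha>)" 
    using alpha by (simp add: rad_def)
  show "rad \<alpha> 3 \<phi> * rad \<alpha> 3 \<phi> = 1 - cos \<phi> * cos \<phi> / 2 - sin \<phi> * sin \<phi> / (2 * \<alpha>)"
    using rad3_positive[of \<phi>] by (simp add: rad_def powr_add[symmetric])
qed

lemma rad_constraints:
  "rad \<alpha> 1 \<phi> * rad \<alpha> 1 \<phi> + rad \<alpha> 2 \<phi> * rad \<alpha> 2 \<phi> + rad \<alpha> 3 \<phi> * rad \<alpha> 3 \<phi> = 1"
  "rad \<alpha> 1 \<phi> * rad \<alpha> 1 \<phi> + \<alpha> * (rad \<alpha> 2 \<phi> * rad \<alpha> 2 \<phi>) = 1/2"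
  using alpha sin_cos_squared_add[of \<phi>] unfolding rad_squares by (simp_all add: power2_eq_square field_simps)

lemma Psi_in_Y: "Psi \<alpha> s \<in> Y_alpha \<alpha>"
  unfolding Y_alpha_iff om_rot_self sum_3 using rad_constraints[of "fst (snd (snd s))"]
  by (simp add: Psi_def norm_mult power2_eq_square)

lemma smooth_on_rad: "smooth_on UNIV (rad \<alpha> j)"
proof -
  have id: "smooth_on UNIV (\<lambda>x::real. x)" by (rule smooth_on_bounded_linear[OF bounded_linear_ident])
  have "smooth_on UNIV (\<lambda>\<phi>. cos \<phi> * (1 / sqrt 2))" "smooth_on UNIV (\<lambda>\<phi>. sin \<phi> * (1 / sqrt (2 * \<alpha>)))"
    "smooth_on UNIV (\<lambda>\<phi>. (1 - cos \<phi> * cos \<phi> * (1 / 2) - sin \<phi> * sin \<phi> * (1 / (2 * \<alpha>))) powr (1/2))"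
    using rad3_positive
    by (intro smooth_on_mult smooth_on_cos_sin smooth_on_const open_UNIV smooth_on_real_compose smooth_on_diff; simp)+
  then show ?thesis by (cases "j = 1"; cases "j = 2") (simp_all add: rad_def[abs_def])
qed

lemma smooth_on_cis: "open U \<Longrightarrow> smooth_on U f \<Longrightarrow> smooth_on U (\<lambda>x. cis (f x))"
proof -
  assume "open U" "smooth_on U f"
  then have "smooth_on U (\<lambda>x. of_real (cos (f x)) + \<i> * of_real (sin (f x)))"
    by (intro smooth_on_add smooth_on_mult smooth_on_const smooth_on_linear_compose[OF bounded_linear_of_real] smooth_on_real_compose)
  then show ?thesis by (simp add: cis_conv_exp exp_Euler cos_of_real sin_of_real)
qed

lemma ang_linear: "bounded_linear (\<lambda>s. ang \<alpha> s j)"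
  by (intro linear_conv_bounded_linear[THEN iffD1] linearI) (auto simp: ang_def algebra_simps)

lemma smooth_on_Psi: "smooth_on UNIV (Psi \<alpha>)"
  unfolding Psi_def[abs_def]
  by (intro smooth_on_of_zc smooth_on_mult open_UNIV smooth_on_linear_compose[OF bounded_linear_of_real]
      smooth_on_cis smooth_on_bounded_linear[OF ang_linear] smooth_on_compose[OF open_UNIV _ smooth_on_rad subset_UNIV]
      smooth_on_bounded_linear bounded_linear_intros)

lemma zc_pd_Psi:
  "zc j (pd d (Psi \<alpha>) s) = (of_real (fst (snd (snd d)) * pd 1 (rad \<alpha> j) (fst (snd (snd s)))) 
     + \<i> * of_real (rad \<alpha> j (fst (snd (snd s))) * ang \<alpha> d j)) * cis (ang \<alpha> s j)"
proof -
  let ?\<phi> = "\<lambda>s::par. fst (snd (snd s))"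
  have c: "(?\<phi> has_derivative ?\<phi>) (at s)"
    by (intro bounded_linear_imp_has_derivative bounded_linear_intros)
  have "(rad \<alpha> j has_derivative (\<lambda>h. h * pd 1 (rad \<alpha> j) (?\<phi> s))) (at (?\<phi> s))"
    using has_vector_derivative_along_line[of "rad \<alpha> j" 0 "?\<phi> s" 1] smooth_on_differentiable[OF smooth_on_rad]
    by (simp add: has_vector_derivative_def)
  from has_derivative_compose[OF c this]
  have r: "((\<lambda>s. rad \<alpha> j (?\<phi> s)) has_derivative (\<lambda>d. ?\<phi> d * pd 1 (rad \<alpha> j) (?\<phi> s))) (at s)" .
  have a: "((\<lambda>s. ang \<alpha> s j) has_derivative (\<lambda>d. ang \<alpha> d j)) (at s)"
    by (intro bounded_linear_imp_has_derivative ang_linear)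
  have "((\<lambda>x. cis x) has_derivative (\<lambda>h. h *\<^sub>R (\<i> * cis x))) (at x)" for x
    by (auto intro!: derivative_eq_intros simp: scaleR_conv_of_real algebra_simps)
  from has_derivative_compose[OF a this]
  have ca: "((\<lambda>s. cis (ang \<alpha> s j)) has_derivative (\<lambda>d. ang \<alpha> d j *\<^sub>R (\<i> * cis (ang \<alpha> s j)))) (at s)" .
  have "((\<lambda>s. zc j (Psi \<alpha> s)) has_derivative (\<lambda>d. (of_real (?\<phi> d * pd 1 (rad \<alpha> j) (?\<phi> s)) 
     + \<i> * of_real (rad \<alpha> j (?\<phi> s) * ang \<alpha> d j)) * cis (ang \<alpha> s j))) (at s)"
    unfolding Psi_def zc_of_zc
    by (rule has_derivative_eq_rhs, rule has_derivative_mult[OF has_derivative_of_real[OF r] ca])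
      (auto simp: scaleR_conv_of_real algebra_simps)
  then have "pd d (\<lambda>s. zc j (Psi \<alpha> s)) s = (of_real (?\<phi> d * pd 1 (rad \<alpha> j) (?\<phi> s)) 
     + \<i> * of_real (rad \<alpha> j (?\<phi> s) * ang \<alpha> d j)) * cis (ang \<alpha> s j)" by (rule pd_eq)
  then show ?thesis
    using pd_linear[OF bounded_linear_zc smooth_on_differentiable[OF smooth_on_Psi UNIV_I], where v = d and x = s] by simp
qed

lemma pd_Psi_rot: "pd (bas 1) (Psi \<alpha>) s = rot (\<lambda>_. 1) (Psi \<alpha> s)" "pd (bas 2) (Psi \<alpha>) s = rot (wt \<alpha>) (Psi \<alpha> s)"
  by (auto intro!: phase_eqI simp: zc_pd_Psi bas_simps ang_def Psi_def)

lemma rad_derivative_constraints: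
  "rad \<alpha> 1 \<phi> * pd 1 (rad \<alpha> 1) \<phi> + rad \<alpha> 2 \<phi> * pd 1 (rad \<alpha> 2) \<phi> + rad \<alpha> 3 \<phi> * pd 1 (rad \<alpha> 3) \<phi> = 0"
  "rad \<alpha> 1 \<phi> * pd 1 (rad \<alpha> 1) \<phi> + \<alpha> * (rad \<alpha> 2 \<phi> * pd 1 (rad \<alpha> 2) \<phi>) = 0"
proof -
  have d: "(rad \<alpha> j has_real_derivative pd 1 (rad \<alpha> j) \<phi>) (at \<phi>)" for j
    using has_vector_derivative_along_line[of "rad \<alpha> j" 0 \<phi> 1] smooth_on_differentiable[OF smooth_on_rad]
    by (simp add: has_real_derivative_iff_has_vector_derivative)
  have "((\<lambda>\<phi>. rad \<alpha> 1 \<phi> * rad \<alpha> 1 \<phi> + rad \<alpha> 2 \<phi> * rad \<alpha> 2 \<phi> + rad \<alpha> 3 \<phi> * rad \<alpha> 3 \<phi>) has_real_derivative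
      2 * (rad \<alpha> 1 \<phi> * pd 1 (rad \<alpha> 1) \<phi> + rad \<alpha> 2 \<phi> * pd 1 (rad \<alpha> 2) \<phi> + rad \<alpha> 3 \<phi> * pd 1 (rad \<alpha> 3) \<phi>)) (at \<phi>)"
    by (auto intro!: derivative_eq_intros d simp: algebra_simps)
  then show "rad \<alpha> 1 \<phi> * pd 1 (rad \<alpha> 1) \<phi> + rad \<alpha> 2 \<phi> * pd 1 (rad \<alpha> 2) \<phi> + rad \<alpha> 3 \<phi> * pd 1 (rad \<alpha> 3) \<phi> = 0"
    unfolding rad_constraints using DERIV_unique DERIV_const by fastforce
  have "((\<lambda>\<phi>. rad \<alpha> 1 \<phi> * rad \<alpha> 1 \<phi> + \<alpha> * (rad \<alpha> 2 \<phi> * rad \<alpha> 2 \<phi>)) has_real_derivative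
      2 * (rad \<alpha> 1 \<phi> * pd 1 (rad \<alpha> 1) \<phi> + \<alpha> * (rad \<alpha> 2 \<phi> * pd 1 (rad \<alpha> 2) \<phi>))) (at \<phi>)"
    by (auto intro!: derivative_eq_intros d simp: algebra_simps)
  then show "rad \<alpha> 1 \<phi> * pd 1 (rad \<alpha> 1) \<phi> + \<alpha> * (rad \<alpha> 2 \<phi> * pd 1 (rad \<alpha> 2) \<phi>) = 0"
    unfolding rad_constraints using DERIV_unique DERIV_const by fastforce
qed

end


section \<open>Regular points and the Jacobian of the class\<close>

text \<open>The values of the class on the two null vector fields, for \<open>j = 1, 2\<close>, as functions of the parameters.\<close>

definition leaf_value :: "real \<Rightarrow> nat \<Rightarrow> nat \<Rightarrow> nat \<Rightarrow> par \<Rightarrow> real" where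
  "leaf_value \<alpha> m n j s = obstructed_class m n (Psi \<alpha> s) (pd (bas j) (Psi \<alpha>) s)"

context
  fixes \<alpha> :: real
  assumes alpha: "\<alpha> > 1"
begin

lemma pd_Psi_in_TY: "pd d (Psi \<alpha>) s \<in> TY \<alpha> (Psi \<alpha> s)"
proof -
  have "((\<lambda>t. Psi \<alpha> (s + t *\<^sub>R d)) has_vector_derivative pd d (Psi \<alpha>) s) (at 0)"
    using has_vector_derivative_along_line[of "Psi \<alpha>" s 0 d]
      smooth_on_differentiable[OF smooth_on_Psi[OF alpha] UNIV_I] by simp
  then show ?thesis
    by (rule velocity_in_TY[where d = 1]) (auto simp: Psi_in_Y[OF alpha])
qed

lemma om_pd_Psi_34: "om (pd (bas 3) (Psi \<alpha>) s) (pd (bas 4) (Psi \<alpha>) s) =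
    pd 1 (rad \<alpha> 1) (fst (snd (snd s))) * rad \<alpha> 1 (fst (snd (snd s)))"
proof -
  have a: "ang \<alpha> (bas 3) j = 0" "ang \<alpha> (bas 4) j = (if j = 1 then 1 else 0)" for j
    by (simp_all add: ang_def bas_simps)
  have b: "fst (snd (snd (bas 3))) = 1" "fst (snd (snd (bas 4))) = 0" by (simp_all add: bas_simps)
  have "Im (cnj (of_real x * cis \<theta>) * (\<i> * of_real y * cis \<theta>)) = x * y * ((cos \<theta>)\<^sup>2 + (sin \<theta>)\<^sup>2)" for x y \<theta>
    by (simp add: power2_eq_square algebra_simps
        del: sin_cos_squared_add sin_cos_squared_add2 sin_cos_squared_add3)
  then have im: "Im (cnj (of_real x * cis \<theta>) * (\<i> * of_real y * cis \<theta>)) = x * y" for x y \<theta>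
    by (simp only: sin_cos_squared_add2 mult_1_right)
  let ?\<phi> = "fst (snd (snd s))"
  have z: "zc 1 (pd (bas 3) (Psi \<alpha>) s) = of_real (pd 1 (rad \<alpha> 1) ?\<phi>) * cis (ang \<alpha> s 1)"
    "zc 1 (pd (bas 4) (Psi \<alpha>) s) = \<i> * of_real (rad \<alpha> 1 ?\<phi>) * cis (ang \<alpha> s 1)"
    "zc 2 (pd (bas 4) (Psi \<alpha>) s) = 0" "zc 3 (pd (bas 4) (Psi \<alpha>) s) = 0"
    unfolding zc_pd_Psi[OF alpha] a b by simp_all
  show ?thesis unfolding om_sum z im by simp
qed

lemma rad_at_quarter: "rad \<alpha> j (pi / 4) > 0" "pd 1 (rad \<alpha> 1) (pi / 4) < 0"
proof -
  show "rad \<alpha> j (pi / 4) > 0"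
    using rad3_positive[OF alpha, of "pi / 4"] alpha by (auto simp: rad_def cos_45 sin_45)
  have "((\<lambda>x. cos x / sqrt 2) has_derivative (\<lambda>h. - sin x / sqrt 2 * h)) (at x)" for x :: real
    using DERIV_cdivide[OF DERIV_cos] by (rule has_field_derivative_imp_has_derivative)
  then have "pd 1 (\<lambda>x. cos x / sqrt 2) (pi / 4) = - sin (pi / 4) / sqrt 2 * 1" by (rule pd_eq)
  then show "pd 1 (rad \<alpha> 1) (pi / 4) < 0" by (simp add: rad_def[abs_def] sin_45)
qed

text \<open>\<open>Psi\<close> is a local diffeomorphism onto \<open>Y_alpha\<close> wherever no coordinate \<open>z\<^sub>j\<close> vanishes. The angle \<open>\<pi>/4\<close> on the
  ellipse is such a place: there all moduli are positive, and the first one has a nonzero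
  derivative. Phases and moduli of the components of a vector can then be read off separately.\<close>

lemma pd_Psi_inj:
  assumes "fst (snd (snd s)) = pi / 4" "pd d (Psi \<alpha>) s = 0"
  shows "d = 0"
proof -
  let ?r = "\<lambda>j. rad \<alpha> j (pi / 4)" and ?r' = "\<lambda>j. pd 1 (rad \<alpha> j) (pi / 4)"
  have "(of_real (fst (snd (snd d)) * ?r' j) + \<i> * of_real (?r j * ang \<alpha> d j)) * cis (ang \<alpha> s j) = 0" for j
    using arg_cong[OF assms(2), of "zc j"] unfolding zc_pd_Psi[OF alpha] assms(1) by simp
  then have "of_real (fst (snd (snd d)) * ?r' j) + \<i> * of_real (?r j * ang \<alpha> d j) = 0" for j
    using cis_neq_zero by (metis mult_eq_0_iff)
  then have z: "fst (snd (snd d)) * ?r' j = 0" "?r j * ang \<alpha> d j = 0" for j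
    by (auto simp: complex_eq_iff)
  have "ang \<alpha> d j = 0" for j using z(2)[of j] rad_at_quarter(1)[of j] by auto
  then have "ang \<alpha> d 1 = 0" "ang \<alpha> d 2 = 0" "ang \<alpha> d 3 = 0" by blast+
  moreover have "fst (snd (snd d)) = 0" using z(1)[of 1] rad_at_quarter(2) by auto
  ultimately show ?thesis using alpha by (cases d) (auto simp: ang_def zero_prod_def)
qed

lemma pd_Psi_surj:
  assumes "fst (snd (snd s)) = pi / 4" "v \<in> TY \<alpha> (Psi \<alpha> s)"
  shows "\<exists>d. v = pd d (Psi \<alpha>) s"
proof -
  define r where "r j = rad \<alpha> j (pi / 4)" for j
  define r' where "r' j = pd 1 (rad \<alpha> j) (pi / 4)" for j
  define w where "w j = zc j v / (of_real (r j) * cis (ang \<alpha> s j))" for j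
  have r: "r j > 0" "r' 1 \<noteq> 0" for j
    using rad_at_quarter(1)[of j] rad_at_quarter(2) unfolding r_def r'_def by auto
  have cs: "r 1 * r' 1 + r 2 * r' 2 + r 3 * r' 3 = 0" "r 1 * r' 1 + \<alpha> * (r 2 * r' 2) = 0"
    using rad_derivative_constraints[OF alpha, of "pi / 4"] unfolding r_def r'_def by auto
  have v: "zc j v = of_real (r j) * cis (ang \<alpha> s j) * w j" for j
    using r(1)[of j] by (simp add: w_def)
  have "cis x * cnj (cis x) = 1" for x by (simp add: cis_cnj cis_mult)
  then have c: "cnj (cis x) * (cis x * y) = y" for x y by (simp add: mult.assoc[symmetric] mult.commute[of "cnj _"])
  have "cnj (zc j (Psi \<alpha> s)) * zc j v = of_real (r j * r j) * w j" for j
    unfolding v Psi_def zc_of_zc assms(1) r_def[symmetric]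
    by (simp add: mult.assoc mult.left_commute[of "cnj (cis _)" "of_real _"] c)
  then have R: "Re (cnj (zc j (Psi \<alpha> s)) * zc j v) = r j * (r j * Re (w j))" for j by simp
  have lin: "r 1 * (r 1 * Re (w 1)) + r 2 * (r 2 * Re (w 2)) + r 3 * (r 3 * Re (w 3)) = 0"
    "r 1 * (r 1 * Re (w 1)) + \<alpha> * (r 2 * (r 2 * Re (w 2))) = 0"
    using assms(2) unfolding TY_def om_rot sum_3 mem_Collect_eq R by simp_all
  \<comment> \<open>The first modulus determines the velocity on the ellipse; the two linearised equations then force
    the same velocity for the other two moduli.\<close>
  define \<kappa> where "\<kappa> = r 1 * Re (w 1) / r' 1"
  have k1: "\<kappa> * r' 1 = r 1 * Re (w 1)" using r by (simp add: \<kappa>_def)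
  have "\<alpha> * (r 2 * (\<kappa> * r' 2)) = \<kappa> * (\<alpha> * (r 2 * r' 2))" by (simp add: algebra_simps)
  also have "\<dots> = - (r 1 * (\<kappa> * r' 1))" using cs(2) by algebra
  also have "\<dots> = \<alpha> * (r 2 * (r 2 * Re (w 2)))" unfolding k1 using lin(2) by simp
  finally have k2: "\<kappa> * r' 2 = r 2 * Re (w 2)" using r(1)[of 2] alpha by simp
  have "r 3 * (\<kappa> * r' 3) = \<kappa> * (r 3 * r' 3)" by (simp add: algebra_simps)
  also have "\<dots> = - (r 1 * (\<kappa> * r' 1)) - r 2 * (\<kappa> * r' 2)" using cs(1) by algebra
  also have "\<dots> = r 3 * (r 3 * Re (w 3))" unfolding k1 k2 using lin(1) by simp
  finally have k3: "\<kappa> * r' 3 = r 3 * Re (w 3)" using r(1)[of 3] by simp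
  define d1 d2 d4 where "d1 = Im (w 3)" and "d2 = (Im (w 2) - d1) / \<alpha>" and "d4 = Im (w 1) - d1 - d2"
  have a: "ang \<alpha> (d1, d2, \<kappa>, d4) j = Im (w j)" for j
    using alpha exhaust_3[of j] by (auto simp: ang_def d1_def d2_def d4_def)
  have k: "\<kappa> * r' j = r j * Re (w j)" for j using exhaust_3[of j] k1 k2 k3 by auto
  have "v = pd (d1, d2, \<kappa>, d4) (Psi \<alpha>) s"
  proof (rule phase_eqI)
    fix j
    have "zc j (pd (d1, d2, \<kappa>, d4) (Psi \<alpha>) s) = (of_real (\<kappa> * r' j) + \<i> * of_real (r j * Im (w j))) * cis (ang \<alpha> s j)"
      unfolding zc_pd_Psi[OF alpha] assms(1) a by (simp add: r_def r'_def)
    also have "of_real (\<kappa> * r' j) + \<i> * of_real (r j * Im (w j)) = of_real (r j) * w j"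
      unfolding k by (simp add: complex_eq_iff)
    finally show "zc j v = zc j (pd (d1, d2, \<kappa>, d4) (Psi \<alpha>) s)" unfolding v by (simp add: mult_ac)
  qed
  then show ?thesis by blast
qed

lemma resonance_Psi:
  assumes "n * \<alpha> = real m"
  shows "resonance m n (Psi \<alpha> (s1, s2, \<phi>, y)) = rad \<alpha> 1 \<phi> ^ m * rad \<alpha> 2 \<phi> ^ n * rad \<alpha> 3 \<phi> ^ (n + m) * cos (m * y)"
proof -
  let ?s = "(s1, s2, \<phi>, y)"
  have "m * (s1 + s2 + y) - n * (s1 + \<alpha> * s2) + (real n - real m) * s1 = m * y + s2 * (m - n * \<alpha>)"
    by (simp add: algebra_simps)
  then have "m * ang \<alpha> ?s 1 - n * ang \<alpha> ?s 2 + (real n - real m) * ang \<alpha> ?s 3 = m * y"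
    using assms by (simp add: ang_def)
  moreover have "zc j (Psi \<alpha> ?s) = cis (ang \<alpha> ?s j) * of_real (rad \<alpha> j \<phi>)" for j
    by (simp add: Psi_def)
  ultimately have "resonance m n (Psi \<alpha> ?s) = Re (cis (m * y) * of_real (rad \<alpha> 1 \<phi> ^ m * rad \<alpha> 2 \<phi> ^ n * rad \<alpha> 3 \<phi> ^ (n + m)))"
    using resonance_torus[of "Psi \<alpha> ?s" "ang \<alpha> ?s" "\<lambda>j. of_real (rad \<alpha> j \<phi>)" m n] by (simp add: power_add mult.assoc)
  then show ?thesis by (simp add: mult.commute)
qed

lemma leaf_value_Psi:
  assumes "n * \<alpha> = real m"
  shows "leaf_value \<alpha> m n 1 (s1, s2, \<phi>, y) = 1 - cos \<phi> * cos \<phi> / 2 - sin \<phi> * sin \<phi> / (2 * \<alpha>)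
      + rad \<alpha> 1 \<phi> ^ m * rad \<alpha> 2 \<phi> ^ n * rad \<alpha> 3 \<phi> ^ (n + m) * cos (m * y)"
    "leaf_value \<alpha> m n 2 (s1, s2, \<phi>, y) = rad \<alpha> 1 \<phi> ^ m * rad \<alpha> 2 \<phi> ^ n * rad \<alpha> 3 \<phi> ^ (n + m) * cos (m * y) / 2"
proof -
  have "(cmod (zc 3 (Psi \<alpha> (s1, s2, \<phi>, y))))\<^sup>2 = 1 - cos \<phi> * cos \<phi> / 2 - sin \<phi> * sin \<phi> / (2 * \<alpha>)"
    unfolding rad_squares(3)[OF alpha, symmetric] by (simp add: Psi_def norm_mult power2_eq_square)
  then show "leaf_value \<alpha> m n 1 (s1, s2, \<phi>, y) = 1 - cos \<phi> * cos \<phi> / 2 - sin \<phi> * sin \<phi> / (2 * \<alpha>)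
      + rad \<alpha> 1 \<phi> ^ m * rad \<alpha> 2 \<phi> ^ n * rad \<alpha> 3 \<phi> ^ (n + m) * cos (m * y)"
    "leaf_value \<alpha> m n 2 (s1, s2, \<phi>, y) = rad \<alpha> 1 \<phi> ^ m * rad \<alpha> 2 \<phi> ^ n * rad \<alpha> 3 \<phi> ^ (n + m) * cos (m * y) / 2"
    unfolding leaf_value_def pd_Psi_rot[OF alpha] obstructed_class_rot[OF Psi_in_Y[OF alpha]] resonance_Psi[OF assms] by simp_all
qed

text \<open>At the phase \<open>y = \<pi>/(2m)\<close> the cosine in the resonant monomial vanishes and the sine is 1, hence the
  derivative of \<open>f 2\<close> in the third direction is zero and only the product
  \<open>\<partial>\<^sub>3 |z\<^sub>3|\<^sup>2 \<partial>\<^sub>4 f 2\<close> is left, whose first factor is nonzero because of \<open>\<alpha> \<noteq> 1\<close>.\<close>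

lemma leaf_value_jacobian:
  assumes nm: "n * \<alpha> = real m" "n > 0" and x0: "x0 = (0, 0, pi / 4, pi / (2 * m))"
  defines "f \<equiv> leaf_value \<alpha> m n"
  shows "pd (bas 3) (f 1) x0 * pd (bas 4) (f 2) x0 \<noteq> pd (bas 4) (f 1) x0 * pd (bas 3) (f 2) x0"
proof -
  define C where "C \<phi> = rad \<alpha> 1 \<phi> ^ m * rad \<alpha> 2 \<phi> ^ n * rad \<alpha> 3 \<phi> ^ (n + m)" for \<phi>
  define c where "c x = (case x of (s1, s2, \<phi>, y) \<Rightarrow> C \<phi> * cos (m * y))" for x :: par
  define q where "q x = (case x of (s1, s2, \<phi>, y) \<Rightarrow> 1 - cos \<phi> * cos \<phi> / 2 - sin \<phi> * sin \<phi> / (2 * \<alpha>))" for x :: par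
  have m: "m > 0" using nm alpha by (cases "m = 0") auto
  have f: "f 1 = (\<lambda>x. q x + c x)" "f 2 = (\<lambda>x. c x * (1 / 2))"
    by (auto simp: f_def leaf_value_Psi[OF nm(1)] c_def q_def C_def fun_eq_iff simp del: One_nat_def)
  let ?\<phi> = "\<lambda>x::par. fst (snd (snd x))" and ?y = "\<lambda>x::par. snd (snd (snd x))"
  have bl: "(?\<phi> has_derivative ?\<phi>) (at x)" "(?y has_derivative ?y) (at x)" for x
    by (intro bounded_linear_imp_has_derivative bounded_linear_intros)+
  have sC: "smooth_on UNIV C" unfolding C_def by (intro smooth_on_mult smooth_on_power smooth_on_rad alpha open_UNIV)
  have "(C has_derivative (\<lambda>h. h * pd 1 C \<phi>)) (at \<phi>)" for \<phi>
    using has_vector_derivative_along_line[of C 0 \<phi> 1] smooth_on_differentiable[OF sC]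
    by (simp add: has_vector_derivative_def)
  from has_derivative_compose[OF bl(1) this]
  have dC: "((\<lambda>x. C (?\<phi> x)) has_derivative (\<lambda>d. ?\<phi> d * pd 1 C (?\<phi> x))) (at x)" for x .
  have ce: "c = (\<lambda>x. C (?\<phi> x) * cos (m * ?y x))" "q = (\<lambda>x. 1 - cos (?\<phi> x) * cos (?\<phi> x) / 2 - sin (?\<phi> x) * sin (?\<phi> x) / (2 * \<alpha>))"
    by (auto simp: c_def q_def split_beta fun_eq_iff)
  have dc: "(c has_derivative (\<lambda>d. C (?\<phi> x) * (- sin (m * ?y x) * (m * ?y d)) + ?\<phi> d * pd 1 C (?\<phi> x) * cos (m * ?y x))) (at x)" for x
    unfolding ce by (rule has_derivative_mult[OF dC]) (auto intro!: derivative_eq_intros bl)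
  have dq: "(q has_derivative (\<lambda>d. ?\<phi> d * (sin (?\<phi> x) * cos (?\<phi> x) * (1 - 1 / \<alpha>)))) (at x)" for x
    unfolding ce using alpha by (auto intro!: derivative_eq_intros bl simp: field_simps)
  have d1: "pd v (f 1) x = ?\<phi> v * (sin (?\<phi> x) * cos (?\<phi> x) * (1 - 1 / \<alpha>)) 
      + (C (?\<phi> x) * (- sin (m * ?y x) * (m * ?y v)) + ?\<phi> v * pd 1 C (?\<phi> x) * cos (m * ?y x))" for v x
    unfolding f by (rule pd_eq, rule has_derivative_add[OF dq dc])
  have d2: "pd v (f 2) x = (C (?\<phi> x) * (- sin (m * ?y x) * (m * ?y v)) + ?\<phi> v * pd 1 C (?\<phi> x) * cos (m * ?y x)) * (1/2)" for v x
    unfolding f by (rule pd_eq, rule has_derivative_mult_left[OF dc])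
  have y0: "real m * (pi / (2 * real m)) = pi / 2" using m by simp
  have C0: "C (pi / 4) > 0" unfolding C_def using rad_at_quarter(1) by simp
  have "pd (bas 3) (f 2) x0 = 0" unfolding d2 x0 using m by (simp add: bas_simps y0)
  moreover have "pd (bas 4) (f 2) x0 \<noteq> 0" unfolding d2 x0 using C0 m by (simp add: bas_simps y0)
  moreover have "pd (bas 3) (f 1) x0 \<noteq> 0" unfolding d1 x0 using alpha m by (simp add: bas_simps y0 sin_45 cos_45)
  ultimately show ?thesis by simp
qed

lemma Psi_periodic:
  fixes n m :: nat
  assumes "n * \<alpha> = real m"
  shows "Psi \<alpha> (s + (2 * pi) *\<^sub>R bas 1) = Psi \<alpha> s" "Psi \<alpha> (s + (2 * pi * n) *\<^sub>R bas 2) = Psi \<alpha> s"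
proof -
  have "cis (ang \<alpha> (s + (2 * pi) *\<^sub>R bas 1) j) = cis (ang \<alpha> s j) * cis (2 * pi)" for j
    by (cases s) (simp add: ang_def bas_simps cis_mult algebra_simps)
  then show "Psi \<alpha> (s + (2 * pi) *\<^sub>R bas 1) = Psi \<alpha> s"
    by (auto intro!: phase_eqI simp: Psi_def bas_simps)
  have "cis (ang \<alpha> (s + (2 * pi * n) *\<^sub>R bas 2) j) = cis (ang \<alpha> s j) * cis (2 * pi * (n * wt \<alpha> j))" for j
    by (cases s) (simp add: ang_def bas_simps cis_mult algebra_simps)
  moreover have "n * wt \<alpha> j \<in> \<int>" for j using assms exhaust_3[of j] by auto
  ultimately show "Psi \<alpha> (s + (2 * pi * n) *\<^sub>R bas 2) = Psi \<alpha> s"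
    by (auto intro!: phase_eqI simp: Psi_def bas_simps)
qed

definition period :: "nat \<Rightarrow> nat \<Rightarrow> real" where
  "period n k = (if k = 1 then 2 * pi else 2 * pi * n)"

lemma Psi_period: "n * \<alpha> = real m \<Longrightarrow> k \<in> {1, 2} \<Longrightarrow> Psi \<alpha> (s + period n k *\<^sub>R bas k) = Psi \<alpha> s"
  using Psi_periodic[of n m s] by (auto simp: period_def)

text \<open>The common end of both obstruction proofs: applied to a path of primitives that moves in the
  direction of the obstructed class, \<open>commuting_of_pfaffian_zero\<close> contradicts the nonzero Jacobian. The
  sign in \<open>m\<close> is the one produced by the identification of normal vectors with covectors.\<close>

lemma no_pfaffian_zero_path:
  fixes L :: "nat \<Rightarrow> real \<times> par \<Rightarrow> real"
  assumes nm: "n * \<alpha> = real m" "n > 0" and e: "e > 0"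
    and sm: "\<And>j. smooth_on ({-e<..<e} \<times> UNIV) (L j)" "smooth_on UNIV g"
    and per: "\<And>j k t x. k \<in> {1, 2} \<Longrightarrow> \<bar>t\<bar> < e \<Longrightarrow> L j (t, x + period n k *\<^sub>R bas k) = L j (t, x)" 
      "\<And>k x. k \<in> {1, 2} \<Longrightarrow> g (x + period n k *\<^sub>R bas k) = g x"
    and F: "\<And>i j p. F i j p = pd (0, bas i) (L j) p - pd (0, bas j) (L i) p"
    and pf: "\<And>t s. fst (snd (snd s)) = pi / 4 \<Longrightarrow> \<bar>t\<bar> < e \<Longrightarrow>
       F 1 2 (t, s) * F 3 4 (t, s) - F 1 3 (t, s) * F 2 4 (t, s) + F 1 4 (t, s) * F 2 3 (t, s) = 0"
    and F0: "\<And>s i j. F i j (0, s) = om (pd (bas i) (Psi \<alpha>) s) (pd (bas j) (Psi \<alpha>) s)"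
    and m: "\<And>j s. j \<in> {1, 2} \<Longrightarrow> pd (1, 0) (L j) (0, s) = - 1 * leaf_value \<alpha> m n j s + pd (bas j) g s"
  shows False
proof -
  define x0 where "x0 = (0::real, 0::real, pi / 4, pi / (2 * real m))"
  define f where "f j = (\<lambda>s. - 1 * leaf_value \<alpha> m n j s)" for j
  have x0_leaf: "fst (snd (snd (x0 + (s *\<^sub>R bas 1 + r *\<^sub>R bas 2)))) = pi / 4" for s r
    by (simp add: x0_def bas_simps)
  have slv: "smooth_on UNIV (leaf_value \<alpha> m n j)" for j
  proof -
    have "smooth_on UNIV (\<lambda>s. Im (cnj (zc 3 (Psi \<alpha> s)) * zc 3 (pd (bas j) (Psi \<alpha>) s))
        + resonance m n (Psi \<alpha> s) * om (Psi \<alpha> s) (pd (bas j) (Psi \<alpha>) s))"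
      by (intro smooth_on_add open_UNIV smooth_on_mult smooth_on_bilinear[OF bounded_bilinear_om] smooth_on_pd
        smooth_on_Psi alpha smooth_on_compose[OF open_UNIV smooth_on_Psi[OF alpha] smooth_on_resonance subset_UNIV]
        smooth_on_linear_compose[OF bounded_linear_Im] smooth_on_linear_compose[OF bounded_linear_cnj] smooth_on_zc)
    then show ?thesis unfolding leaf_value_def[abs_def] obstructed_class_def .
  qed
  have "pd (bas 3) (f 1) x0 * pd (bas 4) (f 2) x0 = pd (bas 4) (f 1) x0 * pd (bas 3) (f 2) x0"
  proof (rule commuting_of_pfaffian_zero[where T = "period n" and a = bas and L = L and g = g and F = F and e = e])
    show "smooth_on UNIV (f j)" for j unfolding f_def by (intro smooth_on_mult slv open_UNIV smooth_on_const)
    show "period n 1 > 0" "period n 2 > 0" using nm by (simp_all add: period_def)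
    show "F 3 4 (0, x) = pd 1 (rad \<alpha> 1) (pi / 4) * rad \<alpha> 1 (pi / 4)" 
      if "x = x0 + (s *\<^sub>R bas 1 + r *\<^sub>R bas 2)" for s r x
      unfolding F0 om_pd_Psi_34 that x0_leaf ..
    show "pd 1 (rad \<alpha> 1) (pi / 4) * rad \<alpha> 1 (pi / 4) \<noteq> 0" using rad_at_quarter(1)[of 1] rad_at_quarter(2) by simp
    show "F i j (0, x) = 0" if "i \<in> {1, 2}" for i j x
      using that pd_Psi_in_TY[where d = "bas j" and s = x] unfolding F0 TY_def by (auto simp: pd_Psi_rot[OF alpha, simplified])
    show "f j (x + (s *\<^sub>R bas 1 + r *\<^sub>R bas 2)) = f j x" if "j \<in> {1, 2}" for j x s r
      using that unfolding f_def by (cases x) (auto simp: bas_simps leaf_value_Psi[OF nm(1)] simp del: One_nat_def)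
    show "pd (1, 0) (L j) (0, x) = f j x + pd (bas j) g x" if "j \<in> {1, 2}" for j x
      unfolding f_def by (rule m[OF that])
  qed (use e sm per F pf x0_leaf in auto)
  moreover have "pd v (f j) x0 = - 1 * pd v (leaf_value \<alpha> m n j) x0" for v j
    unfolding f_def by (intro pd_linear[OF bounded_linear_mult_right] smooth_on_differentiable[OF slv UNIV_I])
  ultimately show False using leaf_value_jacobian[OF nm x0_def] by simp
qed

end


section \<open>Coisotropic images and the Pfaffian\<close>

text \<open>If the Pfaffian of \<open>B\<close> on \<open>w 1, \<dots>, w 4\<close> were nonzero, these vectors would span a symplectic
  subspace containing \<open>T\<close>; a nonzero vector orthogonal to it exists in \<open>N\<close> for reasons of dimension,
  lies in \<open>T\<close> by coisotropy and is then zero.\<close>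

lemma pfaffian_zero_of_coisotropic:
  fixes B :: "'b::euclidean_space \<Rightarrow> 'b \<Rightarrow> real" and w :: "nat \<Rightarrow> 'b"
  assumes B: "bilinear B" and skew: "\<And>i j. B (w i) (w j) = - B (w j) (w i)"
    and T: "\<And>v. v \<in> T \<Longrightarrow> \<exists>a b c d. v = a *\<^sub>R w 1 + b *\<^sub>R w 2 + c *\<^sub>R w 3 + d *\<^sub>R w 4"
    and N: "subspace N" "dim N > 4" and co: "\<And>u. u \<in> N \<Longrightarrow> \<forall>v\<in>T. B u v = 0 \<Longrightarrow> u \<in> T"
  shows "B (w 1) (w 2) * B (w 3) (w 4) - B (w 1) (w 3) * B (w 2) (w 4) + B (w 1) (w 4) * B (w 2) (w 3) = 0"
    (is "?P = 0")
proof (rule ccontr)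
  assume P: "?P \<noteq> 0"
  note lin = bilinear_ladd[OF B] bilinear_radd[OF B] bilinear_lmul[OF B] bilinear_rmul[OF B]
  define h where "h u = (B u (w 1), B u (w 2), B u (w 3), B u (w 4))" for u
  have lh: "linear h" by (rule linearI) (simp_all add: h_def lin)
  have "\<not> inj_on h N"
  proof
    assume "inj_on h N"
    moreover have "span N = N" using N(1) by (simp add: span_eq_iff)
    ultimately have "dim (h ` N) = dim N" by (metis dim_image_eq[OF lh])
    moreover have "dim (h ` N) \<le> DIM(real \<times> real \<times> real \<times> real)" by (rule dim_subset_UNIV)
    ultimately show False using N(2) by simp
  qed
  then obtain u where u: "u \<in> N" "h u = 0" "u \<noteq> 0"
    using linear_inj_on_iff_eq_0[OF lh N(1)] by blast
  then have h0: "B u (w 1) = 0" "B u (w 2) = 0" "B u (w 3) = 0" "B u (w 4) = 0"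
    by (simp_all add: h_def zero_prod_def)
  have "\<forall>v\<in>T. B u v = 0" using T h0 by (fastforce simp: lin)
  then have "u \<in> T" using co u(1) by blast
  then obtain a b c d where uw: "u = a *\<^sub>R w 1 + b *\<^sub>R w 2 + c *\<^sub>R w 3 + d *\<^sub>R w 4" using T by blast
  have d0: "B (w i) (w i) = 0" for i using skew[of i i] by simp
  have "b * B (w 1) (w 2) + c * B (w 1) (w 3) + d * B (w 1) (w 4) = 0"
    "a * B (w 1) (w 2) - c * B (w 2) (w 3) - d * B (w 2) (w 4) = 0"
    "a * B (w 1) (w 3) + b * B (w 2) (w 3) - d * B (w 3) (w 4) = 0"
    "a * B (w 1) (w 4) + b * B (w 2) (w 4) + c * B (w 3) (w 4) = 0"
    using h0 skew[of 2 1] skew[of 3 1] skew[of 4 1] skew[of 3 2] skew[of 4 2] skew[of 4 3]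
    unfolding uw by (simp_all add: lin d0)
  then have "a * ?P = 0" "b * ?P = 0" "c * ?P = 0" "d * ?P = 0" by algebra+
  then have "u = 0" using P unfolding uw by simp
  then show False using u(3) by simp
qed

lemma bounded_bilinear_half_om: "bounded_bilinear (\<lambda>x y. 1/2 * om x y)"
  by (intro bilinear_conv_bounded_bilinear[THEN iffD1]) (simp add: bilinear_def linear_iff algebra_simps)

text \<open>\<open>om z / 2\<close> is a primitive of the standard form; in its pull-back under \<open>G\<close> the second derivatives of \<open>G\<close>
  cancel by symmetry.\<close>

lemma ext_deriv_standard_primitive:
  fixes G :: "'a::euclidean_space \<Rightarrow> phase"
  assumes U: "open U" "p \<in> U" and G: "smooth_on U G"
  shows "pd u (\<lambda>p. 1/2 * om (G p) (pd v G p)) p - pd v (\<lambda>p. 1/2 * om (G p) (pd u G p)) p = om (pd u G p) (pd v G p)"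
proof -
  have d: "G differentiable (at p)" "pd w G differentiable (at p)" for w
    using smooth_on_differentiable[OF G U(2)] smooth_on_differentiable[OF smooth_on_pd[OF G] U(2)] by auto
  have "pd w (\<lambda>p. 1/2 * om (G p) (pd w' G p)) p = 1/2 * (om (G p) (pd w (pd w' G) p) + om (pd w G p) (pd w' G p))" for w w'
  proof -
    show ?thesis using pd_bilinear[OF bounded_bilinear_half_om d(1) d(2)[of w'], where v = w] by (simp add: algebra_simps)
  qed
  then show ?thesis using schwarz[OF U G, of u v] om_skew[of "pd v G p" "pd u G p"] by (simp add: algebra_simps)
qed

lemma pd_along_par:
  fixes f :: "real \<times> par \<Rightarrow> 'b::real_normed_vector"
  assumes "f differentiable (at (t, s))"
  shows "pd (0, d) f (t, s) = fst d *\<^sub>R pd (0, bas 1) f (t, s) + fst (snd d) *\<^sub>R pd (0, bas 2) f (t, s) 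
    + fst (snd (snd d)) *\<^sub>R pd (0, bas 3) f (t, s) + snd (snd (snd d)) *\<^sub>R pd (0, bas 4) f (t, s)"
proof -
  have "(0::real, d) = fst d *\<^sub>R (0, bas 1) + fst (snd d) *\<^sub>R (0, bas 2) 
    + fst (snd (snd d)) *\<^sub>R (0, bas 3) + snd (snd (snd d)) *\<^sub>R (0, bas 4)"
    by (simp add: bas_simps)
  from arg_cong[OF this, of "\<lambda>v. pd v f (t, s)"] show ?thesis by (simp only: pd_vector_add[OF assms])
qed

context
  fixes \<alpha> :: real
  assumes alpha: "\<alpha> > 1"
begin

lemma smooth_on_family:
  fixes \<Phi> :: "real \<Rightarrow> phase \<Rightarrow> 'b::euclidean_space"
  assumes "smooth_map_on ({-e<..<e} \<times> Y_alpha \<alpha>) (\<lambda>(t, x). \<Phi> t x)"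
  shows "smooth_on ({-e<..<e} \<times> UNIV) (\<lambda>(t, s). \<Phi> t (Psi \<alpha> s))"
proof -
  have U: "open ({-e<..<e} \<times> (UNIV :: par set))" by (intro open_Times) auto
  have "smooth_on ({-e<..<e} \<times> UNIV) (\<lambda>p. (\<lambda>(t, x). \<Phi> t x) (fst p, Psi \<alpha> (snd p)))"
  proof (rule smooth_map_on_compose[OF assms U])
    have "smooth_on ({-e<..<e} \<times> UNIV) (fst :: real \<times> par \<Rightarrow> real)" "smooth_on ({-e<..<e} \<times> UNIV) (snd :: real \<times> par \<Rightarrow> par)"
      by (intro smooth_on_bounded_linear bounded_linear_fst bounded_linear_snd)+
    then show "smooth_on ({-e<..<e} \<times> UNIV) (\<lambda>p. (fst p, Psi \<alpha> (snd p)))"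
      by (intro smooth_on_Pair U smooth_on_compose[OF U _ smooth_on_Psi[OF alpha] subset_UNIV])
  qed (auto simp: Psi_in_Y[OF alpha])
  then show ?thesis by (simp add: case_prod_unfold)
qed

text \<open>A curve in the image is moved back to \<open>Y_alpha\<close> by the smooth left inverse \<open>J\<close>. Its velocity there is
  realised in the coordinates \<open>Psi\<close>, since the point is regular, and is pushed forward again.\<close>

lemma tangent_space_image:
  fixes \<Phi> :: "real \<Rightarrow> phase \<Rightarrow> 'b::euclidean_space"
  assumes \<Phi>: "smooth_map_on ({-e<..<e} \<times> Y_alpha \<alpha>) (\<lambda>(t, x). \<Phi> t x)" and t: "\<bar>t\<bar> < e"
    and J: "smooth_map_on (\<Phi> t ` Y_alpha \<alpha>) J" "\<And>x. x \<in> Y_alpha \<alpha> \<Longrightarrow> J (\<Phi> t x) = x"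
    and s: "fst (snd (snd s)) = pi / 4" and v: "v \<in> tangent_space (\<Phi> t ` Y_alpha \<alpha>) (\<Phi> t (Psi \<alpha> s))"
  shows "\<exists>d. v = pd (0, d) (\<lambda>(t, s). \<Phi> t (Psi \<alpha> s)) (t, s)"
proof -
  let ?Y = "Y_alpha \<alpha>" and ?G = "\<lambda>(t, s). \<Phi> t (Psi \<alpha> s)"
  have pY: "Psi \<alpha> s \<in> ?Y" by (rule Psi_in_Y[OF alpha])
  have tp: "(t, Psi \<alpha> s) \<in> {-e<..<e} \<times> ?Y" using t pY by auto
  obtain W h where W: "open W" "(t, Psi \<alpha> s) \<in> W" "smooth_on W h" 
    "\<And>y. y \<in> W \<Longrightarrow> y \<in> {-e<..<e} \<times> ?Y \<Longrightarrow> h y = (\<lambda>(t, x). \<Phi> t x) y"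
    using smooth_map_onE[OF \<Phi> tp] by blast
  have dh: "h differentiable (at (t, Psi \<alpha> s))" by (rule smooth_on_differentiable[OF W(3,2)])
  have near: "\<exists>d>0. \<forall>\<tau>. \<bar>\<tau>\<bar> < d \<longrightarrow> b \<tau> \<in> V" 
    if "(b has_vector_derivative u) (at 0)" "open V" "b 0 \<in> V" for b :: "real \<Rightarrow> 'c::real_normed_vector" and u V
  proof -
    have "isCont b 0" using that(1) has_vector_derivative_continuous by blast
    then have "(b \<longlongrightarrow> b 0) (nhds 0)" by (simp add: isCont_def tendsto_at_iff_tendsto_nhds)
    then have "eventually (\<lambda>\<tau>. b \<tau> \<in> V) (nhds 0)" using that(2,3) by (rule topological_tendstoD)
    then show ?thesis unfolding eventually_nhds_metric dist_real_def by simp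
  qed
  have push: "((\<lambda>\<tau>. \<Phi> t (b \<tau>)) has_vector_derivative pd (0, u) h (t, Psi \<alpha> s)) (at 0)"
    if b: "(b has_vector_derivative u) (at 0)" "b 0 = Psi \<alpha> s" "\<delta> > 0" "\<And>\<tau>. \<bar>\<tau>\<bar> < \<delta> \<Longrightarrow> b \<tau> \<in> ?Y" for b u \<delta>
  proof -
    have tb: "((\<lambda>\<tau>. (t, b \<tau>)) has_vector_derivative (0, u)) (at 0)"
      using b(1) by (auto intro!: has_vector_derivative_Pair)
    obtain \<delta>' where d: "\<delta>' > 0" "\<And>\<tau>. \<bar>\<tau>\<bar> < \<delta>' \<Longrightarrow> (t, b \<tau>) \<in> W"
      using near[OF tb W(1)] W(2) b(2) by auto
    have dhb: "((\<lambda>\<tau>. h (t, b \<tau>)) has_vector_derivative pd (0, u) h (t, b 0)) (at 0)"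
      by (rule has_vector_derivative_smooth_compose[OF _ tb]) (use dh b(2) in simp)
    have "h (t, b \<tau>) = \<Phi> t (b \<tau>)" if "\<tau> \<in> {- min \<delta> \<delta>'<..<min \<delta> \<delta>'}" for \<tau>
    proof -
      have "\<bar>\<tau>\<bar> < \<delta>'" "\<bar>\<tau>\<bar> < \<delta>" using that by auto
      then show ?thesis using W(4)[OF d(2)] b(4) t by (auto simp: abs_less_iff)
    qed
    then show ?thesis
      using has_vector_derivative_transform_within_open[OF dhb[unfolded b(2)], where S = "{- min \<delta> \<delta>'<..<min \<delta> \<delta>'}"
          and g = "\<lambda>\<tau>. \<Phi> t (b \<tau>)"] d(1) b(3) by simp
  qed
  obtain c \<epsilon> where c: "\<epsilon> > 0" "(c has_vector_derivative v) (at 0)" "c 0 = \<Phi> t (Psi \<alpha> s)" 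
    "\<And>\<tau>. \<bar>\<tau>\<bar> < \<epsilon> \<Longrightarrow> c \<tau> \<in> \<Phi> t ` ?Y"
    using v by (auto elim: tangent_space_velocity)
  obtain V g where V: "open V" "\<Phi> t (Psi \<alpha> s) \<in> V" "smooth_on V g" 
    "\<And>y. y \<in> V \<Longrightarrow> y \<in> \<Phi> t ` ?Y \<Longrightarrow> g y = J y"
    using smooth_map_onE[OF J(1), of "\<Phi> t (Psi \<alpha> s)"] pY by blast
  obtain \<delta> where d: "\<delta> > 0" "\<And>\<tau>. \<bar>\<tau>\<bar> < \<delta> \<Longrightarrow> c \<tau> \<in> V"
    using near[OF c(2) V(1)] V(2) c(3) by auto
  define b where "b \<tau> = g (c \<tau>)" for \<tau>
  define \<mu> where "\<mu> = min \<delta> \<epsilon>"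
  have mu: "\<mu> > 0" using d(1) c(1) by (simp add: \<mu>_def)
  have b: "b \<tau> \<in> ?Y \<and> \<Phi> t (b \<tau>) = c \<tau>" if "\<bar>\<tau>\<bar> < \<mu>" for \<tau>
    using that[unfolded \<mu>_def] d(2)[of \<tau>] c(4)[of \<tau>] V(4)[of "c \<tau>"] J(2) unfolding b_def by auto
  have b0: "b 0 = Psi \<alpha> s" unfolding b_def c(3) using V pY J(2) by simp
  have db: "(b has_vector_derivative pd v g (c 0)) (at 0)"
    unfolding b_def by (rule has_vector_derivative_smooth_compose[OF _ c(2)]) 
      (use smooth_on_differentiable[OF V(3,2)] c(3) in simp)
  have "pd v g (c 0) \<in> TY \<alpha> (Psi \<alpha> s)"
    by (rule velocity_in_TY[OF db b0, of "\<mu>"]) (use b mu in auto)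
  then obtain w where w: "pd v g (c 0) = pd w (Psi \<alpha>) s" using pd_Psi_surj[OF alpha s] by blast
  have "((\<lambda>\<tau>. \<Phi> t (b \<tau>)) has_vector_derivative pd (0, pd w (Psi \<alpha>) s) h (t, Psi \<alpha> s)) (at 0)"
    using push[OF db b0, of "\<mu>"] b mu w by auto
  then have "(c has_vector_derivative pd (0, pd w (Psi \<alpha>) s) h (t, Psi \<alpha> s)) (at 0)"
    by (rule has_vector_derivative_transform_within_open[where S = "{- \<mu><..<\<mu>}"])
      (use b mu in \<open>auto simp: abs_less_iff\<close>)
  then have 1: "v = pd (0, pd w (Psi \<alpha>) s) h (t, Psi \<alpha> s)"
    using c(2) vector_derivative_unique_at by blast
  have "((\<lambda>\<tau>. Psi \<alpha> (s + \<tau> *\<^sub>R w)) has_vector_derivative pd w (Psi \<alpha>) s) (at 0)"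
    using has_vector_derivative_along_line[of "Psi \<alpha>" s 0 w] smooth_on_differentiable[OF smooth_on_Psi[OF alpha] UNIV_I] by simp
  then have "((\<lambda>\<tau>. \<Phi> t (Psi \<alpha> (s + \<tau> *\<^sub>R w))) has_vector_derivative pd (0, pd w (Psi \<alpha>) s) h (t, Psi \<alpha> s)) (at 0)"
    by (rule push[OF _ _ zero_less_one]) (simp_all add: Psi_in_Y[OF alpha])
  moreover have "((\<lambda>\<tau>. ?G ((t, s) + \<tau> *\<^sub>R (0, w))) has_vector_derivative pd (0, w) ?G ((t, s) + 0 *\<^sub>R (0, w))) (at 0)"
    by (rule has_vector_derivative_along_line) 
      (use smooth_on_differentiable[OF smooth_on_family[OF \<Phi>], of "(t, s)"] t in \<open>auto simp: abs_less_iff\<close>)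
  ultimately have "pd (0, w) ?G (t, s) = pd (0, pd w (Psi \<alpha>) s) h (t, Psi \<alpha> s)"
    using vector_derivative_unique_at by auto
  then show ?thesis using 1 by metis
qed

lemma pd_compose_Psi:
  fixes f :: "phase \<Rightarrow> real"
  assumes "smooth_map_on (Y_alpha \<alpha>) f"
  shows "pd d (\<lambda>s. f (Psi \<alpha> s)) s = dir_deriv (Y_alpha \<alpha>) f (Psi \<alpha> s) (pd d (Psi \<alpha>) s)"
proof -
  have pY: "Psi \<alpha> s \<in> Y_alpha \<alpha>" for s by (rule Psi_in_Y[OF alpha])
  obtain V g where V: "open V" "Psi \<alpha> s \<in> V" "smooth_on V g" 
    "\<And>y. y \<in> V \<Longrightarrow> y \<in> Y_alpha \<alpha> \<Longrightarrow> g y = f y"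
    using smooth_map_onE[OF assms pY] by blast
  let ?W = "Psi \<alpha> -` V"
  have W: "open ?W" using V(1) smooth_on_continuous[OF smooth_on_Psi[OF alpha]] by (simp add: open_vimage)
  have sg: "smooth_on ?W (\<lambda>s. g (Psi \<alpha> s))"
    by (rule smooth_on_compose[OF W smooth_on_subset[OF smooth_on_Psi[OF alpha] subset_UNIV] V(3)]) auto
  have dg: "g differentiable (at (Psi \<alpha> s))" by (rule smooth_on_differentiable[OF V(3,2)])
  have "pd d (\<lambda>s. g (Psi \<alpha> s)) s = pd d (\<lambda>s. f (Psi \<alpha> s)) s"
    by (rule pd_cong_open(1)[OF W _ _ smooth_on_differentiable[OF sg]]) (use V pY in auto)
  moreover have "pd d (\<lambda>s. g (Psi \<alpha> s)) s = pd (pd d (Psi \<alpha>) s) g (Psi \<alpha> s)"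
    by (rule pd_compose[OF smooth_on_differentiable[OF smooth_on_Psi[OF alpha] UNIV_I] dg])
  moreover have "pd d (Psi \<alpha>) s \<in> tangent_space (Y_alpha \<alpha>) (Psi \<alpha> s)"
    using pd_Psi_in_TY[OF alpha] tangent_space_Y_alpha[OF alpha pY] by blast
  ultimately show ?thesis using dir_deriv_eq[OF _ pY V(1,2,4) dg] by simp
qed

section \<open>Obstruction for deformations in the phase space\<close>

text \<open>With \<open>\<xi>\<close> the velocity of the path at time 0, the primitive \<open>om G (dG) / 2\<close> has the time derivative
  \<open>om \<xi> (d\<Psi>)\<close> plus the differential of \<open>om \<Psi> \<xi> / 2\<close>. On the null vector fields \<open>om \<xi>\<close> is the negative of the
  first order covector, which differs from the obstructed class by the differential of \<open>f\<close>.\<close>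

lemma Y_alpha_coisotropic_obstructed:
  fixes m n :: nat
  assumes nm: "n * \<alpha> = real m" "n > 0"
  shows "coisotropic_obstructed UNIV omega_std (Y_alpha \<alpha>)"
  unfolding coisotropic_obstructed_def
proof
  let ?Y = "Y_alpha \<alpha>"
  assume "coisotropic_unobstructed UNIV omega_std ?Y"
  then obtain \<Gamma> e \<phi> where coh: "leafwise_cohomologous ?Y omega_std (obstructed_class m n) \<Gamma>"
    and def: "coisotropic_deformation UNIV omega_std ?Y e \<phi>" and first: "coisotropic_first_order omega_std ?Y \<phi> \<Gamma>"
    using obstructed_class_closed[OF alpha nm(1)] unfolding coisotropic_unobstructed_def by blast
  have e: "e > 0" and \<phi>: "smooth_map_on ({-e<..<e} \<times> ?Y) (\<lambda>(t, x). \<phi> t x)" and \<phi>0: "\<And>x. x \<in> ?Y \<Longrightarrow> \<phi> 0 x = x"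
    and dif: "\<And>t. \<bar>t\<bar> < e \<Longrightarrow> diffeomorphism_onto_image ?Y (\<phi> t)"
    and coi: "\<And>t. \<bar>t\<bar> < e \<Longrightarrow> coisotropic_submanifold UNIV omega_std (\<phi> t ` ?Y)"
    using def unfolding coisotropic_deformation_def by (auto simp: abs_less_iff)
  let ?U = "{-e<..<e} \<times> (UNIV :: par set)"
  have U: "open ?U" by (intro open_Times) auto
  define G where "G = (\<lambda>(t, s). \<phi> t (Psi \<alpha> s))"
  have sG: "smooth_on ?U G" unfolding G_def by (rule smooth_on_family[OF \<phi>])
  have inU: "\<bar>t\<bar> < e \<Longrightarrow> (t, s) \<in> ?U" for t s by auto
  note dG = smooth_on_differentiable[OF sG inU] and dpG = smooth_on_differentiable[OF smooth_on_pd[OF sG] inU]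
  have e0: "\<bar>0\<bar> < e" using e by simp
  have G0: "G (0, s) = Psi \<alpha> s" for s by (simp add: G_def \<phi>0 Psi_in_Y[OF alpha])
  have pG0: "pd (0, d) G (0, s) = pd d (Psi \<alpha>) s" for d s
    using pd_slice[OF dG[OF e0], of s d] by (simp add: G0)
  have perG: "G (t, s + period n k *\<^sub>R bas k) = G (t, s)" if "k \<in> {1, 2}" for t s k
    by (simp add: G_def Psi_period[OF alpha nm(1) that])
  have perpG: "pd (0, d) G (t, s + period n k *\<^sub>R bas k) = pd (0, d) G (t, s)" if "k \<in> {1, 2}" "\<bar>t\<bar> < e" for t s k d
    using pd_periodic[OF smooth_on_slice[OF sG that(2)] perG[OF that(1)]] by (simp add: pd_slice[OF dG[OF that(2)]])
  define L where "L j p = 1/2 * om (G p) (pd (0, bas j) G p)" for j p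
  have sL: "smooth_on ?U (L j)" for j
    unfolding L_def by (intro smooth_on_mult smooth_on_bilinear[OF bounded_bilinear_om] smooth_on_pd sG U smooth_on_const)
  define F where "F i j p = pd (0, bas i) (L j) p - pd (0, bas j) (L i) p" for i j p
  have F: "F i j p = om (pd (0, bas i) G p) (pd (0, bas j) G p)" if "p \<in> ?U" for i j p
    unfolding F_def L_def by (rule ext_deriv_standard_primitive[OF U that sG])
  obtain f where f: "smooth_map_on ?Y f" "\<And>p v. p \<in> ?Y \<Longrightarrow> v \<in> null_space ?Y omega_std p \<Longrightarrow> 
      \<Gamma> p v - obstructed_class m n p v = dir_deriv ?Y f p v"
    using coh unfolding leafwise_cohomologous_def by blast
  define \<xi> where "\<xi> s = pd (1, 0) G (0, s)" for s
  define g where "g s = 1/2 * om (Psi \<alpha> s) (\<xi> s) - f (Psi \<alpha> s)" for s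
  have s\<xi>: "smooth_on UNIV \<xi>" unfolding \<xi>_def by (rule smooth_on_slice[OF smooth_on_pd[OF sG] e0])
  have along: "((\<lambda>t. G (t, s)) has_vector_derivative \<xi> s) (at 0)" for s
    using has_vector_derivative_along_line[of G "(0, s)" 0 "(1, 0)"] dG[OF e0, of s] by (simp add: \<xi>_def)
  have per\<xi>: "\<xi> (s + period n k *\<^sub>R bas k) = \<xi> s" if "k \<in> {1, 2}" for k s
    using along[of s] along[of "s + period n k *\<^sub>R bas k"] vector_derivative_unique_at unfolding perG[OF that] by blast
  have sf: "smooth_on UNIV (\<lambda>s. f (Psi \<alpha> s))"
    by (rule smooth_map_on_compose[OF f(1) open_UNIV smooth_on_Psi[OF alpha]]) (auto simp: Psi_in_Y[OF alpha])
  have null: "pd (bas j) (Psi \<alpha>) s \<in> null_space ?Y omega_std (Psi \<alpha> s)" if "j \<in> {1, 2}" for j s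
    using that rot_in_null_space[OF alpha Psi_in_Y[OF alpha], of 1 s 0] rot_in_null_space[OF alpha Psi_in_Y[OF alpha], of 0 s 1]
    by (auto simp: pd_Psi_rot[OF alpha, simplified])
  show False
  proof (rule no_pfaffian_zero_path[OF alpha nm e sL _ _ _ F_def])
    show "smooth_on UNIV g" unfolding g_def
      by (intro smooth_on_diff smooth_on_mult smooth_on_bilinear[OF bounded_bilinear_om] smooth_on_Psi alpha s\<xi> sf
          open_UNIV smooth_on_const)
    show "L j (t, x + period n k *\<^sub>R bas k) = L j (t, x)" if "k \<in> {1, 2}" "\<bar>t\<bar> < e" for j k t x
      unfolding L_def perG[OF that(1)] perpG[OF that] ..
    show "g (x + period n k *\<^sub>R bas k) = g x" if "k \<in> {1, 2}" for k x
      unfolding g_def per\<xi>[OF that] Psi_period[OF alpha nm(1) that] ..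
    show "F i j (0, s) = om (pd (bas i) (Psi \<alpha>) s) (pd (bas j) (Psi \<alpha>) s)" for i j s
      using F[OF inU[OF e0]] by (simp add: pG0)
    show "F 1 2 (t, s) * F 3 4 (t, s) - F 1 3 (t, s) * F 2 4 (t, s) + F 1 4 (t, s) * F 2 3 (t, s) = 0"
      if s: "fst (snd (snd s)) = pi / 4" and t: "\<bar>t\<bar> < e" for t s
      unfolding F[OF inU[OF t]]
    proof (rule pfaffian_zero_of_coisotropic[where N = UNIV and w = "\<lambda>k. pd (0, bas k) G (t, s)"])
      let ?T = "tangent_space (\<phi> t ` ?Y) (\<phi> t (Psi \<alpha> s))"
      show "bilinear om" using bounded_bilinear_om bilinear_conv_bounded_bilinear by blast
      show "\<exists>a b c d. v = a *\<^sub>R pd (0, bas 1) G (t, s) + b *\<^sub>R pd (0, bas 2) G (t, s) + 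
          c *\<^sub>R pd (0, bas 3) G (t, s) + d *\<^sub>R pd (0, bas 4) G (t, s)" if v: "v \<in> ?T" for v
      proof -
        have J: "inj_on (\<phi> t) ?Y" "smooth_map_on (\<phi> t ` ?Y) (inv_into ?Y (\<phi> t))"
          using dif[OF t] unfolding diffeomorphism_onto_image_def by auto
        obtain d where "v = pd (0, d) G (t, s)"
          using tangent_space_image[OF \<phi> t J(2) inv_into_f_f[OF J(1)] s v] unfolding G_def by blast
        then show ?thesis using pd_along_par[OF dG[OF t]] by blast
      qed
      show "u \<in> ?T" if "\<forall>v\<in>?T. om u v = 0" for u
        using coi[OF t] that Psi_in_Y[OF alpha] 
        unfolding coisotropic_submanifold_def tangent_space_UNIV omega_std_eq_om by blast
      show "om (pd (0, bas i) G (t, s)) (pd (0, bas j) G (t, s)) = - om (pd (0, bas j) G (t, s)) (pd (0, bas i) G (t, s))" for i j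
        by (rule om_skew)
    qed simp_all
    show "pd (1, 0) (L j) (0, s) = - 1 * leaf_value \<alpha> m n j s + pd (bas j) g s" if j: "j \<in> {1, 2}" for j s
    proof -
      let ?D = "pd (bas j) (Psi \<alpha>) s"
      have "pd (1, 0) (pd (0, bas j) G) (0, s) = pd (0, bas j) (pd (1, 0) G) (0, s)"
        by (rule schwarz[OF U inU[OF e0] sG])
      also have "\<dots> = pd (bas j) \<xi> s"
        unfolding \<xi>_def by (rule pd_slice[OF dpG[OF e0], symmetric])
      finally have "pd (1, 0) (L j) (0, s) = 1/2 * om (Psi \<alpha> s) (pd (bas j) \<xi> s) + 1/2 * om (\<xi> s) ?D"
        unfolding L_def using pd_bilinear[OF bounded_bilinear_half_om dG[OF e0] dpG[OF e0]] by (simp add: G0 pG0 \<xi>_def)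
      moreover have "pd (bas j) g s = 1/2 * om (Psi \<alpha> s) (pd (bas j) \<xi> s) + 1/2 * om ?D (\<xi> s) - pd (bas j) (\<lambda>s. f (Psi \<alpha> s)) s"
      proof -
        note D = smooth_on_differentiable[OF _ UNIV_I]
        have "smooth_on UNIV (\<lambda>s. 1/2 * om (Psi \<alpha> s) (\<xi> s))"
          by (rule smooth_on_bilinear[OF bounded_bilinear_half_om open_UNIV smooth_on_Psi[OF alpha] s\<xi>])
        from pd_diff[OF D[OF this] D[OF sf]] show ?thesis
          unfolding g_def pd_bilinear[OF bounded_bilinear_half_om D[OF smooth_on_Psi[OF alpha]] D[OF s\<xi>]] .
      qed
      moreover have "pd (bas j) (\<lambda>s. f (Psi \<alpha> s)) s = dir_deriv ?Y f (Psi \<alpha> s) ?D"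
        by (rule pd_compose_Psi[OF f(1)])
      moreover have "\<Gamma> (Psi \<alpha> s) ?D = om ?D (\<xi> s)"
      proof -
        obtain \<xi>' where "((\<lambda>t. \<phi> t (Psi \<alpha> s)) has_vector_derivative \<xi>') (at 0)" "\<Gamma> (Psi \<alpha> s) ?D = om ?D \<xi>'"
          using first Psi_in_Y[OF alpha] null[OF j] unfolding coisotropic_first_order_def omega_std_eq_om by blast
        moreover from this(1) have "\<xi>' = \<xi> s"
          using along[of s] vector_derivative_unique_at unfolding G_def by fastforce
        ultimately show ?thesis by simp
      qed
      moreover have "\<Gamma> (Psi \<alpha> s) ?D - obstructed_class m n (Psi \<alpha> s) ?D = dir_deriv ?Y f (Psi \<alpha> s) ?D"
        by (rule f(2)[OF Psi_in_Y[OF alpha] null[OF j]])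
      ultimately show ?thesis using om_skew[of "\<xi> s" ?D] by (simp add: leaf_value_def)
    qed
  qed
qed

end


section \<open>Obstruction for deformations of the pre-symplectic manifold\<close>

lemma inner_zc: "u \<bullet> v = (\<Sum>j\<in>UNIV. Re (cnj (zc j u) * zc j v))"
  by (simp add: inner_prod_def inner_vec_def zc_def sum.distrib[symmetric])

lemma rot_inner: "rot \<beta> p \<bullet> rot \<gamma> p = (\<Sum>j\<in>UNIV. \<beta> j * \<gamma> j * (cmod (zc j p))\<^sup>2)"
  unfolding inner_zc cmod_power2 by (simp add: power2_eq_square algebra_simps)

definition gram :: "real \<Rightarrow> phase \<Rightarrow> real" where
  "gram \<alpha> p = rot (wt \<alpha>) p \<bullet> rot (wt \<alpha>) p - 1/4"

text \<open>The element of the span of the two null vector fields with prescribed inner products \<open>a, b\<close>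
  with them: on \<open>Y_alpha\<close> their Gram matrix has the entries \<open>1, 1/2\<close> and determinant \<open>gram\<close>.\<close>

definition null_vec :: "real \<Rightarrow> real \<Rightarrow> real \<Rightarrow> phase \<Rightarrow> phase" where
  "null_vec \<alpha> a b p = (a - (b - a / 2) / gram \<alpha> p / 2) *\<^sub>R rot (\<lambda>_. 1) p + ((b - a / 2) / gram \<alpha> p) *\<^sub>R rot (wt \<alpha>) p"

lemma tangent_space_mono: "S \<subseteq> S' \<Longrightarrow> tangent_space S p \<subseteq> tangent_space S' p"
  unfolding tangent_space_def by blast

context
  fixes \<alpha> :: real
  assumes alpha: "\<alpha> > 1"
begin

lemma gram_positive:
  assumes "p \<in> Y_alpha \<alpha>" shows "gram \<alpha> p > 0"
proof -
  let ?N = "\<lambda>j. (cmod (zc j p))\<^sup>2"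
  have "gram \<alpha> p = ?N 1 + \<alpha> * \<alpha> * ?N 2 - 1/4" by (simp add: gram_def rot_inner sum_3)
  moreover have "\<alpha> * ?N 2 \<le> \<alpha> * \<alpha> * ?N 2" using alpha by (intro mult_right_mono) auto
  ultimately show ?thesis using Y_alpha_cmod(2)[OF assms] by simp
qed

lemma null_vec_inner:
  assumes "p \<in> Y_alpha \<alpha>"
  shows "null_vec \<alpha> a b p \<bullet> rot (\<lambda>_. 1) p = a" "null_vec \<alpha> a b p \<bullet> rot (wt \<alpha>) p = b"
proof -
  have i: "rot (\<lambda>_. 1) p \<bullet> rot (\<lambda>_. 1) p = 1" "rot (\<lambda>_. 1) p \<bullet> rot (wt \<alpha>) p = 1/2"
    "rot (wt \<alpha>) p \<bullet> rot (\<lambda>_. 1) p = 1/2"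
    using Y_alpha_cmod[OF assms] by (simp_all add: rot_inner sum_3)
  define k where "k = (b - a / 2) / gram \<alpha> p"
  have k: "k * (rot (wt \<alpha>) p \<bullet> rot (wt \<alpha>) p) = b - a / 2 + k / 4"
    using gram_positive[OF assms] by (simp add: k_def gram_def field_simps)
  show "null_vec \<alpha> a b p \<bullet> rot (\<lambda>_. 1) p = a" "null_vec \<alpha> a b p \<bullet> rot (wt \<alpha>) p = b"
    unfolding null_vec_def k_def[symmetric] by (simp_all add: inner_add_left i k field_simps)
qed

lemma null_vec_null:
  assumes "p \<in> Y_alpha \<alpha>" shows "null_vec \<alpha> a b p \<in> null_space (Y_alpha \<alpha>) omega_std p"
  unfolding null_vec_def by (rule rot_in_null_space[OF alpha assms])

lemma null_section_rot: "null_section (Y_alpha \<alpha>) omega_std (rot (\<lambda>_. 1))" "null_section (Y_alpha \<alpha>) omega_std (rot (wt \<alpha>))"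
proof -
  have "smooth_map_on (Y_alpha \<alpha>) (rot \<beta>)" for \<beta>
    unfolding smooth_map_on_def using smooth_on_bounded_linear[OF bounded_linear_rot[of \<beta>], of UNIV] open_UNIV by blast
  then show "null_section (Y_alpha \<alpha>) omega_std (rot (\<lambda>_. 1))" "null_section (Y_alpha \<alpha>) omega_std (rot (wt \<alpha>))"
    using rot_in_null_space[OF alpha, of _ 1 0] rot_in_null_space[OF alpha, of _ 0 1] unfolding null_section_def by auto
qed

text \<open>The graph as an embedding of \<open>Y_alpha\<close>: the element of the null space that represents \<open>\<Gamma>\<close> is determined by
  the values of \<open>\<Gamma>\<close> on the two null vector fields.\<close>

lemma graph_of_eq_image:
  assumes "leafwise_oneform (Y_alpha \<alpha>) omega_std \<Gamma>"
  shows "graph_of (Y_alpha \<alpha>) omega_std \<Gamma> = (\<lambda>p. (p, null_vec \<alpha> (\<Gamma> p (rot (\<lambda>_. 1) p)) (\<Gamma> p (rot (wt \<alpha>) p)) p)) ` Y_alpha \<alpha>"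
    (is "?L = ?A ` _")
proof -
  let ?Y = "Y_alpha \<alpha>"
  have ip: "snd (?A p) \<bullet> v = \<Gamma> p v" if p: "p \<in> ?Y" and v: "v \<in> null_space ?Y omega_std p" for p v
  proof -
    obtain a b where v: "v = a *\<^sub>R rot (\<lambda>_. 1) p + b *\<^sub>R rot (wt \<alpha>) p" using null_spaceE[OF alpha p v] .
    have "\<Gamma> p v = a * \<Gamma> p (rot (\<lambda>_. 1) p) + b * \<Gamma> p (rot (wt \<alpha>) p)"
      using assms p rot_in_null_space[OF alpha p, of 1 0] rot_in_null_space[OF alpha p, of 0 1]
      unfolding leafwise_oneform_def v by simp
    then show ?thesis unfolding v by (simp add: inner_add_right null_vec_inner[OF p])
  qed
  show ?thesis
  proof (intro equalityI subsetI)
    fix z assume "z \<in> ?L"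
    moreover obtain p a where za: "z = (p, a)" by (rule prod.exhaust)
    ultimately have z: "z = (p, a)" "p \<in> ?Y" "a \<in> null_space ?Y omega_std p" 
      "\<And>v. v \<in> null_space ?Y omega_std p \<Longrightarrow> a \<bullet> v = \<Gamma> p v"
      unfolding graph_of_def dual_bundle_def by simp_all
    let ?n = "snd (?A p)"
    have "a - ?n \<in> null_space ?Y omega_std p"
      using z(3) null_vec_null[OF z(2)] unfolding null_space_Y_alpha[OF alpha z(2)] by (simp add: span_diff)
    then have "(a - ?n) \<bullet> (a - ?n) = 0" using z(4) ip[OF z(2)] by (simp add: inner_diff_left)
    then have "a = ?n" by simp
    then show "z \<in> ?A ` ?Y" using z by auto
  next
    fix z assume "z \<in> ?A ` ?Y"
    then show "z \<in> ?L" using null_vec_null ip unfolding graph_of_def dual_bundle_def by auto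
  qed
qed

lemma smooth_map_on_null_vec:
  fixes e :: real
  assumes "smooth_map_on ({-e<..<e} \<times> Y_alpha \<alpha>) (\<lambda>(t, p). a t p)" "smooth_map_on ({-e<..<e} \<times> Y_alpha \<alpha>) (\<lambda>(t, p). b t p)"
  shows "smooth_map_on ({-e<..<e} \<times> Y_alpha \<alpha>) (\<lambda>(t, p). (p, null_vec \<alpha> (a t p) (b t p) p))"
  unfolding smooth_map_on_def
proof
  fix x assume x: "x \<in> {-e<..<e} \<times> Y_alpha \<alpha>"
  obtain U f where U: "open U" "x \<in> U" "smooth_on U f" "\<And>y. y \<in> U \<Longrightarrow> y \<in> {-e<..<e} \<times> Y_alpha \<alpha> \<Longrightarrow> f y = (\<lambda>(t, p). a t p) y"
    using smooth_map_onE[OF assms(1) x] by blast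
  obtain V g where V: "open V" "x \<in> V" "smooth_on V g" "\<And>y. y \<in> V \<Longrightarrow> y \<in> {-e<..<e} \<times> Y_alpha \<alpha> \<Longrightarrow> g y = (\<lambda>(t, p). b t p) y"
    using smooth_map_onE[OF assms(2) x] by blast
  have ss: "smooth_on W (snd :: real \<times> phase \<Rightarrow> phase)" for W
    by (intro smooth_on_bounded_linear bounded_linear_snd)
  have sr: "smooth_on W (\<lambda>y::real \<times> phase. rot \<beta> (snd y))" if "open W" for W \<beta>
    by (rule smooth_on_linear_compose[OF bounded_linear_rot that ss])
  have sg: "smooth_on W (\<lambda>y::real \<times> phase. gram \<alpha> (snd y))" if "open W" for W
    unfolding gram_def by (intro smooth_on_diff smooth_on_inner sr smooth_on_const that)
  define W where "W = U \<inter> V \<inter> (\<lambda>y. gram \<alpha> (snd y)) -` {0<..}"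
  have "open ((\<lambda>y::real \<times> phase. gram \<alpha> (snd y)) -` {0<..})"
    by (intro open_vimage smooth_on_continuous sg) auto
  then have W: "open W" unfolding W_def using U(1) V(1) by (simp add: open_Int)
  have "W \<subseteq> U" "W \<subseteq> V" unfolding W_def by blast+
  then have fg: "smooth_on W f" "smooth_on W g" using smooth_on_subset[OF U(3)] smooth_on_subset[OF V(3)] by blast+
  define k where "k y = (g y - f y * (1 / 2)) * (gram \<alpha> (snd y) powr - 1)" for y
  have sk: "smooth_on W k" unfolding k_def
    by (intro smooth_on_mult smooth_on_diff fg W smooth_on_const smooth_on_real_compose(1) sg) (simp add: W_def)
  define h where "h y = (snd y, (f y - k y * (1 / 2)) *\<^sub>R rot (\<lambda>_. 1) (snd y) + k y *\<^sub>R rot (wt \<alpha>) (snd y))" for y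
  have "smooth_on W h" unfolding h_def
    by (intro smooth_on_Pair smooth_on_add smooth_on_scaleR smooth_on_diff smooth_on_mult smooth_on_const fg sk sr ss W)
  moreover have "h y = (\<lambda>(t, p). (p, null_vec \<alpha> (a t p) (b t p) p)) y" if "y \<in> W \<inter> ({-e<..<e} \<times> Y_alpha \<alpha>)" for y
  proof -
    have y: "y \<in> W" "y \<in> U" "y \<in> V" "y \<in> {-e<..<e} \<times> Y_alpha \<alpha>" using that \<open>W \<subseteq> U\<close> \<open>W \<subseteq> V\<close> by blast+
    then have "k y = (g y - f y / 2) / gram \<alpha> (snd y)" unfolding k_def W_def by (simp add: powr_minus_divide)
    then show ?thesis unfolding h_def null_vec_def using U(4)[OF y(2,4)] V(4)[OF y(3,4)] by (simp add: split_beta)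
  qed
  moreover have "x \<in> W" unfolding W_def using U(2) V(2) x gram_positive by auto
  ultimately show "\<exists>U g. open U \<and> x \<in> U \<and> smooth_on U g \<and> 
      (\<forall>y\<in>U \<inter> {-e<..<e} \<times> Y_alpha \<alpha>. g y = (case y of (t, p) \<Rightarrow> (p, null_vec \<alpha> (a t p) (b t p) p)))"
    using W by (intro exI[of _ W] exI[of _ h]) auto
qed

text \<open>At a regular point six independent directions arise from the four parameters of the base point and
  the two fibre coordinates. More than four are needed to find one that is orthogonal to the
  tangent space of the graph of a section.\<close>

lemma dual_bundle_tangent:
  assumes M: "open U" "M = U \<inter> dual_bundle (Y_alpha \<alpha>) omega_std" and z: "(Psi \<alpha> s, a) \<in> M"
    and s: "fst (snd (snd s)) = pi / 4"
  shows "\<exists>N. subspace N \<and> dim N > 4 \<and> N \<subseteq> tangent_space M (Psi \<alpha> s, a)"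
proof -
  let ?Y = "Y_alpha \<alpha>" and ?X1 = "rot (\<lambda>_. 1)" and ?X2 = "rot (wt \<alpha>)" and ?p = "Psi \<alpha> s"
  have pY: "Psi \<alpha> x \<in> ?Y" for x by (rule Psi_in_Y[OF alpha])
  have "a \<in> null_space ?Y omega_std ?p" using z unfolding M(2) dual_bundle_def by simp
  from null_spaceE[OF alpha pY this] obtain k1 k2 where a: "a = k1 *\<^sub>R ?X1 ?p + k2 *\<^sub>R ?X2 ?p" .
  define h where "h x = (let d = fst x; c1 = fst (snd x); c2 = snd (snd x); v = pd d (Psi \<alpha>) s in
     (v, (k1 *\<^sub>R ?X1 v + c1 *\<^sub>R ?X1 ?p) + (k2 *\<^sub>R ?X2 v + c2 *\<^sub>R ?X2 ?p)))" for x :: "par \<times> real \<times> real"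
  have dPsi: "Psi \<alpha> differentiable (at x)" for x by (rule smooth_on_differentiable[OF smooth_on_Psi[OF alpha] UNIV_I])
  have lh: "linear h"
    by (rule linearI) (simp_all add: h_def Let_def pd_vector_add[OF dPsi] algebra_simps)
  have "x = 0" if "h x = 0" for x
  proof -
    have h0: "fst (h x) = 0" "snd (h x) = 0" using that by simp_all
    from h0(1) have "pd (fst x) (Psi \<alpha>) s = 0" by (simp add: h_def Let_def)
    then have d: "fst x = 0" using pd_Psi_inj[OF alpha s] by blast
    have "pd 0 (Psi \<alpha>) s = 0" using linear_frechet_derivative[OF dPsi] linear_0 by blast
    moreover have "?X1 0 = 0" "?X2 0 = 0" by (auto intro: phase_eqI)
    ultimately have "fst (snd x) *\<^sub>R ?X1 ?p + snd (snd x) *\<^sub>R ?X2 ?p = 0"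
      using h0(2) d by (simp add: h_def Let_def)
    then show ?thesis using rot_independent[OF alpha pY] d by (auto simp: prod_eq_iff)
  qed
  then have "inj h" using lh linear_injective_0 by blast
  then have "dim (range h) = DIM(par \<times> real \<times> real)" using dim_image_eq[OF lh, of UNIV] by simp
  then have dim: "dim (range h) > 4" by simp
  have "h x \<in> tangent_space M (?p, a)" for x
  proof -
    obtain d c1 c2 where x: "x = (d, c1, c2)" by (cases x)
    let ?v = "pd d (Psi \<alpha>) s"
    define q where "q t = Psi \<alpha> (s + t *\<^sub>R d)" for t
    define c where "c t = (q t, (k1 + t * c1) *\<^sub>R ?X1 (q t) + (k2 + t * c2) *\<^sub>R ?X2 (q t))" for t
    have "smooth_on UNIV (\<lambda>t::real. s + t *\<^sub>R d)" "smooth_on UNIV (\<lambda>t::real. k + t * c)" for k c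
      by (intro smooth_on_add smooth_on_const smooth_on_bounded_linear bounded_linear_scaleR_left bounded_linear_mult_left open_UNIV)+
    then have sq: "smooth_on UNIV q" and sk: "smooth_on UNIV (\<lambda>t::real. k + t * c)" for k c
      unfolding q_def using smooth_on_compose[OF open_UNIV _ smooth_on_Psi[OF alpha] subset_UNIV] by blast+
    have sc: "smooth_on UNIV c" unfolding c_def
      by (intro smooth_on_Pair smooth_on_add smooth_on_scaleR sq sk smooth_on_linear_compose[OF bounded_linear_rot] open_UNIV)
    have V: "open (c -` U)" by (intro open_vimage M(1) smooth_on_continuous sc)
    have c0: "c 0 = (?p, a)" by (simp add: c_def q_def a)
    have dq: "(q has_vector_derivative ?v) (at 0)"
      unfolding q_def using has_vector_derivative_along_line[OF dPsi, where x = s and t = 0 and v = d] by simp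
    have dr: "((\<lambda>t. rot \<beta> (q t)) has_vector_derivative rot \<beta> ?v) (at 0)" for \<beta>
      by (rule bounded_linear.has_vector_derivative[OF bounded_linear_rot dq])
    have "((\<lambda>t. (k + t * l) *\<^sub>R rot \<beta> (q t)) has_vector_derivative (k *\<^sub>R rot \<beta> ?v + l *\<^sub>R rot \<beta> ?p)) (at 0)" for k l \<beta>
    proof -
      have "((\<lambda>t. k + t * l) has_real_derivative l) (at 0)" by (auto intro!: derivative_eq_intros)
      from has_vector_derivative_scaleR[OF this dr] show ?thesis by (simp add: q_def add.commute)
    qed
    then have dc: "(c has_vector_derivative h x) (at 0)"
      unfolding c_def h_def x Let_def fst_conv snd_conv
      by (intro has_vector_derivative_Pair has_vector_derivative_add dq)
    have "c t \<in> M" if "t \<in> c -` U" for t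
      using that rot_in_null_space[OF alpha pY] unfolding M(2) dual_bundle_def by (auto simp: c_def q_def pY)
    then show ?thesis
      using tangent_spaceI[OF V _ smooth_on_subset[OF sc subset_UNIV] _ dc] z c0 unfolding M(2) by auto
  qed
  then show ?thesis using dim by (intro exI[of _ "range h"]) (auto intro: linear_subspace_image[OF lh] subspace_UNIV)
qed

text \<open>The projection of the splitting is smooth for each constant vector, hence so are its values on a
  basis. The resulting expression extends \<open>theta_G\<close> to the ambient space, linearly in the vector, so that
  the thickening form is given by ordinary directional derivatives.\<close>

lemma theta_G_local:
  assumes "splitting (Y_alpha \<alpha>) omega_std K P" "x \<in> Y_alpha \<alpha>"
  obtains V \<beta> where "open V" "x \<in> V" "\<And>b. b \<in> Basis \<Longrightarrow> smooth_on (V \<times> UNIV) (\<beta> b)"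
    "\<And>z (v :: phase \<times> phase). fst z \<in> V \<Longrightarrow> fst z \<in> Y_alpha \<alpha> \<Longrightarrow> theta_G P z v = (\<Sum>b\<in>Basis. (fst v \<bullet> b) * \<beta> b z)"
proof -
  have "\<forall>b. \<exists>U g. open U \<and> x \<in> U \<and> smooth_on U g \<and> (\<forall>y\<in>U \<inter> Y_alpha \<alpha>. g y = P y b)"
    using assms unfolding splitting_def smooth_map_on_def by blast
  from choice[OF this] obtain U where 
    "\<forall>b. \<exists>g. open (U b) \<and> x \<in> U b \<and> smooth_on (U b) g \<and> (\<forall>y\<in>U b \<inter> Y_alpha \<alpha>. g y = P y b)" ..
  from choice[OF this] obtain g where 
    "\<forall>b. open (U b) \<and> x \<in> U b \<and> smooth_on (U b) (g b) \<and> (\<forall>y\<in>U b \<inter> Y_alpha \<alpha>. g b y = P y b)" ..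
  then have U: "\<And>b. open (U b)" "\<And>b. x \<in> U b" "\<And>b. smooth_on (U b) (g b)" 
    "\<And>b y. y \<in> U b \<Longrightarrow> y \<in> Y_alpha \<alpha> \<Longrightarrow> g b y = P y b" by blast+
  define V where "V = (\<Inter>b\<in>Basis. U b)"
  define \<beta> where "\<beta> b z = snd z \<bullet> g b (fst z)" for b and z :: "phase \<times> phase"
  have V: "open V" unfolding V_def by (intro open_INT finite_Basis ballI U)
  have V2: "open (V \<times> (UNIV :: phase set))" by (intro open_Times V open_UNIV)
  have "smooth_on (V \<times> UNIV) (\<beta> b)" if "b \<in> Basis" for b
    unfolding \<beta>_def
    by (intro smooth_on_inner V2 smooth_on_bounded_linear[OF bounded_linear_snd] 
        smooth_on_compose[OF V2 smooth_on_bounded_linear[OF bounded_linear_fst] U(3)]) (use that in \<open>auto simp: V_def\<close>)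
  moreover have "theta_G P z v = (\<Sum>b\<in>Basis. (fst v \<bullet> b) * \<beta> b z)"
    if "fst z \<in> V" "fst z \<in> Y_alpha \<alpha>" for z and v :: "phase \<times> phase"
  proof -
    have l: "linear (P (fst z))" using assms(1) that(2) unfolding splitting_def by blast
    have "P (fst z) (fst v) = P (fst z) (\<Sum>b\<in>Basis. (fst v \<bullet> b) *\<^sub>R b)" by (simp add: euclidean_representation)
    also have "\<dots> = (\<Sum>b\<in>Basis. (fst v \<bullet> b) *\<^sub>R P (fst z) b)" by (simp add: linear_sum[OF l] linear_scale[OF l])
    also have "\<dots> = (\<Sum>b\<in>Basis. (fst v \<bullet> b) *\<^sub>R g b (fst z))"
      using that U(4) by (intro sum.cong refl) (auto simp: V_def)
    finally show ?thesis unfolding theta_G_def \<beta>_def by (simp add: inner_sum_right)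
  qed
  moreover have "x \<in> V" using U(2) by (simp add: V_def)
  ultimately show ?thesis using V by (intro that[of V \<beta>]) simp_all
qed

end


lemma pd_snd:
  fixes f :: "'a::euclidean_space \<Rightarrow> 'b::real_normed_vector" and t :: "'c::euclidean_space"
  assumes "f differentiable (at s)"
  shows "pd (c, d) (\<lambda>p. f (snd p)) (t, s) = pd d f s"
proof -
  have s: "((snd :: 'c \<times> 'a \<Rightarrow> 'a) has_derivative snd) (at (t, s))"
    by (intro bounded_linear_imp_has_derivative bounded_linear_snd)
  have "((\<lambda>p. f (snd p)) has_derivative (\<lambda>v. pd (snd v) f s)) (at (t, s))"
    using diff_chain_at[OF s, of f] assms by (simp add: frechet_derivative_works o_def)
  from pd_eq[OF this, of "(c, d)"] show ?thesis by simp
qed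

lemma pd_linear_combination:
  fixes \<beta> :: "'i \<Rightarrow> 'a::euclidean_space \<Rightarrow> real"
  assumes "\<And>b. b \<in> I \<Longrightarrow> \<beta> b differentiable (at z)"
  shows "(\<lambda>y. \<Sum>b\<in>I. c b * \<beta> b y) differentiable (at z)" 
    and "pd u (\<lambda>y. \<Sum>b\<in>I. c b * \<beta> b y) z = (\<Sum>b\<in>I. c b * pd u (\<beta> b) z)"
proof -
  have d: "((\<lambda>y. \<Sum>b\<in>I. c b * \<beta> b y) has_derivative (\<lambda>v. \<Sum>b\<in>I. c b * pd v (\<beta> b) z)) (at z)"
    using assms by (intro has_derivative_sum has_derivative_mult_right) (simp add: frechet_derivative_works[symmetric])
  show "(\<lambda>y. \<Sum>b\<in>I. c b * \<beta> b y) differentiable (at z)" using d unfolding differentiable_def by blast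
  show "pd u (\<lambda>y. \<Sum>b\<in>I. c b * \<beta> b y) z = (\<Sum>b\<in>I. c b * pd u (\<beta> b) z)" by (rule pd_eq[OF d])
qed

context
  fixes \<alpha> :: real
  assumes alpha: "\<alpha> > 1"
begin

text \<open>The embeddings are the graphs of the sections \<open>\<Gamma>t t\<close>, and the pulled-back forms are \<open>\<omega> - d\<theta>\<close> with \<open>\<theta>\<close> the
  section composed with the projection of the splitting. As the projection is the identity on null
  vectors, \<open>\<theta>\<close> has the value \<open>\<Gamma>t t\<close> on them, so that minus the obstructed class is the time derivative of the
  primitive up to an exact form.\<close>

lemma Y_alpha_presymplectic_obstructed:
  fixes m n :: nat
  assumes nm: "n * \<alpha> = real m" "n > 0"
  shows "presymplectic_obstructed (Y_alpha \<alpha>) omega_std"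
  unfolding presymplectic_obstructed_def
proof
  let ?Y = "Y_alpha \<alpha>"
  assume "presymplectic_unobstructed ?Y omega_std"
  then obtain K P M \<Gamma> e \<Gamma>t where split: "splitting ?Y omega_std K P" and thick: "symplectic_thickening ?Y omega_std P M"
    and coh: "leafwise_cohomologous ?Y omega_std (obstructed_class m n) \<Gamma>"
    and def: "presymplectic_deformation ?Y omega_std P M e \<Gamma>t" and first: "presymplectic_first_order ?Y omega_std \<Gamma>t \<Gamma>"
    using obstructed_class_closed[OF alpha nm(1)] unfolding presymplectic_unobstructed_def by blast
  have e: "e > 0" and \<Gamma>s: "\<And>X. null_section ?Y omega_std X \<Longrightarrow> smooth_map_on ({-e<..<e} \<times> ?Y) (\<lambda>(t, p). \<Gamma>t t p (X p))"
    and \<Gamma>0: "\<And>p v. p \<in> ?Y \<Longrightarrow> v \<in> null_space ?Y omega_std p \<Longrightarrow> \<Gamma>t 0 p v = 0"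
    and lw: "\<And>t. \<bar>t\<bar> < e \<Longrightarrow> leafwise_oneform ?Y omega_std (\<Gamma>t t)"
    and coi: "\<And>t. \<bar>t\<bar> < e \<Longrightarrow> coisotropic_submanifold M (thickening_form ?Y omega_std P) (graph_of ?Y omega_std (\<Gamma>t t))"
    using def unfolding presymplectic_deformation_def by (auto simp: abs_less_iff)
  obtain A where A: "open A" "M = A \<inter> dual_bundle ?Y omega_std"
    using thick unfolding symplectic_thickening_def by blast
  let ?U = "{-e<..<e} \<times> (UNIV :: par set)"
  have U: "open ?U" by (intro open_Times) auto
  have inU: "\<bar>t\<bar> < e \<Longrightarrow> (t, s) \<in> ?U" for t s by auto
  have e0: "\<bar>0\<bar> < e" using e by simp
  have pY: "Psi \<alpha> s \<in> ?Y" for s by (rule Psi_in_Y[OF alpha])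
  note sPsi = smooth_on_Psi[OF alpha]
  note D = smooth_on_differentiable[OF _ UNIV_I]
  define D\<Psi> where "D\<Psi> j = pd (bas j) (Psi \<alpha>)" for j
  have sD: "smooth_on UNIV (D\<Psi> j)" for j unfolding D\<Psi>_def by (rule smooth_on_pd[OF sPsi])
  have rD: "D\<Psi> 1 s = rot (\<lambda>_. 1) (Psi \<alpha> s)" "D\<Psi> 2 s = rot (wt \<alpha>) (Psi \<alpha> s)" for s
    unfolding D\<Psi>_def pd_Psi_rot[OF alpha] by simp_all
  have null: "D\<Psi> j s \<in> null_space ?Y omega_std (Psi \<alpha> s)" if "j \<in> {1, 2}" for j s
    using that rot_in_null_space[OF alpha pY, of 1 s 0] rot_in_null_space[OF alpha pY, of 0 s 1] 
    by (auto simp: rD[simplified])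

  \<comment> \<open>The deformation as a family of embeddings: the graphs over \<open>Y_alpha\<close>.\<close>
  define \<Phi> where "\<Phi> t p = (p, null_vec \<alpha> (\<Gamma>t t p (rot (\<lambda>_. 1) p)) (\<Gamma>t t p (rot (wt \<alpha>) p)) p)" for t p
  have graph: "graph_of ?Y omega_std (\<Gamma>t t) = \<Phi> t ` ?Y" if "\<bar>t\<bar> < e" for t
    using graph_of_eq_image[OF alpha lw[OF that]] unfolding \<Phi>_def .
  have s\<Phi>: "smooth_map_on ({-e<..<e} \<times> ?Y) (\<lambda>(t, p). \<Phi> t p)"
    unfolding \<Phi>_def by (rule smooth_map_on_null_vec[OF alpha \<Gamma>s \<Gamma>s]) (rule null_section_rot[OF alpha])+
  define G where "G = (\<lambda>(t, s). \<Phi> t (Psi \<alpha> s))"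
  have sG: "smooth_on ?U G" unfolding G_def by (rule smooth_on_family[OF alpha s\<Phi>])
  note dG = smooth_on_differentiable[OF sG inU]
  have fstG: "fst (G p) = Psi \<alpha> (snd p)" for p by (simp add: G_def \<Phi>_def split_beta)
  have fst_pd: "fst (pd (0, d) G (t, s)) = pd d (Psi \<alpha>) s" if "\<bar>t\<bar> < e" for t s d
    using pd_linear[OF bounded_linear_fst dG[OF that], where v = "(0, d)"] pd_snd[OF D[OF sPsi], where d = d and t = t and c = 0] by (simp add: fstG)
  define \<theta> where "\<theta> j p = snd (G p) \<bullet> P (Psi \<alpha> (snd p)) (D\<Psi> j (snd p))" for j p
  have P: "linear (P (Psi \<alpha> s))" "\<And>v. v \<in> null_space ?Y omega_std (Psi \<alpha> s) \<Longrightarrow> P (Psi \<alpha> s) v = v" for s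
    using split pY unfolding splitting_def by blast+
  have ssnd: "smooth_on ?U (snd :: real \<times> par \<Rightarrow> par)" by (intro smooth_on_bounded_linear bounded_linear_snd)
  have s\<theta>: "smooth_on ?U (\<theta> j)" for j
  proof -
    have "P (Psi \<alpha> s) (D\<Psi> j s) = (\<Sum>b\<in>Basis. (D\<Psi> j s \<bullet> b) *\<^sub>R P (Psi \<alpha> s) b)" for s
    proof -
      have "P (Psi \<alpha> s) (D\<Psi> j s) = P (Psi \<alpha> s) (\<Sum>b\<in>Basis. (D\<Psi> j s \<bullet> b) *\<^sub>R b)" by (simp only: euclidean_representation)
      then show ?thesis by (simp only: linear_sum[OF P(1)] linear_scale[OF P(1)])
    qed
    moreover have "smooth_on UNIV (\<lambda>s. P (Psi \<alpha> s) b)" for b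
    proof -
      have "smooth_map_on ?Y (\<lambda>x. P x b)" using split unfolding splitting_def by blast
      then show ?thesis by (rule smooth_map_on_compose[OF _ open_UNIV sPsi]) (use pY in blast)
    qed
    ultimately have "smooth_on UNIV (\<lambda>s. P (Psi \<alpha> s) (D\<Psi> j s))"
      by (simp only:) (intro smooth_on_sum open_UNIV smooth_on_scaleR smooth_on_linear_compose[OF bounded_linear_inner_left] sD)
    then show ?thesis unfolding \<theta>_def
      by (intro smooth_on_inner U smooth_on_linear_compose[OF bounded_linear_snd] sG smooth_on_compose[OF U ssnd _ subset_UNIV])
  qed
  have \<theta>leaf: "\<theta> j (t, s) = \<Gamma>t t (Psi \<alpha> s) (D\<Psi> j s)" if "j \<in> {1, 2}" for j t s
    using that null_vec_inner[OF alpha pY[of s]] null[OF that, of s] unfolding \<theta>_def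
    by (auto simp: P(2) G_def \<Phi>_def rD[simplified])
  have \<theta>0: "\<theta> j (0, s) = 0" for j s
    using \<Gamma>0[OF pY null[of 1 s]] \<Gamma>0[OF pY null[of 2 s]] unfolding \<theta>_def G_def \<Phi>_def by (simp add: rD[simplified] null_vec_def)
  define prim where "prim j s = 1/2 * om (Psi \<alpha> s) (pd (bas j) (Psi \<alpha>) s)" for j s
  have s_prim: "smooth_on UNIV (prim j)" for j
    unfolding prim_def by (rule smooth_on_bilinear[OF bounded_bilinear_half_om open_UNIV sPsi smooth_on_pd[OF sPsi]])
  define L where "L j p = prim j (snd p) - \<theta> j p" for j p
  have sL: "smooth_on ?U (L j)" for j
    unfolding L_def by (intro smooth_on_diff U s\<theta> smooth_on_compose[OF U ssnd s_prim subset_UNIV])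
  define F where "F i j p = pd (0, bas i) (L j) p - pd (0, bas j) (L i) p" for i j p
  \<comment> \<open>\<open>prim\<close> is a primitive of \<open>\<omega>\<close> in the parameters, and \<open>L\<close> one of the pulled-back thickening form.\<close>
  have d_prim: "pd (bas i) (prim j) s - pd (bas j) (prim i) s = om (D\<Psi> i s) (D\<Psi> j s)" for i j s
    unfolding prim_def D\<Psi>_def by (rule ext_deriv_standard_primitive[OF open_UNIV UNIV_I sPsi])
  have F: "F i j (t, s) = om (D\<Psi> i s) (D\<Psi> j s) - (pd (0, bas i) (\<theta> j) (t, s) - pd (0, bas j) (\<theta> i) (t, s))" if t: "\<bar>t\<bar> < e" for i j t s
  proof -
    have "pd (0, bas i) (L j) (t, s) = pd (bas i) (prim j) s - pd (0, bas i) (\<theta> j) (t, s)" for i j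
    proof -
      have "(\<lambda>p. prim j (snd p)) differentiable (at (t, s))"
        by (rule smooth_on_differentiable[OF smooth_on_compose[OF U ssnd s_prim subset_UNIV] inU[OF t]])
      from pd_diff[OF this smooth_on_differentiable[OF s\<theta>[of j] inU[OF t]], where v = "(0, bas i)"] show ?thesis
        unfolding L_def pd_snd[OF D[OF s_prim]] .
    qed
    then show ?thesis unfolding F_def d_prim[symmetric] by simp
  qed
  obtain f where f: "smooth_map_on ?Y f" "\<And>p v. p \<in> ?Y \<Longrightarrow> v \<in> null_space ?Y omega_std p \<Longrightarrow> 
      \<Gamma> p v - obstructed_class m n p v = dir_deriv ?Y f p v"
    using coh unfolding leafwise_cohomologous_def by blast
  have sf: "smooth_on UNIV (\<lambda>s. f (Psi \<alpha> s))"
    by (rule smooth_map_on_compose[OF f(1) open_UNIV sPsi]) (auto simp: pY)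
  have perD: "D\<Psi> j (s + period n k *\<^sub>R bas k) = D\<Psi> j s" if "k \<in> {1, 2}" for j s k
    unfolding D\<Psi>_def by (rule pd_periodic[OF sPsi Psi_period[OF alpha nm(1) that]])
  show False
  proof (rule no_pfaffian_zero_path[OF alpha nm e sL _ _ _ F_def])
    show "smooth_on UNIV (\<lambda>s. (- 1) * f (Psi \<alpha> s))" by (intro smooth_on_mult open_UNIV smooth_on_const sf)
    show "(- 1) * f (Psi \<alpha> (x + period n k *\<^sub>R bas k)) = (- 1) * f (Psi \<alpha> x)" if "k \<in> {1, 2}" for k x
      unfolding Psi_period[OF alpha nm(1) that] ..
    show "L j (t, x + period n k *\<^sub>R bas k) = L j (t, x)" if "k \<in> {1, 2}" "\<bar>t\<bar> < e" for j k t x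
      using perD[OF that(1), of j] unfolding L_def \<theta>_def prim_def G_def D\<Psi>_def by (simp add: Psi_period[OF alpha nm(1) that(1)])
    show "F i j (0, s) = om (pd (bas i) (Psi \<alpha>) s) (pd (bas j) (Psi \<alpha>) s)" for i j s
    proof -
      have "pd (0, d) (\<theta> j) (0, s) = 0" for d j
        using pd_slice[OF smooth_on_differentiable[OF s\<theta>[of j] inU[OF e0]], where v = d] by (simp add: \<theta>0)
      then show ?thesis using F[OF e0] by (simp add: D\<Psi>_def)
    qed
    show "pd (1, 0) (L j) (0, s) = - 1 * leaf_value \<alpha> m n j s + pd (bas j) (\<lambda>s. (- 1) * f (Psi \<alpha> s)) s" if j: "j \<in> {1, 2}" for j s
    proof -
      have "((\<lambda>t. \<Gamma>t t (Psi \<alpha> s) (D\<Psi> j s)) has_real_derivative \<Gamma> (Psi \<alpha> s) (D\<Psi> j s)) (at 0)"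
        using first pY null[OF j] unfolding presymplectic_first_order_def by blast
      then have "((\<lambda>t. L j (t, s)) has_real_derivative 0 - \<Gamma> (Psi \<alpha> s) (D\<Psi> j s)) (at 0)"
        unfolding L_def \<theta>leaf[OF j] snd_conv by (intro DERIV_diff DERIV_const)
      moreover have "((\<lambda>t. L j (t, s)) has_real_derivative pd (1, 0) (L j) (0, s)) (at 0)"
        using has_vector_derivative_along_line[of "L j" "(0, s)" 0 "(1, 0)"] smooth_on_differentiable[OF sL inU[OF e0], of j s]
        by (simp add: has_real_derivative_iff_has_vector_derivative)
      ultimately have "pd (1, 0) (L j) (0, s) = - \<Gamma> (Psi \<alpha> s) (D\<Psi> j s)" using DERIV_unique by fastforce
      moreover have "\<Gamma> (Psi \<alpha> s) (D\<Psi> j s) - obstructed_class m n (Psi \<alpha> s) (D\<Psi> j s) = dir_deriv ?Y f (Psi \<alpha> s) (D\<Psi> j s)"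
        by (rule f(2)[OF pY null[OF j]])
      moreover have "pd (bas j) (\<lambda>s. f (Psi \<alpha> s)) s = dir_deriv ?Y f (Psi \<alpha> s) (D\<Psi> j s)"
        unfolding D\<Psi>_def by (rule pd_compose_Psi[OF alpha f(1)])
      moreover have "pd (bas j) (\<lambda>s. (- 1) * f (Psi \<alpha> s)) s = (- 1) * pd (bas j) (\<lambda>s. f (Psi \<alpha> s)) s"
        by (rule pd_linear[OF bounded_linear_mult_right D[OF sf]])
      ultimately show ?thesis by (simp add: leaf_value_def D\<Psi>_def)
    qed
    show "F 1 2 (t, s) * F 3 4 (t, s) - F 1 3 (t, s) * F 2 4 (t, s) + F 1 4 (t, s) * F 2 3 (t, s) = 0"
      if s: "fst (snd (snd s)) = pi / 4" and t: "\<bar>t\<bar> < e" for t s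
    proof -
      define z where "z = G (t, s)"
      define w where "w k = pd (0, bas k) G (t, s)" for k
      let ?S = "graph_of ?Y omega_std (\<Gamma>t t)" and ?DB = "dual_bundle ?Y omega_std"
      have fz: "fst z = Psi \<alpha> s" by (simp add: z_def fstG)
      have zS: "z \<in> ?S" unfolding graph[OF t] z_def G_def using pY by auto
      have SM: "?S \<subseteq> M" using coi[OF t] unfolding coisotropic_submanifold_def by blast
      then have zM: "z \<in> M" and zD: "z \<in> ?DB" and SD: "?S \<subseteq> ?DB" using zS A(2) by auto
      obtain V \<beta> where V: "open V" "Psi \<alpha> s \<in> V" "\<And>b. b \<in> Basis \<Longrightarrow> smooth_on (V \<times> UNIV) (\<beta> b)"
        "\<And>z (v :: phase \<times> phase). fst z \<in> V \<Longrightarrow> fst z \<in> ?Y \<Longrightarrow> theta_G P z v = (\<Sum>b\<in>Basis. (fst v \<bullet> b) * \<beta> b z)"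
        by (rule theta_G_local[OF alpha split pY]) (rule that)
      have V2: "open (V \<times> (UNIV :: phase set))" by (intro open_Times V open_UNIV)
      have zV: "z \<in> V \<times> UNIV" using V(2) fz by (simp add: mem_Times_iff)
      have d\<beta>: "\<beta> b differentiable (at z)" if "b \<in> Basis" for b
        by (rule smooth_on_differentiable[OF V(3)[OF that] zV])
      define B where "B u v = om (fst u) (fst v) - ((\<Sum>b\<in>Basis. (fst v \<bullet> b) * pd u (\<beta> b) z) - (\<Sum>b\<in>Basis. (fst u \<bullet> b) * pd v (\<beta> b) z))" for u v
      \<comment> \<open>\<open>B\<close> represents the thickening form on tangent vectors of the dual bundle; unlike the thickening
        form it is bilinear on the whole ambient space.\<close>
      have bil: "bilinear B"
        unfolding bilinear_def linear_iff B_def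
        by (auto simp: pd_vector_add[OF d\<beta>] inner_add_left sum.distrib sum_distrib_left algebra_simps)
      have \<Omega>: "thickening_form ?Y omega_std P z u v = B u v" if "u \<in> tangent_space ?DB z" "v \<in> tangent_space ?DB z" for u v
      proof -
        have "dir_deriv ?DB (\<lambda>x. theta_G P x v) z u = (\<Sum>b\<in>Basis. (fst v \<bullet> b) * pd u (\<beta> b) z)"
          if "u \<in> tangent_space ?DB z" for u v
        proof -
          have "dir_deriv ?DB (\<lambda>x. theta_G P x v) z u = pd u (\<lambda>y. \<Sum>b\<in>Basis. (fst v \<bullet> b) * \<beta> b y) z"
            by (rule dir_deriv_eq[OF that zD V2 zV _ pd_linear_combination(1)[OF d\<beta>]])
              (auto simp: V(4) dual_bundle_def)
          also have "\<dots> = (\<Sum>b\<in>Basis. (fst v \<bullet> b) * pd u (\<beta> b) z)"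
            by (rule pd_linear_combination(2)[OF d\<beta>])
          finally show ?thesis .
        qed
        then show ?thesis using that unfolding thickening_form_def ext_deriv1_def B_def omega_std_eq_om by simp
      qed
      have FB: "F i j (t, s) = B (w i) (w j)" for i j
      proof -
        have "pd (0, bas i) (\<theta> j) (t, s) = (\<Sum>b\<in>Basis. (D\<Psi> j s \<bullet> b) * pd (w i) (\<beta> b) z + (pd (bas i) (D\<Psi> j) s \<bullet> b) * \<beta> b z)" for i j
        proof -
          let ?W = "?U \<inter> (\<lambda>p. Psi \<alpha> (snd p)) -` V"
          have "open ((\<lambda>p::real \<times> par. Psi \<alpha> (snd p)) -` V)"
            by (intro open_vimage V(1) continuous_on_compose2[OF smooth_on_continuous[OF sPsi]] continuous_intros) auto
          then have W: "open ?W" using U by blast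
          have inW: "(t, s) \<in> ?W" using inU[OF t] V(2) by simp
          have eq: "\<theta> j p = (\<Sum>b\<in>Basis. (D\<Psi> j (snd p) \<bullet> b) * \<beta> b (G p))" if "p \<in> ?W" for p
            using V(4)[of "G p" "(D\<Psi> j (snd p), 0)"] that pY unfolding \<theta>_def theta_G_def fstG by simp
          have "pd (0, bas i) (\<theta> j) (t, s) = pd (0, bas i) (\<lambda>p. \<Sum>b\<in>Basis. (D\<Psi> j (snd p) \<bullet> b) * \<beta> b (G p)) (t, s)"
            by (rule pd_cong_open(1)[OF W inW eq smooth_on_differentiable[OF s\<theta> inU[OF t]]])
          also have "\<dots> = (\<Sum>b\<in>Basis. (D\<Psi> j s \<bullet> b) * pd (w i) (\<beta> b) z + (pd (bas i) (D\<Psi> j) s \<bullet> b) * \<beta> b z)"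
          proof (rule pd_eq[where f' = "\<lambda>v. \<Sum>b\<in>Basis. (D\<Psi> j s \<bullet> b) * pd (pd v G (t, s)) (\<beta> b) z + (pd (snd v) (D\<Psi> j) s \<bullet> b) * \<beta> b z", 
                of _ "(t, s)" "(0, bas i)", unfolded w_def[symmetric] snd_conv], rule has_derivative_sum)
            fix b :: phase assume b: "b \<in> Basis"
            have "((snd :: real \<times> par \<Rightarrow> par) has_derivative snd) (at (t, s))"
              by (intro bounded_linear_imp_has_derivative bounded_linear_snd)
            from diff_chain_at[OF this, of "D\<Psi> j"] have "((\<lambda>p. D\<Psi> j (snd p)) has_derivative (\<lambda>v. pd (snd v) (D\<Psi> j) s)) (at (t, s))"
              using D[OF sD] by (simp add: frechet_derivative_works o_def)
            then have 1: "((\<lambda>p. D\<Psi> j (snd p) \<bullet> b) has_derivative (\<lambda>v. pd (snd v) (D\<Psi> j) s \<bullet> b)) (at (t, s))"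
              by (rule has_derivative_inner_left)
            have "(G has_derivative (\<lambda>v. pd v G (t, s))) (at (t, s))" using dG[OF t] by (simp add: frechet_derivative_works)
            from diff_chain_at[OF this, of "\<beta> b"] have 2: "((\<lambda>p. \<beta> b (G p)) has_derivative (\<lambda>v. pd (pd v G (t, s)) (\<beta> b) z)) (at (t, s))"
              using d\<beta>[OF b] by (simp add: frechet_derivative_works o_def z_def)
            show "((\<lambda>p. (D\<Psi> j (snd p) \<bullet> b) * \<beta> b (G p)) has_derivative 
                (\<lambda>v. (D\<Psi> j s \<bullet> b) * pd (pd v G (t, s)) (\<beta> b) z + (pd (snd v) (D\<Psi> j) s \<bullet> b) * \<beta> b z)) (at (t, s))"
              using has_derivative_mult[OF 1 2] by (simp add: z_def)
          qed
          finally show ?thesis .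
        qed
        \<comment> \<open>The second derivatives of \<open>Psi\<close> cancel in the antisymmetrisation.\<close>
        moreover have "pd (bas i) (D\<Psi> j) s = pd (bas j) (D\<Psi> i) s"
          unfolding D\<Psi>_def by (rule schwarz[OF open_UNIV UNIV_I sPsi])
        moreover have "fst (w k) = D\<Psi> k s" for k unfolding w_def D\<Psi>_def by (rule fst_pd[OF t])
        ultimately show ?thesis unfolding F[OF t] B_def by (simp add: sum.distrib)
      qed
      obtain N where N: "subspace N" "dim N > 4" "N \<subseteq> tangent_space M z"
        using dual_bundle_tangent[OF alpha A, of s "snd z"] zM s fz by (metis prod.collapse)
      have MD: "tangent_space M z \<subseteq> tangent_space ?DB z" and SD': "tangent_space ?S z \<subseteq> tangent_space ?DB z"
        by (intro tangent_space_mono; use A(2) SD in blast)+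
      show ?thesis unfolding FB
      proof (rule pfaffian_zero_of_coisotropic[OF bil _ _ N(1,2)])
        show "B (w i) (w j) = - B (w j) (w i)" for i j unfolding B_def using om_skew[of "fst (w i)"] by simp
        show "\<exists>a b c d. v = a *\<^sub>R w 1 + b *\<^sub>R w 2 + c *\<^sub>R w 3 + d *\<^sub>R w 4" if v: "v \<in> tangent_space ?S z" for v
        proof -
          have "smooth_map_on (\<Phi> t ` ?Y) fst"
            unfolding smooth_map_on_def using smooth_on_bounded_linear[OF bounded_linear_fst, of UNIV] open_UNIV by blast
          moreover have "v \<in> tangent_space (\<Phi> t ` ?Y) (\<Phi> t (Psi \<alpha> s))" using v unfolding graph[OF t] z_def G_def by simp
          ultimately obtain d where "v = pd (0, d) G (t, s)"
            using tangent_space_image[OF alpha s\<Phi> t, of fst s v] s unfolding G_def \<Phi>_def by auto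
          then show ?thesis using pd_along_par[OF dG[OF t]] unfolding w_def by blast
        qed
        show "u \<in> tangent_space ?S z" if u: "u \<in> N" "\<forall>v\<in>tangent_space ?S z. B u v = 0" for u
        proof -
          have "u \<in> tangent_space M z" using u(1) N(3) by blast
          moreover have "thickening_form ?Y omega_std P z u v = 0" if "v \<in> tangent_space ?S z" for v
            using \<Omega>[of u v] u that N(3) MD SD' by auto
          ultimately show ?thesis using coi[OF t] zS unfolding coisotropic_submanifold_def by blast
        qed
      qed
    qed
  qed
qed

end

theorem theorem12p5:
  fixes \<alpha> :: real
  assumes "\<alpha> \<in> \<rat>" and "\<alpha> > 1"
  shows "coisotropic_submanifold UNIV omega_std (Y_alpha \<alpha>)
    \<and> presymplectic_manifold 3 1 (Y_alpha \<alpha>) omega_std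
    \<and> coisotropic_obstructed UNIV omega_std (Y_alpha \<alpha>)
    \<and> presymplectic_obstructed (Y_alpha \<alpha>) omega_std"
proof -
  obtain m n :: nat where n: "n \<noteq> 0" "\<bar>\<alpha>\<bar> = real m / real n"
    using Rats_abs_nat_div_natE[OF assms(1)] by metis
  then have nm: "real n * \<alpha> = real m" "n > 0" using assms(2) by (auto simp: field_simps)
  show ?thesis
    using coisotropic_Y_alpha[OF assms(2)] presymplectic_Y_alpha[OF assms(2)]
      Y_alpha_coisotropic_obstructed[OF assms(2) nm] Y_alpha_presymplectic_obstructed[OF assms(2) nm] by blast
qed

end
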